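(* Let $\operatorname{char}\mathbbm k\neq2$ and let $M=\langle a,b\rangle_{\mathbbm k}$ be the Yetter--Drinfel'd module over $\mathbbm kC_2$ described in the context, regarded as an $\varnothing$-magma in the braided monoidal category ${}^{\mathbbm kC_2}_{\mathbbm kC_2}\mathcal{YD}$. Then the polynomial identities with coefficients in $\mathbbm k$ of $M$ are generated by the set $$\begin{aligned}V_3:=\{\tau_{1,1}^4-\mathrm{id}_2\}&\cup\{\theta(\sigma_i^2\rho-\rho\sigma_i^2)\mid i=1,\dots,n-1,\ \rho\in PB_n,\ n\geqslant2\}\\&\cup\{q^{(n)}_{ij}\theta(\rho)-\theta(\rho)q^{(n)}_{ij}\mid 1\leqslant i<j\leqslant n,\ \rho\in B_n,\ n\geqslant2,\ \bar\rho(i)=i,\ \bar\rho(j)=j\}\\&\cup\{q^{(n)}_{\{\{1,\dots,i\},\{i+1,\dots,n\}\}}(\mathrm{id}_j\otimes\tau_{1,1}\otimes\mathrm{id}_{n-j-2})-q^{(n)}_{\{\{1,\dots,i\},\{i+1,\dots,n\}\}}\mid 0\leqslant i\leqslant n-1,\ 0\leqslant j\leqslant n-2,\ j\neq i-1\}.\end{aligned}$$ Moreover $c_{m,n}(M)=0$ for $m\neq n$, $c_{0,0}(M)=c_{1,1}(M)=1$, and for $n\geqslant2$, $c_{n,n}(M)=\frac12\binom{2n}{n}\sim\frac{4^n}{2\sqrt{\pi n}}$ as $n\to\infty$.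
   Context: $C_2=\{1,c\}$ is the cyclic group of order $2$. $M=\langle a,b\rangle_{\mathbbm k}$ is a left Yetter--Drinfel'd module over $\mathbbm kC_2$ with $ca=-a$, $cb=b$, $\delta a=1\otimes a$, $\delta b=c\otimes b$; the category ${}^{\mathbbm kC_2}_{\mathbbm kC_2}\mathcal{YD}$ of left Yetter--Drinfel'd modules is braided monoidal with braiding $\sigma_{X,Y}(x\otimes y)=x_{(-1)}y\otimes x_{(0)}$; on $M$: $\sigma(a\otimes a)=a\otimes a$, $\sigma(a\otimes b)=b\otimes a$, $\sigma(b\otimes a)=-a\otimes b$, $\sigma(b\otimes b)=b\otimes b$. $\mathcal M(\varnothing)$ is the free braided strict monoidal category on one object $1$ (objects $\mathbb Z_+$, $m\otimes n=m+n$, morphisms generated by identities, braidings $\tau_{m,n}$ and their inverses modulo the relations of a braided strict monoidal category); $\mathcal P(\mathbbm k,\varnothing)(m,n)$ is the vector space with basis $\mathcal M(\varnothing)(m,n)$. $\mathcal E_M\colon\mathcal P(\mathbbm k,\varnothing)\to{}^{\mathbbm kC_2}_{\mathbbm kC_2}\mathcal{YD}$ is the linear braided monoidal functor with $n\mapsto M^{\otimes n}$ and $\tau_{m,n}\mapsto$ the Yetter--Drinfel'd braiding $\sigma_{M^{\otimes m},M^{\otimes n}}$. $f$ is a polynomial identity of $M$ if $\mathcal E_M(f)=0$; for $V\subseteq\mathcal P(\mathbbm k,\varnothing)$, $\mathcal P_V(\mathbbm k,\varnothing)$ is the quotient by the smallest monoidal ideal containing $V$ (subspaces closed under composition on both sides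 and $\otimes$ with arbitrary morphisms); $V$ generates the identities of $M$ if its elements are identities of $M$ and every identity of $M$ has zero image in $\mathcal P_V(\mathbbm k,\varnothing)$. $c_{m,n}(M):=\dim\mathcal E_M(\mathcal P(\mathbbm k,\varnothing)(m,n))$. $B_n$ is the braid group with generators $\sigma_1,\dots,\sigma_{n-1}$; $\theta\colon\mathbbm kB_n\to\mathcal P(\mathbbm k,\varnothing)(n,n)$ is the linear map with $\theta(\sigma_i)=\mathrm{id}_{i-1}\otimes\tau_{1,1}\otimes\mathrm{id}_{n-i-1}$, multiplicative on braids. $\rho\mapsto\bar\rho$ is the surjection $B_n\to S_n$, $\sigma_i\mapsto(i\ i+1)$, and $PB_n$ its kernel. For $n\geqslant2$, $1\leqslant i<j\leqslant n$, fix $\rho_{ij}\in B_n$ with $\bar\rho_{ij}(1)=i$, $\bar\rho_{ij}(2)=j$ and set $q^{(n)}_{ij}:=\frac12\theta(\rho_{ij})(\mathrm{id}_n-\tau_{1,1}^2\otimes\mathrm{id}_{n-2})\theta(\rho_{ij})^{-1}$, $r^{(n)}_{ij}:=\frac12\theta(\rho_{ij})(\mathrm{id}_n+\tau_{1,1}^2\otimes\mathrm{id}_{n-2})\theta(\rho_{ij})^{-1}$, $q^{(n)}_{ji}:=q^{(n)}_{ij}$, $r^{(n)}_{ji}:=r^{(n)}_{ij}$. $\Xi_n$ is the set of unordered decompositions $\{I,\bar I\}$ with $I\sqcup\bar I=\{1,\dots,n\}$, $I,\bar I\neq\varnothing$; for $\{I,\bar I\}\in\Xi_n$, $q^{(n)}_{\{I,\bar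 I\}}:=\bigl(\prod_{i\in I,j\in\bar I}q^{(n)}_{ij}\bigr)\bigl(\prod_{i<j\in I}r^{(n)}_{ij}\bigr)\bigl(\prod_{i<j\in\bar I}r^{(n)}_{ij}\bigr)$ (products in a fixed order), and $q^{(n)}_{\{\varnothing,\{1,\dots,n\}\}}:=\mathrm{id}_n-\sum_{\{I,\bar I\}\in\Xi_n}q^{(n)}_{\{I,\bar I\}}$ (this is the case $i=0$ in $V_3$). *)

theory Defs
  imports Complex_Main "HOL-Library.Function_Algebras" "HOL-Library.Landau_Symbols"
begin

section \<open>Braid words: morphisms of the free braided strict monoidal category on one object\<close>

text \<open>A braid word is a list of signed Artin generators: (i, True) stands for
  sigma_i and (i, False) for sigma_i inverse (indices 1-based, as in the paper).
  Under theta, the generator sigma_i of B_n corresponds to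
  id_(i-1) (x) tau_(1,1) (x) id_(n-i-1) in M(empty)(n,n).\<close>

type_synonym bword = "(nat \<times> bool) list"

definition valid :: "nat \<Rightarrow> bword \<Rightarrow> bool" where
  "valid n w \<longleftrightarrow> (\<forall>(i, s) \<in> set w. 1 \<le> i \<and> i < n)"

inductive braid_eq :: "nat \<Rightarrow> bword \<Rightarrow> bword \<Rightarrow> bool" for n :: nat where
  be_refl: "braid_eq n u u"
| be_sym: "braid_eq n u v \<Longrightarrow> braid_eq n v u"
| be_trans: "braid_eq n u v \<Longrightarrow> braid_eq n v w \<Longrightarrow> braid_eq n u w"
| be_cong: "braid_eq n u v \<Longrightarrow> valid n x \<Longrightarrow> valid n y \<Longrightarrow> braid_eq n (x @ u @ y) (x @ v @ y)"
| be_cancel: "1 \<le> i \<Longrightarrow> i < n \<Longrightarrow> braid_eq n [(i, s), (i, \<not> s)] []"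
| be_far: "1 \<le> i \<Longrightarrow> i + 2 \<le> j \<Longrightarrow> j < n \<Longrightarrow>
            braid_eq n [(i, True), (j, True)] [(j, True), (i, True)]"
| be_braid: "1 \<le> i \<Longrightarrow> i + 1 < n \<Longrightarrow>
            braid_eq n [(i, True), (i + 1, True), (i, True)] [(i + 1, True), (i, True), (i + 1, True)]"

definition transp :: "nat \<Rightarrow> nat \<Rightarrow> nat" where
  "transp i k = (if k = i then i + 1 else if k = i + 1 then i else k)"

fun bar :: "bword \<Rightarrow> nat \<Rightarrow> nat" where
  "bar [] = id"
| "bar ((i, s) # w) = transp i \<circ> bar w"

definition winv :: "bword \<Rightarrow> bword" where
  "winv w = rev (map (\<lambda>(i, s). (i, \<not> s)) w)"

text \<open>Elements of P(k,empty)(n,n) are represented by finitely supported coefficient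
  functions on valid braid words; braid-equal words are identified by putting the
  differences into every ideal (see in_ideal).\<close>

definition delta :: "bword \<Rightarrow> bword \<Rightarrow> 'k::field" where
  "delta u w = (if w = u then 1 else 0)"

text \<open>Composition: the word u @ v corresponds to theta(u) composed with theta(v).\<close>
definition conv :: "(bword \<Rightarrow> 'k::field) \<Rightarrow> (bword \<Rightarrow> 'k) \<Rightarrow> bword \<Rightarrow> 'k" where
  "conv f g w = (\<Sum>k\<le>length w. f (take k w) * g (drop k w))"

definition tens_id_left :: "nat \<Rightarrow> (bword \<Rightarrow> 'k::field) \<Rightarrow> bword \<Rightarrow> 'k" where
  "tens_id_left m f w = (if (\<forall>(i, s) \<in> set w. m < i) then f (map (\<lambda>(i, s). (i - m, s)) w) else 0)"

definition prodl :: "(bword \<Rightarrow> 'k::field) list \<Rightarrow> bword \<Rightarrow> 'k" where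
  "prodl fs = foldr conv fs (delta [])"

definition fin_el :: "nat \<Rightarrow> (bword \<Rightarrow> 'k::field) \<Rightarrow> bool" where
  "fin_el n f \<longleftrightarrow> finite {w. f w \<noteq> 0} \<and> (\<forall>w. f w \<noteq> 0 \<longrightarrow> valid n w)"

inductive in_ideal :: "(nat \<Rightarrow> (bword \<Rightarrow> 'k::field) set) \<Rightarrow> nat \<Rightarrow> (bword \<Rightarrow> 'k) \<Rightarrow> bool"
  for G :: "nat \<Rightarrow> (bword \<Rightarrow> 'k::field) set" where
  ii_gen: "f \<in> G n \<Longrightarrow> in_ideal G n f"
| ii_rel: "braid_eq n u v \<Longrightarrow> valid n u \<Longrightarrow> valid n v \<Longrightarrow> in_ideal G n (\<lambda>w. delta u w - delta v w)"
| ii_zero: "in_ideal G n (\<lambda>w. 0)"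
| ii_add: "in_ideal G n f \<Longrightarrow> in_ideal G n g \<Longrightarrow> in_ideal G n (\<lambda>w. f w + g w)"
| ii_smult: "in_ideal G n f \<Longrightarrow> in_ideal G n (\<lambda>w. c * f w)"
| ii_lmul: "valid n u \<Longrightarrow> in_ideal G n f \<Longrightarrow> in_ideal G n (conv (delta u) f)"
| ii_rmul: "valid n u \<Longrightarrow> in_ideal G n f \<Longrightarrow> in_ideal G n (conv f (delta u))"
| ii_tens_right: "in_ideal G n f \<Longrightarrow> in_ideal G (n + m) f"
| ii_tens_left: "in_ideal G n f \<Longrightarrow> in_ideal G (m + n) (tens_id_left m f)"

text \<open>Basis of M^(tensor n): boolean lists of length n (False = a, True = b).
  Operators are matrices indexed by (output basis vector, input basis vector).\<close>

type_synonym 'k mat = "bool list \<Rightarrow> bool list \<Rightarrow> 'k"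

text \<open>sigma(e_p (x) e_q) = yd_sign p q * e_q (x) e_p; the sign is -1 exactly for p = b, q = a.\<close>
definition yd_sign :: "bool \<Rightarrow> bool \<Rightarrow> 'k::field" where
  "yd_sign p q = (if p \<and> \<not> q then -1 else 1)"

definition swapat :: "nat \<Rightarrow> bool list \<Rightarrow> bool list" where
  "swapat k x = x[k := x ! (k + 1), k + 1 := x ! k]"

definition genm :: "nat \<Rightarrow> nat \<times> bool \<Rightarrow> 'k::field mat" where
  "genm n g y x = (case g of (i, s) \<Rightarrow>
     (if length x = n \<and> length y = n \<and> y = swapat (i - 1) x
      then (if s then yd_sign (x ! (i - 1)) (x ! i) else yd_sign (x ! i) (x ! (i - 1)))
      else 0))"

definition idm :: "nat \<Rightarrow> 'k::field mat" where
  "idm n y x = (if length x = n \<and> y = x then 1 else 0)"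

definition matmul :: "nat \<Rightarrow> 'k::field mat \<Rightarrow> 'k mat \<Rightarrow> 'k mat" where
  "matmul n A B y x = (\<Sum>z \<in> {z. length z = n}. A y z * B z x)"

definition Eop :: "nat \<Rightarrow> bword \<Rightarrow> 'k::field mat" where
  "Eop n w = foldr (\<lambda>g A. matmul n (genm n g) A) w (idm n)"

definition Eval :: "nat \<Rightarrow> (bword \<Rightarrow> 'k::field) \<Rightarrow> 'k mat" where
  "Eval n f = (\<lambda>y x. \<Sum>w \<in> {w. f w \<noteq> 0}. f w * Eop n w y x)"

definition is_identity :: "nat \<Rightarrow> (bword \<Rightarrow> 'k::field) \<Rightarrow> bool" where
  "is_identity n f \<longleftrightarrow> fin_el n f \<and> Eval n f = (\<lambda>y x. 0)"

definition generates_identities :: "(nat \<Rightarrow> (bword \<Rightarrow> 'k::field) set) \<Rightarrow> bool" where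
  "generates_identities G \<longleftrightarrow>
     (\<forall>n f. f \<in> G n \<longrightarrow> is_identity n f) \<and> (\<forall>n f. is_identity n f \<longrightarrow> in_ideal G n f)"

definition mor :: "nat \<Rightarrow> nat \<Rightarrow> bword set" where
  "mor m n = {w. m = n \<and> valid n w}"

text \<open>c_(m,n)(M) = dim E_M(P(k,empty)(m,n)) = dimension of the span of the images of the basis.\<close>
definition codim :: "'k::field itself \<Rightarrow> nat \<Rightarrow> nat \<Rightarrow> nat" where
  "codim TYPE('k) m n = vector_space.dim (\<lambda>c (A :: 'k mat). (\<lambda>y x. c * A y x)) (Eop n ` mor m n)"

definition qel :: "(nat \<Rightarrow> nat \<Rightarrow> nat \<Rightarrow> bword) \<Rightarrow> nat \<Rightarrow> nat \<Rightarrow> nat \<Rightarrow> bword \<Rightarrow> 'k::field" where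
  "qel rho n i j = (\<lambda>w. (1/2) * conv (conv (delta (rho n i j))
        (\<lambda>v. delta [] v - delta [(1, True), (1, True)] v)) (delta (winv (rho n i j))) w)"

definition rel :: "(nat \<Rightarrow> nat \<Rightarrow> nat \<Rightarrow> bword) \<Rightarrow> nat \<Rightarrow> nat \<Rightarrow> nat \<Rightarrow> bword \<Rightarrow> 'k::field" where
  "rel rho n i j = (\<lambda>w. (1/2) * conv (conv (delta (rho n i j))
        (\<lambda>v. delta [] v + delta [(1, True), (1, True)] v)) (delta (winv (rho n i j))) w)"

definition qq :: "(nat \<Rightarrow> nat \<Rightarrow> nat \<Rightarrow> bword) \<Rightarrow> nat \<Rightarrow> nat \<Rightarrow> nat \<Rightarrow> bword \<Rightarrow> 'k::field" where
  "qq rho n i j = qel rho n (min i j) (max i j)"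

definition rr :: "(nat \<Rightarrow> nat \<Rightarrow> nat \<Rightarrow> bword) \<Rightarrow> nat \<Rightarrow> nat \<Rightarrow> nat \<Rightarrow> bword \<Rightarrow> 'k::field" where
  "rr rho n i j = rel rho n (min i j) (max i j)"

definition qdec :: "(nat \<Rightarrow> nat \<Rightarrow> nat \<Rightarrow> bword) \<Rightarrow> (nat \<Rightarrow> (nat \<times> nat) list) \<Rightarrow> nat \<Rightarrow> nat set
                     \<Rightarrow> bword \<Rightarrow> 'k::field" where
  "qdec rho pl n I =
     conv (conv (prodl (map (\<lambda>(i, j). qq rho n i j) (filter (\<lambda>(i, j). (i \<in> I) \<noteq> (j \<in> I)) (pl n))))
                (prodl (map (\<lambda>(i, j). rr rho n i j) (filter (\<lambda>(i, j). i \<in> I \<and> j \<in> I) (pl n)))))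
          (prodl (map (\<lambda>(i, j). rr rho n i j) (filter (\<lambda>(i, j). i \<notin> I \<and> j \<notin> I) (pl n))))"

text \<open>Unordered decompositions {I, complement I} in Xi_n, represented by the part containing 1.\<close>
definition Xi :: "nat \<Rightarrow> nat set set" where
  "Xi n = {I. I \<subseteq> {1..n} \<and> 1 \<in> I \<and> I \<noteq> {1..n}}"

definition qseg :: "(nat \<Rightarrow> nat \<Rightarrow> nat \<Rightarrow> bword) \<Rightarrow> (nat \<Rightarrow> (nat \<times> nat) list) \<Rightarrow> nat \<Rightarrow> nat
                     \<Rightarrow> bword \<Rightarrow> 'k::field" where
  "qseg rho pl n i = (if i = 0 then (\<lambda>w. delta [] w - (\<Sum>I \<in> Xi n. qdec rho pl n I w))
                      else qdec rho pl n {1..i})"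

definition V3 :: "(nat \<Rightarrow> nat \<Rightarrow> nat \<Rightarrow> bword) \<Rightarrow> (nat \<Rightarrow> (nat \<times> nat) list) \<Rightarrow> nat
                  \<Rightarrow> (bword \<Rightarrow> 'k::field) set" where
  "V3 rho pl n =
     {f. n = 2 \<and> f = (\<lambda>w. delta [(1, True), (1, True), (1, True), (1, True)] w - delta [] w)}
   \<union> {f. \<exists>i \<sigma>. 2 \<le> n \<and> 1 \<le> i \<and> i \<le> n - 1 \<and> valid n \<sigma> \<and> bar \<sigma> = id \<and>
         f = (\<lambda>w. delta ([(i, True), (i, True)] @ \<sigma>) w - delta (\<sigma> @ [(i, True), (i, True)]) w)}
   \<union> {f. \<exists>i j \<sigma>. 2 \<le> n \<and> 1 \<le> i \<and> i < j \<and> j \<le> n \<and> valid n \<sigma> \<and> bar \<sigma> i = i \<and> bar \<sigma> j = j \<and>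
         f = (\<lambda>w. conv (qq rho n i j) (delta \<sigma>) w - conv (delta \<sigma>) (qq rho n i j) w)}
   \<union> {f. \<exists>i j. i < n \<and> j + 2 \<le> n \<and> j + 1 \<noteq> i \<and>
         f = (\<lambda>w. conv (qseg rho pl n i) (delta [(j + 1, True)]) w - qseg rho pl n i w)}"

end

(*
  Conjugates of the squares of the Artin generators act on the tensor power of M diagonally: t_ij has
  the sign -1 on a basis vector x exactly if x_i and x_j differ.  Modulo the ideal, the t_ij become
  commuting involutions permuted by braids, so (1 - t_ij)/2 and (1 + t_ij)/2 are commuting idempotents,
  and the generators with i = 0 make 1 the sum of the idempotents of the two-colourings of {1..n}
  up to exchanging the colours.  For the idempotent p of a two-colouring c, pure braids act on p by
  signs; by the Coxeter presentation of S_n, p w depends up to sign only on the permutation of w,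
  and by the generators with i > 0 only on the colouring c o w.  Hence the quotient is spanned by one
  element for each pair (c, c o w), and these have linearly independent images, because the
  corresponding matrices have disjoint supports.  Counting the pairs gives half the number of
  pairs of words in a, b of the same weight, i.e. half the central binomial coefficient.
*)
theory Submission
  imports Defs "HOL-Library.Poly_Mapping" "HOL-Combinatorics.Permutations" "HOL-Analysis.Gamma_Function"
begin

section \<open>Braid words and their permutations\<close>

text \<open>The main obstacle is that the sign with which a word acts on a colouring is not a
  function of its permutation: the square of a generator gives -1 on unequal colours. The same sign
  appears when the word is multiplied onto the idempotent, so the product of both
  (\<open>NN\<close>) respects all Coxeter relations. Since the generators with i > 0 concern only
  segments {1..i}, other colourings are first carried to a segment by a braid; two words with the
  same effect on a segment then differ by an element of the Young subgroup S_i x S_(n-i), whose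
  generators are absorbed. Completeness is read off entrywise: in p F, each spanning element gets as
  coefficient an entry of the operator of F. The class of constant colourings is treated apart,
  through the remainder \<open>Q0\<close>, which absorbs every braid. The t_ij only see whether two
  colours agree, so the idempotents cut out the rows of a colouring and of its complement together,
  and a word has one nonzero entry in each. Their ratio \<open>msign2\<close> depends only on the
  position of the entry; this is why the dimension is half the number of pairs and not more.\<close>

lemma valid_Nil [simp]: "valid n []"
  by (simp add: valid_def)

lemma valid_Cons [simp]: "valid n (g # w) \<longleftrightarrow> 1 \<le> fst g \<and> fst g < n \<and> valid n w"
  by (cases g) (auto simp: valid_def)

lemma valid_append [simp]: "valid n (u @ v) \<longleftrightarrow> valid n u \<and> valid n v"
  by (auto simp: valid_def)

lemma valid_mono: "valid m w \<Longrightarrow> m \<le> n \<Longrightarrow> valid n w"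
  by (fastforce simp: valid_def)

lemma valid_le_1: "valid n w \<Longrightarrow> n \<le> 1 \<Longrightarrow> w = []"
  by (cases w) auto

lemma winv_Nil [simp]: "winv [] = []"
  by (simp add: winv_def)

lemma winv_Cons [simp]: "winv ((i, s) # w) = winv w @ [(i, \<not> s)]"
  by (simp add: winv_def)

lemma winv_append [simp]: "winv (u @ v) = winv v @ winv u"
  by (simp add: winv_def)

lemma valid_winv [simp]: "valid n (winv w) \<longleftrightarrow> valid n w"
  by (induction w) auto

lemma winv_winv [simp]: "winv (winv w) = w"
  by (induction w) auto

lemma transp_transp [simp]: "transp i (transp i k) = k"
  by (simp add: transp_def)

lemma transp_self [simp]: "transp i i = Suc i" "transp i (Suc i) = i"
  by (auto simp: transp_def)

lemma transp_braid: "transp i (transp (Suc i) (transp i k)) = transp (Suc i) (transp i (transp (Suc i) k))"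
  by (auto simp: transp_def)

lemma bar_append: "bar (u @ v) = bar u \<circ> bar v"
  by (induction u rule: bar.induct) auto

lemma bar_append_apply [simp]: "bar (u @ v) k = bar u (bar v k)"
  by (simp add: bar_append)

lemma bar_winv [simp]: "bar (winv u) (bar u k) = k"
  by (induction u arbitrary: k) auto

lemma bar_winv' [simp]: "bar u (bar (winv u) k) = k"
  using bar_winv[of "winv u" k] by simp

lemma bij_bar: "bij (bar u)"
  by (rule bijI'[OF _ exI[of _ "bar (winv u) _"]]) (metis bar_winv, simp)

lemma inj_bar: "inj (bar u)"
  using bij_bar bij_is_inj by blast

lemma bar_eq_iff [simp]: "bar u k = bar u l \<longleftrightarrow> k = l"
  using inj_bar by (auto simp: inj_def)

lemma bar_outside: "valid n u \<Longrightarrow> k \<notin> {1..n} \<Longrightarrow> bar u k = k"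
  by (induction u) (auto simp: transp_def)

lemma bar_permutes: "valid n u \<Longrightarrow> bar u permutes {1..n}"
  using bij_bar[of u] bar_outside[of n u] unfolding permutes_def bij_iff by simp

lemma bar_range [simp]: "valid n u \<Longrightarrow> bar u k \<in> {1..n} \<longleftrightarrow> k \<in> {1..n}"
  using permutes_in_image[OF bar_permutes] by blast

lemma bar_bounds: "valid n u \<Longrightarrow> 1 \<le> k \<Longrightarrow> k \<le> n \<Longrightarrow> 1 \<le> bar u k \<and> bar u k \<le> n"
  using bar_range[of n u k] by simp

section \<open>The Coxeter presentation of the symmetric group\<close>

text \<open>Permutations are presented on the same signed words as braids, so an extra rule forgets
  the exponent of a letter. Unlike \<open>braid_eq\<close>, the relation only holds between valid
  words, which makes validity available in inductions.\<close>

inductive cox_eq :: "nat \<Rightarrow> bword \<Rightarrow> bword \<Rightarrow> bool" for n :: nat where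
  cox_refl: "valid n u \<Longrightarrow> cox_eq n u u"
| cox_sym: "cox_eq n u v \<Longrightarrow> cox_eq n v u"
| cox_trans: "cox_eq n u v \<Longrightarrow> cox_eq n v w \<Longrightarrow> cox_eq n u w"
| cox_cong: "cox_eq n u v \<Longrightarrow> valid n x \<Longrightarrow> valid n y \<Longrightarrow> cox_eq n (x @ u @ y) (x @ v @ y)"
| cox_sign: "1 \<le> i \<Longrightarrow> i < n \<Longrightarrow> cox_eq n [(i, s)] [(i, t)]"
| cox_square: "1 \<le> i \<Longrightarrow> i < n \<Longrightarrow> cox_eq n [(i, True), (i, True)] []"
| cox_far: "1 \<le> i \<Longrightarrow> i + 2 \<le> j \<Longrightarrow> j < n \<Longrightarrow>
            cox_eq n [(i, True), (j, True)] [(j, True), (i, True)]"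
| cox_braid: "1 \<le> i \<Longrightarrow> i + 1 < n \<Longrightarrow>
            cox_eq n [(i, True), (i + 1, True), (i, True)] [(i + 1, True), (i, True), (i + 1, True)]"

lemma cox_eq_valid: "cox_eq n u v \<Longrightarrow> valid n u \<and> valid n v"
  by (induction rule: cox_eq.induct) auto

lemma cox_eq_bar: "cox_eq n u v \<Longrightarrow> bar u = bar v"
proof (induction rule: cox_eq.induct)
  case (cox_far i j)
  then show ?case by (auto simp: fun_eq_iff transp_def)
qed (auto simp: bar_append fun_eq_iff transp_braid)

lemma cox_eq_mono: "cox_eq m u v \<Longrightarrow> m \<le> n \<Longrightarrow> cox_eq n u v"
proof (induction rule: cox_eq.induct)
  case (cox_trans u v w)
  then show ?case by (meson cox_eq.cox_trans)
next
  case (cox_cong u v x y)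
  then show ?case by (meson cox_eq.cox_cong valid_mono)
next
  case (cox_braid i)
  then show ?case by (intro cox_eq.cox_braid) auto
qed (auto intro: cox_eq.intros valid_mono)

lemma cox_append: "cox_eq n u u' \<Longrightarrow> cox_eq n v v' \<Longrightarrow> cox_eq n (u @ v) (u' @ v')"
  using cox_cong[of n u u' "[]" v] cox_cong[of n v v' u' "[]"] cox_eq_valid
  by (fastforce intro: cox_trans)

abbreviation pos :: "nat list \<Rightarrow> bword" where
  "pos \<equiv> map (\<lambda>j. (j, True))"

lemma cox_commute:
  assumes "\<forall>i \<in> set d. i + 2 \<le> j \<or> j + 2 \<le> i" "valid n (pos d)" "1 \<le> j" "j < n"
  shows "cox_eq n (pos (d @ [j])) (pos (j # d))"
  using assms
proof (induction d)
  case Nil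
  then show ?case by (auto intro: cox_refl)
next
  case (Cons i d)
  have "cox_eq n ([(i, True)] @ pos (d @ [j]) @ []) ([(i, True)] @ pos (j # d) @ [])"
    using Cons by (intro cox_cong) auto
  moreover have "cox_eq n [(i, True), (j, True)] [(j, True), (i, True)]"
    using Cons.prems by (auto intro: cox_far cox_sym[OF cox_far])
  from cox_cong[OF this, of "[]" "pos d"]
  have "cox_eq n (pos (i # j # d)) (pos (j # i # d))" using Cons.prems by simp
  ultimately show ?case by (auto intro: cox_trans)
qed

text \<open>The products s_m s_(m-1) ... s_k, with k = m+1 giving the empty word: the usual
  representatives of the cosets of S_m in S_(m+1).\<close>

definition desc :: "nat \<Rightarrow> nat \<Rightarrow> nat list" where
  "desc m k = rev [k..<Suc m]"

lemma desc_empty [simp]: "desc m (Suc m) = []"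
  by (simp add: desc_def)

lemma set_desc [simp]: "set (desc m k) = {k..m}"
  by (auto simp: desc_def)

lemma desc_snoc: "k \<le> m \<Longrightarrow> desc m k = desc m (Suc k) @ [k]"
  by (simp add: desc_def upt_conv_Cons)

lemma desc_split: "k \<le> Suc l \<Longrightarrow> l \<le> m \<Longrightarrow> desc m k = desc m (Suc l) @ desc l k"
proof -
  assume "k \<le> Suc l" "l \<le> m"
  then have "[k..<Suc m] = [k..<Suc l] @ [Suc l..<Suc m]"
    using upt_add_eq_append[of k "Suc l" "m - l"] by auto
  then show ?thesis unfolding desc_def by simp
qed

lemma valid_pos: "valid n (pos d) \<longleftrightarrow> (\<forall>i \<in> set d. 1 \<le> i \<and> i < n)"
  by (auto simp: valid_def)

lemma bar_desc: "k \<le> Suc m \<Longrightarrow> bar (pos (desc m k)) k = Suc m"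
proof (induction "Suc m - k" arbitrary: k)
  case 0
  then have "k = Suc m" by simp
  then show ?case by simp
next
  case (Suc d)
  then show ?case by (simp add: desc_snoc)
qed

text \<open>Right multiplication by s_j permutes the cosets: it lengthens the descent if j = k - 1,
  shortens it if j = k, and otherwise fixes the coset and leaves a single letter of S_m on the
  left.\<close>

lemma desc_mult:
  assumes "1 \<le> k" "k \<le> Suc m" "1 \<le> j" "j \<le> m"
  shows "\<exists>w' k'. valid m w' \<and> 1 \<le> k' \<and> k' \<le> Suc m \<and>
           cox_eq (Suc m) (pos (desc m k @ [j])) (w' @ pos (desc m k'))"
proof -
  consider "j + 1 < k" | "j + 1 = k" | "j = k" | "k < j" by linarith
  then show ?thesis
  proof cases
    case 1
    then have "cox_eq (Suc m) (pos (desc m k @ [j])) (pos [j] @ pos (desc m k))"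
      using assms cox_commute[of "desc m k" j "Suc m"] by (auto simp: valid_pos)
    then show ?thesis using assms 1 by (intro exI[of _ "pos [j]"] exI[of _ k]) auto
  next
    case 2
    then have "desc m k @ [j] = desc m j" using assms desc_snoc[of j m] by simp
    then show ?thesis using assms
      by (intro exI[of _ "[]"] exI[of _ j]) (auto intro: cox_refl simp: valid_pos)
  next
    case 3
    have "cox_eq (Suc m) (pos (desc m (Suc k)) @ [(k, True), (k, True)] @ []) (pos (desc m (Suc k)) @ [] @ [])"
      using assms 3 by (intro cox_cong cox_square) (auto simp: valid_pos)
    then have "cox_eq (Suc m) (pos (desc m k @ [j])) (pos (desc m (Suc k)))"
      using 3 assms by (simp add: desc_snoc)
    then show ?thesis using assms 3 by (intro exI[of _ "[]"] exI[of _ "Suc k"]) auto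
  next
    case 4
    \<comment> \<open>The descent is split around its letters j, i = j - 1. The new j commutes with
      the tail \<open>L\<close>, the braid relation turns j i j into i j i, and the first i commutes
      with the head \<open>D\<close>; s_j on the right thus becomes s_(j-1) on the left.\<close>
    then obtain i where j: "j = Suc i" by (cases j) auto
    define D where "D = desc m (Suc j)"
    define L where "L = desc (i - 1) k"
    have i: "1 \<le> i" "k \<le> i" using 4 assms j by auto
    have "desc m k = D @ desc j k" using desc_split[of k j m] 4 assms by (simp add: D_def)
    also have "desc j k = [j] @ desc i k" using desc_split[of k i j] i j desc_snoc[of j j] by simp
    also have "desc i k = [i] @ L" using desc_split[of k "i - 1" i] i desc_snoc[of i i] by (simp add: L_def)
    finally have dk: "desc m k = D @ [j, i] @ L" by simp
    have vD: "valid (Suc m) (pos D)" and vL: "valid (Suc m) (pos L)"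
      using assms i j by (auto simp: D_def L_def valid_pos)
    have "cox_eq (Suc m) (pos (L @ [j])) (pos (j # L))"
      using assms j i vL by (intro cox_commute) (auto simp: L_def)
    from cox_cong[OF this, of "pos (D @ [j, i])" "[]"]
    have 1: "cox_eq (Suc m) (pos (desc m k @ [j])) (pos (D @ [j, i, j] @ L))"
      using assms j i vD by (simp add: dk)
    have "cox_eq (Suc m) [(i, True), (j, True), (i, True)] [(j, True), (i, True), (j, True)]"
      using cox_braid[of i "Suc m"] assms j i by simp
    from cox_cong[OF cox_sym[OF this], of "pos D" "pos L"]
    have 2: "cox_eq (Suc m) (pos (D @ [j, i, j] @ L)) (pos (D @ [i, j, i] @ L))"
      using vD vL by simp
    have "cox_eq (Suc m) (pos (D @ [i])) (pos (i # D))"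
      using assms j i vD by (intro cox_commute) (auto simp: D_def)
    from cox_cong[OF this, of "[]" "pos ([j, i] @ L)"]
    have 3: "cox_eq (Suc m) (pos (D @ [i, j, i] @ L)) (pos [i] @ pos (desc m k))"
      using assms j i vL by (simp add: dk)
    have "cox_eq (Suc m) (pos (desc m k @ [j])) (pos [i] @ pos (desc m k))"
      using 1 2 3 by (blast intro: cox_trans)
    then show ?thesis using assms i j by (intro exI[of _ "pos [i]"] exI[of _ k]) auto
  qed
qed

lemma cox_normal_form:
  "valid (Suc m) w \<Longrightarrow> \<exists>w' k. valid m w' \<and> 1 \<le> k \<and> k \<le> Suc m \<and> cox_eq (Suc m) w (w' @ pos (desc m k))"
proof (induction w rule: rev_induct)
  case Nil
  then show ?case by (intro exI[of _ "[]"] exI[of _ "Suc m"]) (auto intro: cox_refl)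
next
  case (snoc g v)
  obtain j s where g: "g = (j, s)" by (cases g)
  from snoc obtain v' k where v': "valid m v'" "1 \<le> k" "k \<le> Suc m" "cox_eq (Suc m) v (v' @ pos (desc m k))"
    by auto
  have j: "1 \<le> j" "j \<le> m" using snoc.prems g by auto
  obtain w' k' where w': "valid m w'" "1 \<le> k'" "k' \<le> Suc m"
    "cox_eq (Suc m) (pos (desc m k @ [j])) (w' @ pos (desc m k'))"
    using desc_mult[of k m j] v' j by blast
  have "cox_eq (Suc m) (v @ [g]) ((v' @ pos (desc m k)) @ [(j, True)])"
    using v' j g by (intro cox_append) (auto intro: cox_sign)
  moreover have "cox_eq (Suc m) (v' @ pos (desc m k @ [j])) (v' @ (w' @ pos (desc m k')))"
    using v' w' valid_mono[of m v' "Suc m"] by (intro cox_append) (auto intro: cox_refl)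
  ultimately have "cox_eq (Suc m) (v @ [g]) ((v' @ w') @ pos (desc m k'))"
    by (auto intro: cox_trans)
  then show ?case using v' w' by (intro exI[of _ "v' @ w'"] exI[of _ k']) auto
qed

text \<open>The preimage of \<open>Suc m\<close> under the permutation is the index of the coset, so
  the normal forms of two words with equal permutations have the same tail. Cancelling it leaves
  words on \<open>m\<close> strands with equal permutations.\<close>

theorem cox_eq_if_bar_eq:
  "valid n u \<Longrightarrow> valid n v \<Longrightarrow> bar u = bar v \<Longrightarrow> cox_eq n u v"
proof (induction n arbitrary: u v)
  case 0
  then show ?case using valid_le_1[of 0] by (auto intro: cox_refl)
next
  case (Suc m)
  obtain u' k where u': "valid m u'" "1 \<le> k" "k \<le> Suc m" "cox_eq (Suc m) u (u' @ pos (desc m k))"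
    using cox_normal_form Suc.prems by blast
  obtain v' l where v': "valid m v'" "1 \<le> l" "l \<le> Suc m" "cox_eq (Suc m) v (v' @ pos (desc m l))"
    using cox_normal_form Suc.prems by blast
  have bu: "bar u = bar (u' @ pos (desc m k))" and bv: "bar v = bar (v' @ pos (desc m l))"
    using u' v' cox_eq_bar by blast+
  have "bar u k = Suc m" using bu u' by (simp add: bar_desc bar_outside)
  moreover have "bar v l = Suc m" using bv v' by (simp add: bar_desc bar_outside)
  ultimately have kl: "k = l" using Suc.prems bar_eq_iff by metis
  have "bar u' = bar v'"
  proof
    fix x
    have "bar (u' @ pos (desc m k)) (bar (winv (pos (desc m k))) x)
        = bar (v' @ pos (desc m k)) (bar (winv (pos (desc m k))) x)"
      using bu bv kl Suc.prems by metis
    then show "bar u' x = bar v' x" by simp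
  qed
  then have "cox_eq (Suc m) u' v'" using Suc.IH u' v' cox_eq_mono[of m _ _ "Suc m"] by simp
  then have "cox_eq (Suc m) (u' @ pos (desc m k)) (v' @ pos (desc m l))"
    unfolding kl using v' by (intro cox_append) (auto intro!: cox_refl simp: valid_pos)
  then show ?case using u' v' by (meson cox_sym cox_trans)
qed

section \<open>Lifting permutations to words\<close>

lemma transpose_lift:
  assumes "1 \<le> a" "a \<le> b"
  shows "\<exists>d. set d \<subseteq> {a..<b} \<and> bar (pos d) = Transposition.transpose a b"
  using assms(2)
proof (induction b rule: dec_induct)
  case base
  then show ?case by (intro exI[of _ "[]"]) auto
next
  case (step b)
  then obtain d where d: "set d \<subseteq> {a..<b}" "bar (pos d) = Transposition.transpose a b" by blast
  have tr: "transp b = Transposition.transpose b (Suc b)"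
    by (auto simp: fun_eq_iff transp_def Transposition.transpose_def)
  show ?case
  proof (cases "a = b")
    case True
    then show ?thesis by (intro exI[of _ "[b]"]) (auto simp: tr)
  next
    case False
    have "bar (pos ([b] @ d @ [b])) = Transposition.transpose a (Suc b)"
      using False step d by (auto simp: bar_append d tr fun_eq_iff Transposition.transpose_def)
    then show ?thesis using d step by (intro exI[of _ "[b] @ d @ [b]"]) auto
  qed
qed

text \<open>The bound on the letters matters: a permutation of one block lifts to a word that never
  crosses the border of the block.\<close>

lemma permutation_lift:
  assumes "p permutes {a..b}" "1 \<le> a"
  shows "\<exists>d. set d \<subseteq> {a..<b} \<and> bar (pos d) = p"
  using assms(1) finite_atLeastAtMost
proof (induction rule: permutes_induct)
  case id
  then show ?case by (intro exI[of _ "[]"]) auto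
next
  case (swap x y p)
  then obtain d where d: "set d \<subseteq> {a..<b}" "bar (pos d) = p" by blast
  have "\<exists>e. set e \<subseteq> {a..<b} \<and> bar (pos e) = Transposition.transpose x y"
  proof (cases "x \<le> y")
    case True
    then show ?thesis using transpose_lift[of x y] swap assms(2) by fastforce
  next
    case False
    then show ?thesis using transpose_lift[of y x] swap assms(2)
      by (fastforce simp: transpose_commute[of x y])
  qed
  then obtain e where "set e \<subseteq> {a..<b}" "bar (pos e) = Transposition.transpose x y" by blast
  then show ?case using d by (intro exI[of _ "e @ d"]) (auto simp: bar_append)
qed

section \<open>The free monoid algebra and its quotient by an ideal\<close>

text \<open>\<open>Poly_Mapping\<close> convolves along \<open>+\<close>, so words are wrapped in a
  type whose addition is concatenation. This makes \<open>wd \<Rightarrow>\<^sub>0 'k\<close> the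
  free monoid algebra, with its ring structure for free.\<close>

datatype wd = Wd (unWd: bword)

instantiation wd :: monoid_add
begin

definition "u + v = Wd (unWd u @ unWd v)"
definition "0 = Wd []"

instance by standard (auto simp: plus_wd_def zero_wd_def)

end

definition W :: "bword \<Rightarrow> wd \<Rightarrow>\<^sub>0 'k::field" where
  "W u = Poly_Mapping.single (Wd u) 1"

definition C :: "'k \<Rightarrow> wd \<Rightarrow>\<^sub>0 'k::field" where
  "C c = Poly_Mapping.single 0 c"

definition cf :: "(wd \<Rightarrow>\<^sub>0 'k) \<Rightarrow> bword \<Rightarrow> 'k::field" where
  "cf F w = Poly_Mapping.lookup F (Wd w)"

lemma cf_eqI: "(\<And>w. cf F w = cf H w) \<Longrightarrow> F = H"
  by (rule poly_mapping_eqI) (metis cf_def wd.collapse)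

lemma cf_add: "cf (F + H) w = cf F w + cf H w"
  and cf_diff: "cf (F - H) w = cf F w - cf H w"
  and cf_0: "cf 0 w = 0"
  and cf_sum: "cf (\<Sum>x\<in>A. f x) w = (\<Sum>x\<in>A. cf (f x) w)"
  by (simp_all add: cf_def lookup_add lookup_minus lookup_sum)

lemma cf_W: "cf (W u) = delta u"
  by (auto simp: fun_eq_iff cf_def W_def delta_def lookup_single when_def)

lemma W_Nil [simp]: "W [] = 1"
  by (simp add: W_def flip: zero_wd_def)

lemma cf_1: "cf 1 = delta []"
  unfolding W_Nil[symmetric] cf_W ..

lemma W_append: "W (u @ v) = W u * W v"
  by (simp add: W_def mult_single plus_wd_def)

lemma C_0 [simp]: "C 0 = 0" and C_1 [simp]: "C 1 = 1"
  by (simp_all add: C_def)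

lemma C_mult: "C (a * b) = C a * C b"
  by (simp add: C_def mult_single)

lemma C_add: "C (a + b) = C a + C b"
  by (simp add: C_def single_add)

lemma C_minus: "C (- a) = - C a"
  by (simp add: C_def single_uminus)

lemma C_sum: "C (\<Sum>x\<in>A. f x) = (\<Sum>x\<in>A. C (f x))"
  by (induction A rule: infinite_finite_induct) (auto simp: C_add)

text \<open>A factorisation of \<open>w\<close> in the word monoid is a split at some position, so
  the general convolution collapses to the finite sum in \<open>conv\<close>.\<close>

lemma cf_mult: "cf (F * H) = conv (cf F) (cf H)"
proof
  fix w
  let ?f = "\<lambda>l. Poly_Mapping.lookup F l * (Groups_Big_Fun.Sum_any (\<lambda>q. Poly_Mapping.lookup H q when Wd w = l + q))"
  have *: "Wd w = Wd (take k w) + q \<longleftrightarrow> q = Wd (drop k w)" for k q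
    by (cases q) (simp add: plus_wd_def, metis append_same_eq append_take_drop_id same_append_eq)
  have "cf (F * H) w = Sum_any ?f"
    by (simp add: cf_def lookup_mult prod_fun_def)
  also have "\<dots> = sum ?f ((\<lambda>k. Wd (take k w)) ` {..length w})"
  proof (rule Sum_any.expand_superset)
    show "{l. ?f l \<noteq> 0} \<subseteq> (\<lambda>k. Wd (take k w)) ` {..length w}"
    proof
      fix l assume "l \<in> {l. ?f l \<noteq> 0}"
      then have "Groups_Big_Fun.Sum_any (\<lambda>q. Poly_Mapping.lookup H q when Wd w = l + q) \<noteq> 0" by auto
      then have "\<exists>q. Wd w = l + q" by (rule contrapos_np) simp
      then obtain q where "Wd w = l + q" ..
      then have w: "w = unWd l @ unWd q" by (simp add: plus_wd_def)
      then have "l = Wd (take (length (unWd l)) w)" "length (unWd l) \<le> length w"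
        unfolding w by simp_all
      then show "l \<in> (\<lambda>k. Wd (take k w)) ` {..length w}" by blast
    qed
  qed simp
  also have "\<dots> = (\<Sum>k\<le>length w. ?f (Wd (take k w)))"
    by (subst sum.reindex) (auto simp: inj_on_def dest: arg_cong[of _ _ length])
  also have "\<dots> = conv (cf F) (cf H) w"
    by (simp add: conv_def * cf_def)
  finally show "cf (F * H) w = conv (cf F) (cf H) w" .
qed

lemma cf_C: "cf (C c) w = (if w = [] then c else 0)"
  by (auto simp: cf_def C_def lookup_single when_def zero_wd_def)

lemma cf_C_mult: "cf (C c * F) w = c * cf F w"
proof -
  have "cf (C c) (take k w) * cf F (drop k w) = (if k = 0 then c * cf F w else 0)"
    if "k \<le> length w" for k using that by (auto simp: cf_C)
  then have "cf (C c * F) w = (\<Sum>k\<le>length w. (if k = 0 then c * cf F w else 0))"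
    unfolding cf_mult conv_def by (intro sum.cong) simp_all
  then show ?thesis by simp
qed

lemma C_comm: "F * C c = C c * F"
proof (rule cf_eqI)
  fix w
  have "cf F (take k w) * cf (C c) (drop k w) = (if k = length w then c * cf F w else 0)"
    if "k \<le> length w" for k using that by (auto simp: cf_C)
  then have "cf (F * C c) w = (\<Sum>k\<le>length w. (if k = length w then c * cf F w else 0))"
    unfolding cf_mult conv_def by (intro sum.cong) simp_all
  then show "cf (F * C c) w = cf (C c * F) w" by (simp add: cf_C_mult)
qed

lemma finite_cf: "finite {w. cf F w \<noteq> 0}"
proof -
  have "{w. cf F w \<noteq> 0} = unWd ` {k. Poly_Mapping.lookup F k \<noteq> 0}"
    by (force simp: cf_def image_iff)
  then show ?thesis by simp
qed

lemma fa_expand: "F = (\<Sum>w\<in>{w. cf F w \<noteq> 0}. C (cf F w) * W w)"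
  by (rule cf_eqI) (simp add: cf_sum cf_C_mult cf_W delta_def finite_cf sum.delta' if_distrib cong: if_cong)

lemma ex_cf: "finite {w. f w \<noteq> 0} \<Longrightarrow> \<exists>F. cf F = f"
proof (intro exI[of _ "Abs_poly_mapping (f \<circ> unWd)"] ext)
  fix w assume fin: "finite {w. f w \<noteq> 0}"
  have "{k. (f \<circ> unWd) k \<noteq> 0} = Wd ` {w. f w \<noteq> 0}"
    by (force simp: image_iff)
  then have "finite {k. (f \<circ> unWd) k \<noteq> 0}" using fin by simp
  then show "cf (Abs_poly_mapping (f \<circ> unWd)) w = f w"
    by (simp add: cf_def)
qed

definition res :: "nat \<Rightarrow> (bword \<Rightarrow> 'k::field) \<Rightarrow> bword \<Rightarrow> 'k" where
  "res n f w = (if valid n w then f w else 0)"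

lemma valid_take_drop: "valid n (take k w) \<and> valid n (drop k w) \<longleftrightarrow> valid n w"
  by (metis append_take_drop_id valid_append)

text \<open>A word is valid exactly if both parts of any split of it are valid; hence discarding the
  invalid words is multiplicative.\<close>

lemma res_conv: "res n (conv f g) = conv (res n f) (res n g)"
proof
  fix w
  show "res n (conv f g) w = conv (res n f) (res n g) w"
  proof (cases "valid n w")
    case True
    then show ?thesis using valid_take_drop[of n _ w] by (auto simp: res_def conv_def)
  next
    case False
    then have "res n f (take k w) * res n g (drop k w) = 0" for k
      using valid_take_drop[of n k w] by (auto simp: res_def)
    then show ?thesis using False unfolding conv_def by (simp only: sum.neutral_const) (simp add: res_def)
  qed
qed

lemma res_smult: "res n (\<lambda>w. c * f w) = (\<lambda>w. c * res n f w)"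
  by (auto simp: res_def)

lemma res_delta: "valid n u \<Longrightarrow> res n (delta u) = delta u"
  by (auto simp: res_def delta_def)

lemma conv_0: "conv (\<lambda>w. 0) f = (\<lambda>w. 0)" "conv f (\<lambda>w. 0) = (\<lambda>w. 0)"
  by (auto simp: conv_def)

lemma res_0: "res n (cf 0) = (\<lambda>w. 0)"
  by (auto simp: res_def cf_0)

lemma cf_C_mult_fun: "cf (C c * F) = (\<lambda>w. c * cf F w)"
  by (rule ext) (rule cf_C_mult)

definition vsupp :: "nat \<Rightarrow> (wd \<Rightarrow>\<^sub>0 'k::field) \<Rightarrow> bool" where
  "vsupp n F \<longleftrightarrow> (\<forall>w. cf F w \<noteq> 0 \<longrightarrow> valid n w)"

lemma vsupp_res: "vsupp n F \<longleftrightarrow> res n (cf F) = cf F"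
  by (auto simp: vsupp_def res_def fun_eq_iff)

lemma fin_el_cf: "fin_el n (cf F) \<longleftrightarrow> vsupp n F"
  by (auto simp: fin_el_def vsupp_def finite_cf)

lemma vsupp_mult: "vsupp n F \<Longrightarrow> vsupp n H \<Longrightarrow> vsupp n (F * H)"
  by (simp add: vsupp_res cf_mult res_conv)

lemma vsupp_add: "vsupp n F \<Longrightarrow> vsupp n H \<Longrightarrow> vsupp n (F + H)"
  by (force simp: vsupp_def cf_add)

lemma vsupp_diff: "vsupp n F \<Longrightarrow> vsupp n H \<Longrightarrow> vsupp n (F - H)"
  by (force simp: vsupp_def cf_diff)

lemma vsupp_0: "vsupp n 0"
  by (simp add: vsupp_def cf_0)

lemma vsupp_sum: "(\<And>x. x \<in> A \<Longrightarrow> vsupp n (f x)) \<Longrightarrow> vsupp n (\<Sum>x\<in>A. f x)"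
  by (induction A rule: infinite_finite_induct) (auto intro: vsupp_add vsupp_0)

lemma vsupp_W: "valid n u \<Longrightarrow> vsupp n (W u)"
  by (simp add: vsupp_def cf_W delta_def)

lemma vsupp_1: "vsupp n 1"
  using vsupp_W[of n "[]"] by simp

lemma vsupp_C: "vsupp n (C c)"
  using cf_C_mult[of c 1] by (auto simp: vsupp_def cf_1 delta_def split: if_splits)

lemma vsupp_prod_list: "(\<And>x. x \<in> set xs \<Longrightarrow> vsupp n x) \<Longrightarrow> vsupp n (prod_list xs)"
  by (induction xs) (auto intro: vsupp_mult vsupp_1)

lemmas vsupp_intros = vsupp_mult vsupp_add vsupp_diff vsupp_0 vsupp_1 vsupp_W vsupp_C vsupp_sum vsupp_prod_list

text \<open>Words that are not valid on n strands are discarded before testing membership in the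
  ideal; this makes the relation below a ring congruence on the algebra of all words, so that no
  validity side conditions are needed when multiplying.\<close>

locale ideal_cong =
  fixes G :: "nat \<Rightarrow> (bword \<Rightarrow> 'k::field) set" and n :: nat
begin

definition eqv :: "(wd \<Rightarrow>\<^sub>0 'k) \<Rightarrow> (wd \<Rightarrow>\<^sub>0 'k) \<Rightarrow> bool" (infix \<open>\<doteq>\<close> 50) where
  "F \<doteq> H \<longleftrightarrow> in_ideal G n (res n (cf (F - H)))"

text \<open>The ideal is closed only under multiplication by one valid word. An arbitrary factor is
  expanded into words, of which the invalid ones contribute 0 after \<open>res\<close>.\<close>

lemma eqv_0_mult_left:
  assumes "F \<doteq> 0"
  shows "A * F \<doteq> 0"
proof -
  have W: "in_ideal G n (res n (cf (C c * W u * F)))" for c u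
  proof (cases "valid n u")
    case True
    have "res n (cf (C c * W u * F)) = (\<lambda>w. c * conv (delta u) (res n (cf F)) w)"
      unfolding mult.assoc cf_C_mult_fun res_smult
      using True by (simp add: cf_mult res_conv cf_W res_delta)
    then show ?thesis using ii_smult[OF ii_lmul[OF True]] assms by (simp add: eqv_def)
  next
    case False
    have "res n (delta u) = (\<lambda>w. 0 :: 'k)" using False by (auto simp: res_def delta_def)
    then have "res n (cf (C c * W u * F)) = (\<lambda>w. 0)"
      by (simp add: res_conv cf_mult cf_W conv_0)
    then show ?thesis by (simp add: ii_zero)
  qed
  have S: "finite S \<Longrightarrow> in_ideal G n (res n (cf ((\<Sum>w\<in>S. C (c w) * W w) * F)))" for S c
  proof (induction S rule: finite_induct)
    case empty
    then show ?case by (simp add: res_0 ii_zero)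
  next
    case (insert x S)
    have "res n (cf ((\<Sum>w\<in>insert x S. C (c w) * W w) * F)) =
      (\<lambda>w. res n (cf (C (c x) * W x * F)) w + res n (cf ((\<Sum>w\<in>S. C (c w) * W w) * F)) w)"
      using insert by (auto simp: fun_eq_iff res_def distrib_right cf_add)
    then show ?case using ii_add[OF W insert.IH] by simp
  qed
  show ?thesis
    using S[OF finite_cf[of A], of "cf A"] by (simp add: eqv_def flip: fa_expand)
qed

lemma eqv_0_mult_right:
  assumes "F \<doteq> 0"
  shows "F * A \<doteq> 0"
proof -
  have W: "in_ideal G n (res n (cf (F * (C c * W u))))" for c u
  proof (cases "valid n u")
    case True
    have "res n (cf (F * (C c * W u))) = (\<lambda>w. c * conv (res n (cf F)) (delta u) w)"
      unfolding mult.assoc[symmetric] C_comm unfolding mult.assoc cf_C_mult_fun res_smult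
      using True by (simp add: cf_mult res_conv cf_W res_delta)
    then show ?thesis using ii_smult[OF ii_rmul[OF True]] assms by (simp add: eqv_def)
  next
    case False
    have "res n (delta u) = (\<lambda>w. 0 :: 'k)" using False by (auto simp: res_def delta_def)
    then have "res n (cf (F * (C c * W u))) = (\<lambda>w. 0)"
      by (simp add: res_conv cf_mult cf_W conv_0)
    then show ?thesis by (simp add: ii_zero)
  qed
  have S: "finite S \<Longrightarrow> in_ideal G n (res n (cf (F * (\<Sum>w\<in>S. C (c w) * W w))))" for S c
  proof (induction S rule: finite_induct)
    case empty
    then show ?case by (simp add: res_0 ii_zero)
  next
    case (insert x S)
    have "res n (cf (F * (\<Sum>w\<in>insert x S. C (c w) * W w))) =
      (\<lambda>w. res n (cf (F * (C (c x) * W x))) w + res n (cf (F * (\<Sum>w\<in>S. C (c w) * W w))) w)"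
      using insert by (auto simp: fun_eq_iff res_def distrib_left cf_add)
    then show ?case using ii_add[OF W insert.IH] by simp
  qed
  show ?thesis
    using S[OF finite_cf[of A], of "cf A"] by (simp add: eqv_def flip: fa_expand)
qed

lemma eqv_iff_diff: "F \<doteq> H \<longleftrightarrow> F - H \<doteq> 0"
  by (simp add: eqv_def)

lemma eqv_refl [simp, intro]: "F \<doteq> F"
  by (simp add: eqv_def res_0 ii_zero)

lemma eqv_0_add: "F \<doteq> 0 \<Longrightarrow> H \<doteq> 0 \<Longrightarrow> F + H \<doteq> 0"
proof -
  assume "F \<doteq> 0" "H \<doteq> 0"
  then have "in_ideal G n (\<lambda>w. res n (cf F) w + res n (cf H) w)"
    by (intro ii_add) (simp_all add: eqv_def)
  moreover have "(\<lambda>w. res n (cf F) w + res n (cf H) w) = res n (cf (F + H))"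
    by (auto simp: res_def cf_add)
  ultimately show ?thesis by (simp add: eqv_def)
qed

lemma eqv_sym: "F \<doteq> H \<Longrightarrow> H \<doteq> F"
  using eqv_0_mult_left[of "F - H" "- 1"] by (simp add: eqv_iff_diff[of F H] eqv_iff_diff[of H F])

lemma eqv_trans [trans]: "F \<doteq> H \<Longrightarrow> H \<doteq> K \<Longrightarrow> F \<doteq> K"
  using eqv_0_add[of "F - H" "H - K"]
  by (simp add: eqv_iff_diff[of F H] eqv_iff_diff[of H K] eqv_iff_diff[of F K])

lemma eqv_add: "F \<doteq> F' \<Longrightarrow> H \<doteq> H' \<Longrightarrow> F + H \<doteq> F' + H'"
  using eqv_0_add[of "F - F'" "H - H'"]
  by (simp add: eqv_iff_diff[of F F'] eqv_iff_diff[of H H'] eqv_iff_diff[of "F + H" "F' + H'"] algebra_simps)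

lemma eqv_mult: 
  assumes "F \<doteq> F'" "H \<doteq> H'"
  shows "F * H \<doteq> F' * H'"
proof -
  have "(F - F') * H \<doteq> 0" "F' * (H - H') \<doteq> 0"
    using assms eqv_0_mult_left eqv_0_mult_right by (simp_all add: eqv_iff_diff[of F F'] eqv_iff_diff[of H H'])
  from eqv_0_add[OF this] show ?thesis
    by (simp add: eqv_iff_diff[of "F * H" "F' * H'"] algebra_simps)
qed

lemma eqv_minus: "F \<doteq> F' \<Longrightarrow> - F \<doteq> - F'"
  using eqv_mult[OF eqv_refl[of "- 1"], of F F'] by simp

lemma eqv_diff: "F \<doteq> F' \<Longrightarrow> H \<doteq> H' \<Longrightarrow> F - H \<doteq> F' - H'"
  using eqv_add[of F F' "- H" "- H'"] eqv_minus by simp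

lemma eqv_sum: "(\<And>x. x \<in> A \<Longrightarrow> f x \<doteq> g x) \<Longrightarrow> (\<Sum>x\<in>A. f x) \<doteq> (\<Sum>x\<in>A. g x)"
  by (induction A rule: infinite_finite_induct) (auto intro: eqv_add)

lemma eqv_mult_left: "H \<doteq> H' \<Longrightarrow> F * H \<doteq> F * H'"
  by (simp add: eqv_mult)

lemma eqv_mult_right: "F \<doteq> F' \<Longrightarrow> F * H \<doteq> F' * H"
  by (simp add: eqv_mult)

lemma eqv_0_if_in_ideal: "in_ideal G n (cf F) \<Longrightarrow> vsupp n F \<Longrightarrow> F \<doteq> 0"
  by (simp add: eqv_def vsupp_res)

lemma in_ideal_if_eqv_0: "F \<doteq> 0 \<Longrightarrow> vsupp n F \<Longrightarrow> in_ideal G n (cf F)"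
  by (simp add: eqv_def vsupp_res)

lemma W_braid_eq: "braid_eq n u v \<Longrightarrow> valid n u \<Longrightarrow> valid n v \<Longrightarrow> W u \<doteq> W v"
proof -
  assume *: "braid_eq n u v" "valid n u" "valid n v"
  have "cf (W u - W v) = (\<lambda>w. delta u w - delta v w :: 'k)" by (auto simp: cf_diff cf_W)
  then have "W u - W v \<doteq> 0"
    using * ii_rel[of n u v G] by (intro eqv_0_if_in_ideal) (auto intro: vsupp_intros)
  then show ?thesis by (simp add: eqv_iff_diff[of "W u"])
qed

lemma W_far:
  "1 \<le> i \<Longrightarrow> i + 2 \<le> j \<Longrightarrow> j < n \<Longrightarrow> W [(i, True), (j, True)] \<doteq> W [(j, True), (i, True)]"
  by (rule W_braid_eq) (auto intro: be_far)

lemma W_braid: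
  "1 \<le> i \<Longrightarrow> i + 1 < n \<Longrightarrow>
    W [(i, True), (i + 1, True), (i, True)] \<doteq> W [(i + 1, True), (i, True), (i + 1, True)]"
  by (rule W_braid_eq, rule be_braid) auto

lemma W_winv: "valid n u \<Longrightarrow> W u * W (winv u) \<doteq> 1"
proof (induction u)
  case (Cons g u)
  obtain i s where g: "g = (i, s)" by (cases g)
  have "W (g # u) * W (winv (g # u)) = W [g] * (W u * W (winv u)) * W [(i, \<not> s)]"
    by (simp add: g mult.assoc flip: W_append)
  also have "\<dots> \<doteq> W [g] * 1 * W [(i, \<not> s)]"
    using Cons by (intro eqv_mult eqv_refl) auto
  also have "W [g] * 1 * W [(i, \<not> s)] = W [(i, s), (i, \<not> s)]" by (simp add: g flip: W_append)
  also have "\<dots> \<doteq> W []" using Cons.prems g by (intro W_braid_eq be_cancel) auto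
  finally show ?case by simp
qed simp

end

section \<open>Evaluation on colourings\<close>

text \<open>Basis vectors are also viewed as colourings of the positions 1 to n; row c of the
  operator of a word w has a single nonzero entry, namely msign c w in column c \<circ> bar w.\<close>

definition sg :: "(nat \<Rightarrow> bool) \<Rightarrow> nat \<times> bool \<Rightarrow> 'k::field" where
  "sg c g = (case g of (i, s) \<Rightarrow> if s then yd_sign (c (Suc i)) (c i) else yd_sign (c i) (c (Suc i)))"

fun msign :: "(nat \<Rightarrow> bool) \<Rightarrow> bword \<Rightarrow> 'k::field" where
  "msign c [] = 1"
| "msign c (g # w) = sg c g * msign (c \<circ> transp (fst g)) w"

lemma sg_square [simp]: "sg c g * sg c g = 1"
  by (auto simp: sg_def yd_sign_def split: prod.splits)

lemma msign_append: "msign c (u @ v) = msign c u * msign (c \<circ> bar u) v"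
  by (induction u arbitrary: c) (auto simp: comp_assoc)

lemma msign_square [simp]: "msign c w * msign c w = 1"
proof (induction w arbitrary: c)
  case (Cons g w)
  have "msign c (g # w) * msign c (g # w) =
    (sg c g * sg c g) * (msign (c \<circ> transp (fst g)) w * msign (c \<circ> transp (fst g)) w :: 'a)"
    by (simp only: msign.simps ac_simps)
  then show ?case using Cons by simp
qed simp

lemma msign_square' [simp]: "msign c w * (msign c w * a) = a"
  by (simp flip: mult.assoc)

lemma msign_cong:
  "valid n w \<Longrightarrow> (\<And>k. k \<in> {1..n} \<Longrightarrow> c k = d k) \<Longrightarrow> msign c w = msign d w"
proof (induction w arbitrary: c d)
  case (Cons g w)
  have "msign (c \<circ> transp (fst g)) w = (msign (d \<circ> transp (fst g)) w :: 'a)"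
    using Cons.prems by (intro Cons.IH) (auto simp: transp_def)
  then show ?case using Cons.prems by (auto simp: sg_def split: prod.splits)
qed simp

lemma msign_const:
  "valid n w \<Longrightarrow> (\<And>k. k \<in> {1..n} \<Longrightarrow> c k = b) \<Longrightarrow> msign c w = 1"
proof (induction w arbitrary: c)
  case (Cons g w)
  have "msign (c \<circ> transp (fst g)) w = (1 :: 'a)"
    using Cons.prems by (intro Cons.IH) (auto simp: transp_def)
  then show ?case using Cons.prems by (auto simp: sg_def yd_sign_def split: prod.splits)
qed simp

lemma msign_double: "msign c [(i, True), (i, True)] = (if c i \<noteq> c (Suc i) then - 1 else 1)"
  by (auto simp: sg_def yd_sign_def)

text \<open>The word \<open>u @ winv u\<close> has sign 1 on every colouring, and a sign is its own
  inverse.\<close>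

lemma msign_winv: "msign (c \<circ> bar u) (winv u) = msign c u"
proof -
  have "msign c (u @ winv u) = (1 :: 'a)"
  proof (induction u arbitrary: c)
    case (Cons g u)
    obtain i s where g: "g = (i, s)" by (cases g)
    have b: "c \<circ> transp i \<circ> bar (u @ winv u) = c \<circ> transp i"
      by (auto simp: fun_eq_iff)
    have "(msign c ((g # u) @ winv (g # u)) :: 'a) = sg c g * msign (c \<circ> transp i) ((u @ winv u) @ [(i, \<not> s)])"
      by (simp add: g)
    also have "\<dots> = sg c g * sg (c \<circ> transp i) (i, \<not> s)"
      unfolding msign_append[of "c \<circ> transp i" "u @ winv u"] b using Cons[of "c \<circ> transp i"]
      by (simp add: o_def)
    also have "\<dots> = (1 :: 'a)" by (auto simp: g sg_def yd_sign_def)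
    finally show ?case .
  qed simp
  then have "msign c u * (msign c u * msign (c \<circ> bar u) (winv u)) = (msign c u :: 'a)"
    by (simp only: msign_append mult.right_neutral)
  then show ?thesis by simp
qed

text \<open>The relative sign of a word on a colouring and on its complement; unlike msign it is
  invariant under Coxeter equivalence.\<close>

definition msign2 :: "(nat \<Rightarrow> bool) \<Rightarrow> bword \<Rightarrow> 'k::field" where
  "msign2 c w = msign c w * msign (\<lambda>k. \<not> c k) w"

lemma msign2_append: "msign2 c (u @ v) = msign2 c u * msign2 (c \<circ> bar u) v"
  by (simp add: msign2_def msign_append o_def)

lemma msign_braid:
  "msign c [(i, True), (i + 1, True), (i, True)] = msign c [(i + 1, True), (i, True), (i + 1, True)]"
  by (simp add: sg_def transp_def)

lemma msign_far:
  "i + 2 \<le> j \<Longrightarrow> msign c [(i, True), (j, True)] = msign c [(j, True), (i, True)]"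
  by (simp add: sg_def transp_def)

text \<open>On unequal colours exactly one of the colouring and its complement gives -1, whatever
  the exponent of the letter. So the relative sign of a letter does not see the exponent, and that
  of a square is 1.\<close>

lemma cox_eq_msign2: "cox_eq n u v \<Longrightarrow> msign2 c u = msign2 c v"
proof (induction arbitrary: c rule: cox_eq.induct)
  case (cox_cong u v x y)
  then have "bar u = bar v" using cox_eq_bar by blast
  then show ?case by (simp only: msign2_append cox_cong.IH)
next
  case (cox_sign i s t)
  then show ?case by (auto simp: msign2_def sg_def yd_sign_def)
next
  case (cox_square i)
  then show ?case by (auto simp: msign2_def sg_def yd_sign_def)
next
  case (cox_far i j)
  then show ?case by (simp only: msign2_def msign_far[OF cox_far(2)])
next
  case (cox_braid i)
  then show ?case by (simp only: msign2_def msign_braid)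
qed auto

text \<open>Positions are 1-based, to match \<open>bar\<close>. Values outside \<open>{1..n}\<close>
  carry no meaning, which explains the congruence lemmas restricted to that range.\<close>

definition col :: "bool list \<Rightarrow> nat \<Rightarrow> bool" where
  "col y k = y ! (k - 1)"

definition lst :: "nat \<Rightarrow> (nat \<Rightarrow> bool) \<Rightarrow> bool list" where
  "lst n c = map c [1..<Suc n]"

lemma length_lst [simp]: "length (lst n c) = n"
  by (simp add: lst_def)

lemma nth_lst [simp]: "k < n \<Longrightarrow> lst n c ! k = c (Suc k)"
  by (simp add: lst_def del: upt_Suc)

lemma col_lst [simp]: "1 \<le> k \<Longrightarrow> k \<le> n \<Longrightarrow> col (lst n c) k = c k"
  by (simp add: col_def)

lemma lst_eq_iff: "lst n c = lst n d \<longleftrightarrow> (\<forall>k\<in>{1..n}. c k = d k)"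
  by (auto simp: lst_def)

lemma lst_col [simp]: "length y = n \<Longrightarrow> lst n (col y) = y"
  by (auto intro!: nth_equalityI simp: col_def)

lemma lst_col_lst: "valid n u \<Longrightarrow> lst n (col (lst n c) \<circ> bar u) = lst n (c \<circ> bar u)"
  by (auto simp: lst_eq_iff dest: bar_bounds intro!: col_lst)

lemma Eop_Nil: "Eop n [] y x = (if length y = n \<and> y = x then 1 else 0)"
  by (auto simp: Eop_def idm_def)

lemma Eop_Cons: "Eop n (g # w) y x = (\<Sum>z\<in>{z. length z = n}. genm n g y z * Eop n w z x)"
  by (simp add: Eop_def matmul_def)

lemma finite_length: "finite {z :: bool list. length z = n}"
  using finite_lists_length_eq[of "UNIV :: bool set" n] by simp

lemma Eop_wrong_length: "length y \<noteq> n \<Longrightarrow> Eop n w y x = 0"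
  by (cases w) (auto simp: Eop_Nil Eop_Cons genm_def split: prod.splits)

text \<open>Swapping is an involution, so the output vector determines the only input that
  contributes to its row.\<close>

lemma swapat_iff:
  assumes "length y = n" "length z = n" "1 \<le> i" "i < n"
  shows "y = swapat (i - 1) z \<longleftrightarrow> z = lst n (col y \<circ> transp i)"
proof -
  have *: "swapat (i - 1) z = lst n (col z \<circ> transp i)" if "length z = n" for z
  proof (rule nth_equalityI)
    fix k assume k: "k < length (swapat (i - 1) z)"
    obtain j where j: "i = Suc j" using assms(3) by (cases i) auto
    from k that have "k < n" by (simp add: swapat_def)
    then show "swapat (i - 1) z ! k = lst n (col z \<circ> transp i) ! k"
      using that assms(4) j by (auto simp: swapat_def nth_list_update transp_def col_def)
  qed (use that in \<open>simp add: swapat_def\<close>)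
  have inv: "lst n (col (lst n (col z \<circ> transp i)) \<circ> transp i) = z" if "length z = n" for z
  proof -
    have "lst n (col (lst n (col z \<circ> transp i)) \<circ> bar [(i, True)]) = lst n (col z \<circ> transp i \<circ> bar [(i, True)])"
      using assms by (intro lst_col_lst) auto
    then show ?thesis using that by (simp add: comp_def)
  qed
  show ?thesis using * inv assms by metis
qed

lemma Eop_Cons':
  assumes "length y = n" "1 \<le> i" "i < n"
  shows "Eop n ((i, s) # w) y x = sg (col y) (i, s) * Eop n w (lst n (col y \<circ> transp i)) x"
proof -
  let ?z = "lst n (col y \<circ> transp i)"
  \<comment> \<open>\<open>genm\<close> reads its sign from the input and \<open>sg\<close> from the
    output; the two letters have changed places in between, which is why the arguments of
    \<open>yd_sign\<close> are exchanged.\<close>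
  have g: "genm n (i, s) y z = (if z = ?z then sg (col y) (i, s) else 0)" if "length z = n" for z
    using that assms swapat_iff[of y n z i]
    by (auto simp: genm_def sg_def)
  have "Eop n ((i, s) # w) y x = (\<Sum>z\<in>{z. length z = n}. if z = ?z then sg (col y) (i, s) * Eop n w z x else 0)"
    unfolding Eop_Cons by (intro sum.cong) (auto simp: g)
  then show ?thesis by (simp add: finite_length)
qed

lemma Eop_append:
  "length y = n \<Longrightarrow> valid n u \<Longrightarrow>
    Eop n (u @ w) y x = msign (col y) u * Eop n w (lst n (col y \<circ> bar u)) x"
proof (induction u arbitrary: y)
  case (Cons g u)
  obtain i s where g: "g = (i, s)" by (cases g)
  let ?z = "lst n (col y \<circ> transp i)"
  have 1: "msign (col ?z) u = (msign (col y \<circ> transp i) u :: 'a)"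
    using Cons.prems by (intro msign_cong[of n]) auto
  have 2: "lst n (col ?z \<circ> bar u) = lst n (col y \<circ> transp i \<circ> bar u)"
    using Cons.prems by (intro lst_col_lst) auto
  show ?case using Cons.prems Cons.IH[of ?z] 
    by (simp add: g Eop_Cons' 1[unfolded o_def] 2[unfolded o_def] o_def)
qed simp

lemma Eop_eq:
  "valid n u \<Longrightarrow> Eop n u y x =
    (if length y = n \<and> x = lst n (col y \<circ> bar u) then msign (col y) u else 0)"
  using Eop_append[of y n u "[]" x] by (cases "length y = n") (auto simp: Eop_Nil Eop_wrong_length)

definition Ev :: "nat \<Rightarrow> (wd \<Rightarrow>\<^sub>0 'k::field) \<Rightarrow> 'k mat" where
  "Ev n F = Eval n (cf F)"

lemma Ev_superset:
  "finite S \<Longrightarrow> {w. cf F w \<noteq> 0} \<subseteq> S \<Longrightarrow> Ev n F y x = (\<Sum>w\<in>S. cf F w * Eop n w y x)"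
  unfolding Ev_def Eval_def by (intro sum.mono_neutral_left) auto

lemma Ev_add: "Ev n (F + H) y x = Ev n F y x + Ev n H y x"
proof -
  let ?S = "{w. cf F w \<noteq> 0} \<union> {w. cf H w \<noteq> 0}"
  have "finite ?S" by (simp add: finite_cf)
  then show ?thesis
    using Ev_superset[of ?S "F + H" n y x] Ev_superset[of ?S F n y x] Ev_superset[of ?S H n y x]
    by (force simp: cf_add distrib_right sum.distrib)
qed

lemma Ev_C: "Ev n (C c * F) y x = c * Ev n F y x"
proof -
  have "{w. cf (C c * F) w \<noteq> 0} \<subseteq> {w. cf F w \<noteq> 0}" by (auto simp: cf_C_mult)
  from Ev_superset[OF finite_cf this] show ?thesis
    by (simp add: Ev_superset[OF finite_cf order_refl] cf_C_mult mult.assoc sum_distrib_left)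
qed

lemma Ev_0: "Ev n 0 y x = 0"
  by (simp add: Ev_def Eval_def cf_0)

lemma Ev_diff: "Ev n (F - H) y x = Ev n F y x - Ev n H y x"
  using Ev_add[of n "F - H" H y x] by simp

lemma Ev_sum: "Ev n (\<Sum>a\<in>A. f a) y x = (\<Sum>a\<in>A. Ev n (f a) y x)"
  by (induction A rule: infinite_finite_induct) (auto simp: Ev_add Ev_0)

lemma Ev_W: "Ev n (W u) y x = Eop n u y x"
proof -
  have "{w. cf (W u :: wd \<Rightarrow>\<^sub>0 'a) w \<noteq> 0} \<subseteq> {u}" by (auto simp: cf_W delta_def)
  from Ev_superset[OF _ this] show ?thesis by (simp add: cf_W delta_def)
qed

lemma Ev_wrong_length: "length y \<noteq> n \<Longrightarrow> Ev n F y x = 0"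
  by (simp add: Ev_def Eval_def Eop_wrong_length)

lemma Ev_W_mult:
  assumes "length y = n" "valid n u"
  shows "Ev n (W u * F) y x = msign (col y) u * Ev n F (lst n (col y \<circ> bar u)) x"
proof -
  let ?S = "{w. cf F w \<noteq> 0}"
  have F: "F = (\<Sum>w\<in>?S. C (cf F w) * W w)" by (rule fa_expand)
  have "W u * F = (\<Sum>w\<in>?S. C (cf F w) * W (u @ w))"
    by (subst F) (simp add: sum_distrib_left W_append C_comm[of "W u", symmetric] flip: mult.assoc)
  then have "Ev n (W u * F) y x = msign (col y) u * (\<Sum>w\<in>?S. cf F w * Eop n w (lst n (col y \<circ> bar u)) x)"
    by (simp add: Ev_sum Ev_C Ev_W Eop_append assms sum_distrib_left ac_simps)
  also have "(\<Sum>w\<in>?S. cf F w * Eop n w (lst n (col y \<circ> bar u)) x) = Ev n F (lst n (col y \<circ> bar u)) x"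
    by (rule Ev_superset[OF finite_cf order_refl, symmetric])
  finally show ?thesis .
qed

text \<open>Quantifying over all right factors \<open>F\<close> lets diagonal elements be multiplied
  without a product formula for \<open>Ev\<close>.\<close>

definition acts_diag :: "nat \<Rightarrow> (wd \<Rightarrow>\<^sub>0 'k::field) \<Rightarrow> (bool list \<Rightarrow> 'k) \<Rightarrow> bool" where
  "acts_diag n D d \<longleftrightarrow> (\<forall>F y x. length y = n \<longrightarrow> Ev n (D * F) y x = d y * Ev n F y x)"

lemma acts_diagD: "acts_diag n D d \<Longrightarrow> length y = n \<Longrightarrow> Ev n (D * F) y x = d y * Ev n F y x"
  by (simp add: acts_diag_def)

lemma acts_diag_1: "acts_diag n 1 (\<lambda>y. 1)"
  by (simp add: acts_diag_def)

lemma acts_diag_mult: "acts_diag n D d \<Longrightarrow> acts_diag n E e \<Longrightarrow> acts_diag n (D * E) (\<lambda>y. d y * e y)"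
  by (simp add: acts_diag_def mult.assoc)

lemma acts_diag_C: "acts_diag n D d \<Longrightarrow> acts_diag n (C c * D) (\<lambda>y. c * d y)"
  by (simp add: acts_diag_def mult.assoc Ev_C)

lemma acts_diag_add: "acts_diag n D d \<Longrightarrow> acts_diag n E e \<Longrightarrow> acts_diag n (D + E) (\<lambda>y. d y + e y)"
  by (simp add: acts_diag_def distrib_right Ev_add)

lemma acts_diag_diff: "acts_diag n D d \<Longrightarrow> acts_diag n E e \<Longrightarrow> acts_diag n (D - E) (\<lambda>y. d y - e y)"
  by (simp add: acts_diag_def left_diff_distrib Ev_diff)

lemma acts_diag_sum:
  "(\<And>a. a \<in> A \<Longrightarrow> acts_diag n (D a) (d a)) \<Longrightarrow> acts_diag n (\<Sum>a\<in>A. D a) (\<lambda>y. \<Sum>a\<in>A. d a y)"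
  by (simp add: acts_diag_def sum_distrib_right Ev_sum)

lemma acts_diag_prod_list:
  "(\<And>a. a \<in> set L \<Longrightarrow> acts_diag n (D a) (\<lambda>y. if p a y then 1 else 0)) \<Longrightarrow>
    acts_diag n (prod_list (map D L)) (\<lambda>y. if \<forall>a\<in>set L. p a y then 1 else 0)"
proof (induction L)
  case Nil
  then show ?case by (simp add: acts_diag_1)
next
  case (Cons a L)
  then have "acts_diag n (D a * prod_list (map D L))
      (\<lambda>y. (if p a y then 1 else 0) * (if \<forall>a\<in>set L. p a y then 1 else 0))"
    by (intro acts_diag_mult) auto
  moreover have "(\<lambda>y. (if p a y then 1 else 0) * (if \<forall>a\<in>set L. p a y then 1 else 0)) =
      (\<lambda>y. if \<forall>a\<in>set (a # L). p a y then 1 else (0 :: 'b))" by auto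
  ultimately show ?case by simp
qed

lemma acts_diag_pure:
  assumes "valid n u" "bar u = id"
  shows "acts_diag n (W u) (\<lambda>y. msign (col y) u)"
  using assms by (simp add: acts_diag_def Ev_W_mult)

lemma is_identityI:
  assumes "cf F = f" "vsupp n F" "\<And>y x. length y = n \<Longrightarrow> Ev n F y x = 0"
  shows "is_identity n f"
  using assms Ev_wrong_length[of _ n F] fin_el_cf[of n F]
  by (fastforce simp: is_identity_def fun_eq_iff Ev_def)

lemma cf_prod_list: "cf (prod_list (map g L)) = prodl (map (\<lambda>a. cf (g a)) L)"
  by (induction L) (auto simp: prodl_def cf_1 cf_mult)

section \<open>The generating identities hold in M\<close>

locale magma_identities = ideal_cong G n
  for G :: "nat \<Rightarrow> (bword \<Rightarrow> 'k::field) set" and n :: nat +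
  fixes rho :: "nat \<Rightarrow> nat \<Rightarrow> nat \<Rightarrow> bword" and pl :: "nat \<Rightarrow> (nat \<times> nat) list"
  assumes two: "(2 :: 'k) \<noteq> 0"
    and n2: "2 \<le> n"
    and rho: "\<And>i j. 1 \<le> i \<Longrightarrow> i < j \<Longrightarrow> j \<le> n \<Longrightarrow>
      valid n (rho n i j) \<and> bar (rho n i j) 1 = i \<and> bar (rho n i j) 2 = j"
    and distinct_pl: "distinct (pl n)"
    and set_pl: "set (pl n) = {(i, j). 1 \<le> i \<and> i < j \<and> j \<le> n}"
    and G: "G = V3 rho pl"
begin

text \<open>Extends the chosen conjugators to unordered pairs, since braids move indices without
  respecting their order.\<close>

definition rw :: "nat \<Rightarrow> nat \<Rightarrow> bword" where
  "rw i j = rho n (min i j) (max i j)"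

definition tw :: "nat \<Rightarrow> nat \<Rightarrow> bword" where
  "tw i j = rw i j @ [(1, True), (1, True)] @ winv (rw i j)"

definition pair :: "nat \<Rightarrow> nat \<Rightarrow> bool" where
  "pair i j \<longleftrightarrow> i \<noteq> j \<and> i \<in> {1..n} \<and> j \<in> {1..n}"

lemma pair_set_pl: "(i, j) \<in> set (pl n) \<Longrightarrow> pair i j"
  by (auto simp: set_pl pair_def)

lemma rw_commute: "rw i j = rw j i"
  by (simp add: rw_def min.commute max.commute)

lemma tw_commute: "tw i j = tw j i"
  by (simp add: tw_def rw_commute)

lemma rw:
  assumes "pair i j"
  shows "valid n (rw i j)" "{bar (rw i j) 1, bar (rw i j) 2} = {i, j}"
  using rho[of "min i j" "max i j"] assms
  by (auto simp: pair_def rw_def min_def max_def split: if_splits)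

lemma valid_tw: "pair i j \<Longrightarrow> valid n (tw i j)"
  using rw n2 by (simp add: tw_def)

lemma bar_tw: "bar (tw i j) = id"
  by (simp add: tw_def fun_eq_iff)

lemma msign_tw:
  assumes "pair i j"
  shows "msign c (tw i j) = (if c i \<noteq> c j then - 1 else 1 :: 'k)"
proof -
  let ?r = "rw i j"
  have "msign c (tw i j) = msign c ?r * (msign (c \<circ> bar ?r) [(1, True), (1, True)] *
     msign (c \<circ> bar ?r \<circ> bar [(1, True), (1, True)]) (winv ?r) :: 'k)"
    by (simp only: tw_def msign_append)
  also have "c \<circ> bar ?r \<circ> bar [(1, True), (1, True)] = c \<circ> bar ?r" by (simp add: fun_eq_iff)
  also have "msign (c \<circ> bar ?r) (winv ?r) = (msign c ?r :: 'k)" by (rule msign_winv)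
  also have "msign c ?r * (msign (c \<circ> bar ?r) [(1, True), (1, True)] * msign c ?r) =
      (msign (c \<circ> bar ?r) [(1, True), (1, True)] :: 'k)"
    by (simp only: mult.commute[of _ "msign c ?r"] msign_square')
  also have "\<dots> = (if c (bar ?r 1) \<noteq> c (bar ?r 2) then - 1 else 1)"
    unfolding msign_double by (simp add: numeral_2_eq_2)
  also have "\<dots> = (if c i \<noteq> c j then - 1 else 1)"
    using rw(2)[OF assms] by (auto simp: doubleton_eq_iff)
  finally show ?thesis .
qed

definition qE :: "nat \<Rightarrow> nat \<Rightarrow> wd \<Rightarrow>\<^sub>0 'k" where
  "qE i j = C (1 / 2) * (W (rw i j) * (1 - W [(1, True), (1, True)]) * W (winv (rw i j)))"

definition rE :: "nat \<Rightarrow> nat \<Rightarrow> wd \<Rightarrow>\<^sub>0 'k" where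
  "rE i j = C (1 / 2) * (W (rw i j) * (1 + W [(1, True), (1, True)]) * W (winv (rw i j)))"

text \<open>In the algebra of words the conjugate of 1 stays an uncancelled word; it becomes 1 only
  modulo the ideal. Its operator is the identity, as \<open>acts_diag_rr\<close> shows.\<close>

lemma qE_eq: "qE i j = C (1 / 2) * (W (rw i j @ winv (rw i j)) - W (tw i j))"
  unfolding qE_def tw_def W_append by (simp add: algebra_simps)

lemma rE_eq: "rE i j = C (1 / 2) * (W (rw i j @ winv (rw i j)) + W (tw i j))"
  unfolding rE_def tw_def W_append by (simp add: algebra_simps)

lemma cf_qE: "cf (qE i j) = qq rho n i j"
proof -
  have "cf (1 - W [(1, True), (1, True)] :: wd \<Rightarrow>\<^sub>0 'k) =
      (\<lambda>v. delta [] v - delta [(1, True), (1, True)] v)"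
    by (auto simp: cf_diff cf_1 cf_W)
  then show ?thesis unfolding qE_def cf_C_mult_fun by (simp add: qq_def qel_def cf_mult cf_W rw_def)
qed

lemma cf_rE: "cf (rE i j) = rr rho n i j"
proof -
  have "cf (1 + W [(1, True), (1, True)] :: wd \<Rightarrow>\<^sub>0 'k) =
      (\<lambda>v. delta [] v + delta [(1, True), (1, True)] v)"
    by (auto simp: cf_add cf_1 cf_W)
  then show ?thesis unfolding rE_def cf_C_mult_fun by (simp add: rr_def rel_def cf_mult cf_W rw_def)
qed

lemma vsupp_qE: "pair i j \<Longrightarrow> vsupp n (qE i j)" and vsupp_rE: "pair i j \<Longrightarrow> vsupp n (rE i j)"
  using rw n2 by (auto simp: qE_def rE_def intro!: vsupp_intros)

lemma acts_diag_rr: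
  assumes "pair i j"
  shows "acts_diag n (W (rw i j @ winv (rw i j)) :: wd \<Rightarrow>\<^sub>0 'k) (\<lambda>y. 1)"
proof -
  have "msign (col y) (rw i j @ winv (rw i j)) = (1 :: 'k)" for y
    unfolding msign_append msign_winv by simp
  moreover have "acts_diag n (W (rw i j @ winv (rw i j)) :: wd \<Rightarrow>\<^sub>0 'k)
      (\<lambda>y. msign (col y) (rw i j @ winv (rw i j)))"
    using rw(1)[OF assms] by (intro acts_diag_pure) (auto simp: fun_eq_iff)
  ultimately show ?thesis by simp
qed

lemma acts_diag_tw:
  assumes "pair i j"
  shows "acts_diag n (W (tw i j) :: wd \<Rightarrow>\<^sub>0 'k) (\<lambda>y. if col y i \<noteq> col y j then - 1 else 1)"
proof -
  have "acts_diag n (W (tw i j) :: wd \<Rightarrow>\<^sub>0 'k) (\<lambda>y. msign (col y) (tw i j))"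
    using assms by (intro acts_diag_pure valid_tw bar_tw)
  then show ?thesis by (simp only: msign_tw[OF assms])
qed

lemma acts_diag_qE:
  assumes "pair i j"
  shows "acts_diag n (qE i j) (\<lambda>y. if col y i \<noteq> col y j then 1 else 0)"
proof -
  have "acts_diag n (qE i j) (\<lambda>y. (1 / 2) * (1 - (if col y i \<noteq> col y j then - 1 else 1)))"
    unfolding qE_eq by (intro acts_diag_C acts_diag_diff acts_diag_rr acts_diag_tw assms)
  moreover have "(\<lambda>y. (1 / 2) * (1 - (if col y i \<noteq> col y j then - 1 else 1))) =
      (\<lambda>y. if col y i \<noteq> col y j then 1 else 0 :: 'k)"
    using two by (auto simp: fun_eq_iff)
  ultimately show ?thesis by simp
qed

lemma acts_diag_rE:
  assumes "pair i j"
  shows "acts_diag n (rE i j) (\<lambda>y. if col y i = col y j then 1 else 0)"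
proof -
  have "acts_diag n (rE i j) (\<lambda>y. (1 / 2) * (1 + (if col y i \<noteq> col y j then - 1 else 1)))"
    unfolding rE_eq by (intro acts_diag_C acts_diag_add acts_diag_rr acts_diag_tw assms)
  moreover have "(\<lambda>y. (1 / 2) * (1 + (if col y i \<noteq> col y j then - 1 else 1))) =
      (\<lambda>y. if col y i = col y j then 1 else 0 :: 'k)"
    using two by (auto simp: fun_eq_iff)
  ultimately show ?thesis by simp
qed

definition QI :: "nat set \<Rightarrow> wd \<Rightarrow>\<^sub>0 'k" where
  "QI I = prod_list (map (\<lambda>(i, j). qE i j) (filter (\<lambda>(i, j). (i \<in> I) \<noteq> (j \<in> I)) (pl n))) *
          prod_list (map (\<lambda>(i, j). rE i j) (filter (\<lambda>(i, j). i \<in> I \<and> j \<in> I) (pl n))) *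
          prod_list (map (\<lambda>(i, j). rE i j) (filter (\<lambda>(i, j). i \<notin> I \<and> j \<notin> I) (pl n)))"

text \<open>As a remainder, it makes the decomposition of 1 an identity of the algebra itself. What
  the generators with i = 0 contribute is that it absorbs the letters of a braid.\<close>

definition Q0 :: "wd \<Rightarrow>\<^sub>0 'k" where
  "Q0 = 1 - (\<Sum>I\<in>Xi n. QI I)"

definition QS :: "nat \<Rightarrow> wd \<Rightarrow>\<^sub>0 'k" where
  "QS i = (if i = 0 then Q0 else QI {1..i})"

lemma cf_QI: "cf (QI I) = qdec rho pl n I"
  unfolding QI_def qdec_def cf_mult cf_prod_list
  by (simp add: case_prod_unfold cf_qE cf_rE)

lemma cf_Q0: "cf Q0 = (\<lambda>w. delta [] w - (\<Sum>I\<in>Xi n. qdec rho pl n I w))"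
  by (auto simp: Q0_def cf_diff cf_1 cf_sum cf_QI)

lemma cf_QS: "cf (QS i) = qseg rho pl n i"
  by (simp add: QS_def qseg_def cf_Q0 cf_QI)

lemma vsupp_QI: "vsupp n (QI I)"
  unfolding QI_def
  by (intro vsupp_mult vsupp_prod_list)
    (auto intro!: vsupp_qE vsupp_rE dest: pair_set_pl)

lemma vsupp_Q0: "vsupp n Q0"
  unfolding Q0_def by (intro vsupp_diff vsupp_1 vsupp_sum vsupp_QI)

lemma vsupp_QS: "vsupp n (QS i)"
  by (simp add: QS_def vsupp_Q0 vsupp_QI)

text \<open>The partition of the positions by colour is {I, complement}, with no record of which
  part has which colour.\<close>

definition bicol :: "nat set \<Rightarrow> (nat \<Rightarrow> bool) \<Rightarrow> bool" where
  "bicol I c \<longleftrightarrow> (\<forall>i\<in>{1..n}. \<forall>j\<in>{1..n}. c i \<noteq> c j \<longleftrightarrow> (i \<in> I) \<noteq> (j \<in> I))"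

lemma bicol_pl:
  "bicol I c \<longleftrightarrow> (\<forall>(i, j)\<in>set (pl n). c i \<noteq> c j \<longleftrightarrow> (i \<in> I) \<noteq> (j \<in> I))" (is "_ \<longleftrightarrow> ?R")
proof
  assume R: ?R
  show "bicol I c"
    unfolding bicol_def
  proof (intro ballI)
    fix i j assume "i \<in> {1..n}" "j \<in> {1..n}"
    then consider "i = j" | "(i, j) \<in> set (pl n)" | "(j, i) \<in> set (pl n)"
      unfolding set_pl by fastforce
    then show "c i \<noteq> c j \<longleftrightarrow> (i \<in> I) \<noteq> (j \<in> I)"
      using R by cases fastforce+
  qed
qed (auto simp: bicol_def set_pl)

lemma acts_diag_QI: "acts_diag n (QI I) (\<lambda>y. if bicol I (col y) then 1 else 0)"
proof -
  let ?L = "\<lambda>P. filter (\<lambda>(i, j). P i j) (pl n)"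
  let ?q = "\<lambda>y (i, j). col y i \<noteq> col y j" and ?r = "\<lambda>y (i, j). col y i = col y j"
  let ?A = "?L (\<lambda>i j. (i \<in> I) \<noteq> (j \<in> I))" and ?B = "?L (\<lambda>i j. i \<in> I \<and> j \<in> I)"
    and ?D = "?L (\<lambda>i j. i \<notin> I \<and> j \<notin> I)"
  have q: "acts_diag n (case p of (i, j) \<Rightarrow> qE i j) (\<lambda>y. if ?q y p then 1 else 0)" if "p \<in> set (pl n)" for p
    using that acts_diag_qE[of "fst p" "snd p"] pair_set_pl[of "fst p" "snd p"] by (simp add: case_prod_unfold)
  have r: "acts_diag n (case p of (i, j) \<Rightarrow> rE i j) (\<lambda>y. if ?r y p then 1 else 0)" if "p \<in> set (pl n)" for p
    using that acts_diag_rE[of "fst p" "snd p"] pair_set_pl[of "fst p" "snd p"] by (simp add: case_prod_unfold)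
  have "acts_diag n (QI I) (\<lambda>y. (if \<forall>p\<in>set ?A. ?q y p then 1 else 0) *
      (if \<forall>p\<in>set ?B. ?r y p then 1 else 0) * (if \<forall>p\<in>set ?D. ?r y p then 1 else 0))"
    unfolding QI_def
    by (intro acts_diag_mult acts_diag_prod_list q r) auto
  moreover have "(if \<forall>p\<in>set ?A. ?q y p then 1 else 0) *
      (if \<forall>p\<in>set ?B. ?r y p then 1 else 0) * (if \<forall>p\<in>set ?D. ?r y p then 1 else 0) =
      (if bicol I (col y) then 1 else 0 :: 'k)" for y
  proof -
    have "(if X then 1 else 0) * (if Y then 1 else 0) * (if Z then 1 else 0) = (if X \<and> Y \<and> Z then 1 else 0 :: 'k)"
      for X Y Z by simp
    moreover have "(\<forall>p\<in>set ?A. ?q y p) \<and> (\<forall>p\<in>set ?B. ?r y p) \<and> (\<forall>p\<in>set ?D. ?r y p) \<longleftrightarrow> bicol I (col y)"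
      unfolding bicol_pl by fastforce
    ultimately show ?thesis by (simp only:)
  qed
  ultimately show ?thesis by simp
qed

definition monochrome :: "(nat \<Rightarrow> bool) \<Rightarrow> bool" where
  "monochrome c \<longleftrightarrow> (\<forall>k\<in>{1..n}. c k = c 1)"

lemma finite_Xi: "finite (Xi n)"
  by (rule finite_subset[of _ "Pow {1..n}"]) (auto simp: Xi_def)

text \<open>The convention 1 \<in> I singles out one part of each decomposition, so the matching
  \<open>I\<close> is the colour class of position 1.\<close>

lemma bicol_Xi_iff:
  assumes "I \<in> Xi n"
  shows "bicol I c \<longleftrightarrow> \<not> monochrome c \<and> I = {k \<in> {1..n}. c k = c 1}"
proof -
  have n: "1 \<in> {1..n}" using n2 by simp
  have I: "I \<subseteq> {1..n}" "1 \<in> I" "I \<noteq> {1..n}" using assms by (auto simp: Xi_def)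
  have "I = {k \<in> {1..n}. c k = c 1}" if "bicol I c"
    using that n I unfolding bicol_def by blast
  moreover have "bicol I c" if "I = {k \<in> {1..n}. c k = c 1}"
    using that unfolding bicol_def by auto
  ultimately show ?thesis using I unfolding monochrome_def by blast
qed

text \<open>The sum over \<open>Xi n\<close> counts the decompositions that match the colouring:
  exactly one if both colours occur, none otherwise.\<close>

lemma acts_diag_Q0: "acts_diag n Q0 (\<lambda>y. if monochrome (col y) then 1 else 0)"
proof -
  have "acts_diag n Q0 (\<lambda>y. 1 - (\<Sum>I\<in>Xi n. if bicol I (col y) then 1 else 0))"
    unfolding Q0_def by (intro acts_diag_diff acts_diag_1 acts_diag_sum acts_diag_QI)
  moreover have "1 - (\<Sum>I\<in>Xi n. if bicol I (col y) then 1 else 0) =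
      (if monochrome (col y) then 1 else 0 :: 'k)" for y
  proof -
    let ?J = "{k \<in> {1..n}. col y k = col y 1}"
    have "(\<Sum>I\<in>Xi n. if bicol I (col y) then 1 else 0) =
        (\<Sum>I\<in>Xi n. if I = ?J then (if monochrome (col y) then 0 else 1) else 0 :: 'k)"
      using bicol_Xi_iff by (intro sum.cong) auto
    moreover have "?J \<in> Xi n" if "\<not> monochrome (col y)"
      using that n2 unfolding monochrome_def Xi_def by auto
    ultimately show ?thesis by (simp add: finite_Xi)
  qed
  ultimately show ?thesis by simp
qed

lemma lst_fix:
  assumes "length y = n" "\<And>k. k \<in> {1..n} \<Longrightarrow> c k = col y k"
  shows "lst n c = y"
  using assms lst_eq_iff[of n c "col y"] by simp

text \<open>On the rows that survive, the positions j+1 and j+2 lie in the same block because j+1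
  \<noteq> i, so the generator exchanges equal letters, with sign 1.\<close>

lemma is_identity_QS:
  assumes "i < n" "j + 2 \<le> n" "j + 1 \<noteq> i"
  shows "is_identity n (\<lambda>w. conv (qseg rho pl n i :: bword \<Rightarrow> 'k) (delta [(j + 1, True)]) w - qseg rho pl n i w)"
proof (rule is_identityI)
  let ?s = "[(j + 1, True)]"
  let ?F = "QS i * W ?s - QS i"
  show "cf ?F = (\<lambda>w. conv (qseg rho pl n i) (delta ?s) w - qseg rho pl n i w)"
    by (auto simp: cf_diff cf_mult cf_W cf_QS)
  show "vsupp n ?F" using assms by (intro vsupp_intros vsupp_QS) auto
  fix y :: "bool list" and x assume y: "length y = n"
  define d where "d y = (if if i = 0 then monochrome (col y) else bicol {1..i} (col y) then 1 else 0 :: 'k)" for y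
  have d: "acts_diag n (QS i) d"
    using acts_diag_Q0 acts_diag_QI[of "{1..i}"] by (auto simp: QS_def d_def[abs_def])
  show "Ev n ?F y x = 0"
  proof (cases "d y = 0")
    case True
    then show ?thesis using acts_diagD[OF d y, of "W ?s"] acts_diagD[OF d y, of 1] by (simp add: Ev_diff)
  next
    case False
    have eq: "col y (j + 1) = col y (j + 2)"
    proof (cases "i = 0")
      case True
      then have "monochrome (col y)" using False by (simp add: d_def split: if_splits)
      then have m: "k \<in> {1..n} \<Longrightarrow> col y k = col y 1" for k unfolding monochrome_def by blast
      have "col y (j + 1) = col y 1" by (rule m) (use assms in auto)
      also have "\<dots> = col y (j + 2)" by (rule m[symmetric]) (use assms in auto)
      finally show ?thesis .
    next
      case 2: False
      then have "bicol {1..i} (col y)" using False by (simp add: d_def split: if_splits)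
      moreover have "j + 1 \<in> {1..i} \<longleftrightarrow> j + 2 \<in> {1..i}" using assms by auto
      moreover have "j + 1 \<in> {1..n}" "j + 2 \<in> {1..n}" using assms by auto
      ultimately show ?thesis unfolding bicol_def by blast
    qed
    have "msign (col y) ?s = (1 :: 'k)" using eq by (simp add: sg_def yd_sign_def)
    moreover have "lst n (col y \<circ> bar ?s) = y"
      using y eq by (intro lst_fix) (auto simp: transp_def)
    ultimately have "Ev n (W ?s * 1) y x = (Ev n 1 y x :: 'k)"
      using assms by (subst Ev_W_mult[OF y]) auto
    then show ?thesis
      using acts_diagD[OF d y, of "W ?s"] acts_diagD[OF d y, of 1] by (simp add: Ev_diff)
  qed
qed

lemma Ev_W_eqI:
  "valid n u \<Longrightarrow> valid n v \<Longrightarrow> bar u = bar v \<Longrightarrow> msign (col y) u = (msign (col y) v :: 'k) \<Longrightarrow>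
    Ev n (W u - W v :: wd \<Rightarrow>\<^sub>0 'k) y x = 0"
  by (simp add: Ev_diff Ev_W Eop_eq)

lemma is_identity_tau:
  assumes "n = 2"
  shows "is_identity n (\<lambda>w. delta [(1, True), (1, True), (1, True), (1, True)] w - delta [] w :: 'k)"
proof (rule is_identityI)
  let ?u = "[(1, True), (1, True), (1, True), (1, True)]"
  let ?F = "W ?u - W [] :: wd \<Rightarrow>\<^sub>0 'k"
  show "cf ?F = (\<lambda>w. delta ?u w - delta [] w)"
    by (auto simp: cf_diff cf_W cf_1)
  show "vsupp n ?F" using assms by (intro vsupp_intros) auto
  fix y :: "bool list" and x assume y: "length y = n"
  have "msign (col y) ([(1, True), (1, True)] @ [(1, True), (1, True)]) = (1 :: 'k)"
    unfolding msign_append msign_double by (auto simp: o_def)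
  then show "Ev n ?F y x = 0"
    using assms by (intro Ev_W_eqI) (auto simp: fun_eq_iff)
qed

text \<open>Both factors are pure braids, so both act on each row by a scalar.\<close>

lemma is_identity_commutator:
  assumes "1 \<le> i" "i \<le> n - 1" "valid n \<sigma>" "bar \<sigma> = id"
  shows "is_identity n (\<lambda>w. delta ([(i, True), (i, True)] @ \<sigma>) w - delta (\<sigma> @ [(i, True), (i, True)]) w :: 'k)"
proof (rule is_identityI)
  let ?s = "[(i, True), (i, True)]"
  let ?F = "W (?s @ \<sigma>) - W (\<sigma> @ ?s) :: wd \<Rightarrow>\<^sub>0 'k"
  show "cf ?F = (\<lambda>w. delta (?s @ \<sigma>) w - delta (\<sigma> @ ?s) w)"
    by (auto simp: cf_diff cf_W)
  have v: "valid n ?s" using assms n2 by auto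
  then show "vsupp n ?F" using assms by (intro vsupp_intros) auto
  fix y :: "bool list" and x assume y: "length y = n"
  have "bar ?s = id" by (simp add: fun_eq_iff)
  then have "msign (col y) (?s @ \<sigma>) = (msign (col y) (\<sigma> @ ?s) :: 'k)" "bar (?s @ \<sigma>) = id" "bar (\<sigma> @ ?s) = id"
    using assms by (simp_all only: msign_append bar_append comp_id mult.commute)
  then show "Ev n ?F y x = 0"
    by (intro Ev_W_eqI) (use v assms in simp_all)
qed

text \<open>The diagonal entry of q_ij depends only on the colours at i and j, and a braid fixing
  both indices leaves these unchanged.\<close>

lemma is_identity_q:
  assumes "1 \<le> i" "i < j" "j \<le> n" "valid n \<sigma>" "bar \<sigma> i = i" "bar \<sigma> j = j"
  shows "is_identity n (\<lambda>w. conv (qq rho n i j :: bword \<Rightarrow> 'k) (delta \<sigma>) w - conv (delta \<sigma>) (qq rho n i j) w)"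
proof (rule is_identityI)
  let ?F = "qE i j * W \<sigma> - W \<sigma> * qE i j"
  have p: "pair i j" using assms by (auto simp: pair_def)
  show "cf ?F = (\<lambda>w. conv (qq rho n i j) (delta \<sigma>) w - conv (delta \<sigma>) (qq rho n i j) w)"
    by (auto simp: cf_diff cf_mult cf_W cf_qE)
  show "vsupp n ?F" using assms p by (intro vsupp_intros vsupp_qE) auto
  fix y :: "bool list" and x assume y: "length y = n"
  let ?z = "lst n (col y \<circ> bar \<sigma>)"
  have z: "length ?z = n" "col ?z i = col y i" "col ?z j = col y j" using assms by simp_all
  note q = acts_diagD[OF acts_diag_qE[OF p]]
  show "Ev n ?F y x = 0"
    using q[OF y, of "W \<sigma>"] q[OF z(1), of 1] z(2,3) Ev_W_mult[OF y, of \<sigma> "qE i j"] Ev_W_mult[OF y, of \<sigma> "1 :: wd \<Rightarrow>\<^sub>0 'k"] assms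
    by (simp add: Ev_diff)
qed

lemma V3_sound: "f \<in> V3 rho pl n \<Longrightarrow> is_identity n (f :: bword \<Rightarrow> 'k)"
  unfolding V3_def
  using is_identity_tau is_identity_commutator is_identity_q is_identity_QS
  by auto

end

section \<open>The quotient by the generated ideal\<close>

context ideal_cong
begin

lemma W_cong: "W u \<doteq> W v \<Longrightarrow> W (a @ u @ b) \<doteq> W (a @ v @ b)"
  unfolding W_append by (intro eqv_mult eqv_refl)

lemma W_cancel: "valid n u \<Longrightarrow> W (a @ u @ winv u @ b) \<doteq> W (a @ b)"
  using W_cong[of "u @ winv u" "[]" a b] W_winv[of u] by (simp add: W_append)

lemma W_cancel': "valid n u \<Longrightarrow> W (a @ winv u @ u @ b) \<doteq> W (a @ b)"
  using W_cancel[of "winv u" a b] by simp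

end

context magma_identities
begin

lemma V3_eqv_0:
  assumes "cf F \<in> V3 rho pl n"
  shows "F \<doteq> 0"
proof (rule eqv_0_if_in_ideal)
  show "in_ideal G n (cf F)" using assms by (simp add: G ii_gen)
  show "vsupp n F" using V3_sound[OF assms] by (simp add: is_identity_def fin_el_cf)
qed

text \<open>The generator lives on two strands only. Tensoring with i - 1 strands on the left and n
  - i - 1 on the right moves it to position i; the shift of indices in \<open>tens_id_left\<close>
  has to be matched letter by letter.\<close>

lemma W_power4:
  assumes i: "1 \<le> i" "i < n"
  shows "W [(i, True), (i, True), (i, True), (i, True)] \<doteq> 1"
proof -
  let ?u = "\<lambda>i. [(i, True), (i, True), (i, True), (i, True)] :: bword"
  let ?f = "\<lambda>w. delta (?u 1) w - delta [] w :: 'k"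
  have "in_ideal G 2 ?f" by (rule ii_gen) (simp add: G V3_def)
  then have "in_ideal G (i - 1 + 2 + (n - i - 1)) (tens_id_left (i - 1) ?f)"
    by (intro ii_tens_right ii_tens_left)
  moreover have "i - 1 + 2 + (n - i - 1) = n" using i by simp
  moreover have "tens_id_left (i - 1) ?f = cf (W (?u i) - W [])"
  proof
    fix w
    have "map (\<lambda>(j, s). (j - (i - 1), s)) w = ?u 1 \<longleftrightarrow> w = ?u i"
      if "\<forall>(j, s)\<in>set w. i - 1 < j"
      using that i by (fastforce simp: map_eq_Cons_conv)
    then show "tens_id_left (i - 1) ?f w = cf (W (?u i) - W []) w"
      using i by (auto simp: tens_id_left_def cf_diff cf_W delta_def simp del: W_Nil)
  qed
  ultimately have "W (?u i) - W [] \<doteq> 0"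
    using i by (intro eqv_0_if_in_ideal vsupp_intros) auto
  then show ?thesis using eqv_iff_diff by simp
qed

section \<open>The pure braids t_ij modulo the ideal\<close>

lemma half_C: "C (1 / 2) * F + C (1 / 2) * F = (F :: wd \<Rightarrow>\<^sub>0 'k)"
proof -
  have "C (1 / 2) + C (1 / 2) = (1 :: wd \<Rightarrow>\<^sub>0 'k)"
    using two by (simp flip: C_add)
  then show ?thesis by (simp flip: distrib_right)
qed

lemma qE_eqv: "pair i j \<Longrightarrow> qE i j \<doteq> C (1 / 2) * (1 - W (tw i j))"
  unfolding qE_eq W_append using rw(1) by (intro eqv_mult_left eqv_diff eqv_refl W_winv)

lemma rE_eqv: "pair i j \<Longrightarrow> rE i j \<doteq> C (1 / 2) * (1 + W (tw i j))"
  unfolding rE_eq W_append using rw(1) by (intro eqv_mult_left eqv_add eqv_refl W_winv)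

lemma qE_commute:
  assumes "pair i j" "valid n \<sigma>" "bar \<sigma> i = i" "bar \<sigma> j = j"
  shows "qE i j * W \<sigma> \<doteq> W \<sigma> * qE i j"
proof -
  have *: "qE i j * W \<sigma> \<doteq> W \<sigma> * qE i j"
    if "1 \<le> i" "i < j" "j \<le> n" "bar \<sigma> i = i" "bar \<sigma> j = j" for i j
  proof -
    have "cf (qE i j * W \<sigma> - W \<sigma> * qE i j) =
        (\<lambda>w. conv (qq rho n i j) (delta \<sigma>) w - conv (delta \<sigma>) (qq rho n i j) w)"
      by (auto simp: cf_diff cf_mult cf_W cf_qE)
    moreover have "\<dots> \<in> V3 rho pl n"
      unfolding V3_def using that assms(2) n2 by blast
    ultimately have "qE i j * W \<sigma> - W \<sigma> * qE i j \<doteq> 0" by (intro V3_eqv_0) simp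
    then show ?thesis by (simp add: eqv_iff_diff[of "qE i j * W \<sigma>"])
  qed
  have "qE i j = qE j i" by (simp add: qE_def rw_commute)
  then show ?thesis
    using *[of i j] *[of j i] assms unfolding pair_def by (cases "i < j") auto
qed

lemma W_tw_eqv: "pair i j \<Longrightarrow> W (tw i j) \<doteq> 1 - (qE i j + qE i j)"
proof -
  assume "pair i j"
  then have "1 - (qE i j + qE i j) \<doteq> 1 - (C (1 / 2) * (1 - W (tw i j)) + C (1 / 2) * (1 - W (tw i j)))"
    by (intro eqv_diff eqv_add qE_eqv eqv_refl)
  also have "\<dots> = W (tw i j)" unfolding half_C by simp
  finally show ?thesis by (rule eqv_sym)
qed

text \<open>The generators speak about q_ij, and t_ij = 1 - 2 q_ij recovers the twist, so
  commutation passes from one to the other.\<close>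

lemma tw_commute_fixing:
  assumes "pair i j" "valid n \<sigma>" "bar \<sigma> i = i" "bar \<sigma> j = j"
  shows "W (tw i j) * W \<sigma> \<doteq> W \<sigma> * W (tw i j)"
proof -
  have "W (tw i j) * W \<sigma> \<doteq> (1 - (qE i j + qE i j)) * W \<sigma>"
    by (intro eqv_mult_right W_tw_eqv assms)
  also have "\<dots> = W \<sigma> - (qE i j * W \<sigma> + qE i j * W \<sigma>)" by (simp add: algebra_simps)
  also have "\<dots> \<doteq> W \<sigma> - (W \<sigma> * qE i j + W \<sigma> * qE i j)"
    by (intro eqv_diff eqv_add eqv_refl qE_commute assms)
  also have "\<dots> = W \<sigma> * (1 - (qE i j + qE i j))" by (simp add: algebra_simps)
  also have "\<dots> \<doteq> W \<sigma> * W (tw i j)"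
    by (intro eqv_mult_left eqv_sym[OF W_tw_eqv] assms)
  finally show ?thesis .
qed

text \<open>The braid \<open>g @ winv (rw i j)\<close> fixes i and j, hence commutes with t_ij. So
  the twist does not depend on the conjugator, only on where it sends strands 1 and 2.\<close>

lemma conj_square_ordered:
  assumes "pair i j" "valid n g" "bar g 1 = bar (rw i j) 1" "bar g 2 = bar (rw i j) 2"
  shows "W (g @ [(1, True), (1, True)] @ winv g) \<doteq> W (tw i j)"
proof -
  let ?s = "[(1, True), (1, True)]" and ?r = "rw i j"
  let ?u = "g @ winv ?r"
  note r = rw[OF assms(1)]
  have fix_ij: "bar ?u i = i" "bar ?u j = j"
  proof -
    have "bar ?u (bar ?r 1) = bar ?r 1" "bar ?u (bar ?r 2) = bar ?r 2" using assms by simp_all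
    then show "bar ?u i = i" "bar ?u j = j" using r(2) by (metis doubleton_eq_iff)+
  qed
  have "W (g @ ?s @ winv g) \<doteq> W (g @ winv ?r @ ?r @ ?s @ winv g)"
    using W_cancel'[OF r(1), of g "?s @ winv g"] by (rule eqv_sym)
  also have "\<dots> \<doteq> W ((g @ winv ?r @ ?r @ ?s) @ winv ?r @ ?r @ winv g)"
    using W_cancel'[OF r(1), of "g @ winv ?r @ ?r @ ?s" "winv g"] by (simp add: eqv_sym)
  also have "\<dots> = W ?u * W (tw i j) * W (winv ?u)"
    by (simp add: tw_def flip: W_append)
  also have "\<dots> \<doteq> W (tw i j) * W ?u * W (winv ?u)"
    using assms r fix_ij by (intro eqv_mult_right eqv_sym[OF tw_commute_fixing]) auto
  also have "\<dots> \<doteq> W (tw i j) * 1"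
    unfolding mult.assoc using assms r by (intro eqv_mult_left W_winv) auto
  finally show ?thesis by simp
qed

lemma conj_square:
  assumes "pair i j" "valid n g" "{bar g 1, bar g 2} = {i, j}"
  shows "W (g @ [(1, True), (1, True)] @ winv g) \<doteq> W (tw i j)"
proof -
  note r = rw[OF assms(1)]
  consider "bar g 1 = bar (rw i j) 1" "bar g 2 = bar (rw i j) 2"
    | "bar g 1 = bar (rw i j) 2" "bar g 2 = bar (rw i j) 1"
    using assms(3) r(2) by (metis doubleton_eq_iff)
  then show ?thesis
  proof cases
    case 1
    then show ?thesis using assms by (intro conj_square_ordered)
  next
    case 2
    \<comment> \<open>Appending sigma_1 exchanges the images of 1 and 2, and it does not change the
      conjugate because it commutes with its own square.\<close>
    let ?g = "g @ [(1, True)]"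
    have "W (?g @ [(1, True), (1, True)] @ winv ?g) \<doteq> W (tw i j)"
      using assms 2 n2 by (intro conj_square_ordered) (auto simp: numeral_2_eq_2)
    also have "?g @ [(1, True), (1, True)] @ winv ?g =
        (g @ [(1, True), (1, True)]) @ [(1, True)] @ winv [(1, True)] @ winv g" by simp
    finally have A: "W \<dots> \<doteq> W (tw i j)" .
    have "W ((g @ [(1, True), (1, True)]) @ [(1, True)] @ winv [(1, True)] @ winv g)
        \<doteq> W ((g @ [(1, True), (1, True)]) @ winv g)"
      using n2 by (intro W_cancel) auto
    from eqv_trans[OF eqv_sym[OF this] A] show ?thesis by simp
  qed
qed

text \<open>The conjugate of t_ij by \<open>u\<close> is the conjugate of sigma_1^2 by
  \<open>u @ rw i j\<close>, which sends {1, 2} to the pair of images of i and j.\<close>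

lemma tw_conj:
  assumes "pair i j" "valid n u"
  shows "W u * W (tw i j) \<doteq> W (tw (bar u i) (bar u j)) * W u"
proof -
  let ?r = "rw i j" and ?s = "[(1, True), (1, True)]"
  note r = rw[OF assms(1)]
  have p: "pair (bar u i) (bar u j)"
    using assms bar_range[of n u i] bar_range[of n u j] unfolding pair_def by simp
  have im: "{bar (u @ ?r) 1, bar (u @ ?r) 2} = {bar u i, bar u j}"
    using r(2) by (auto simp: doubleton_eq_iff)
  have "W u * W (tw i j) = W ((u @ tw i j) @ [])" by (simp add: W_append)
  also have "\<dots> \<doteq> W ((u @ tw i j) @ winv u @ u @ [])"
    by (rule eqv_sym[OF W_cancel']) (rule assms)
  also have "\<dots> = W ((u @ ?r) @ ?s @ winv (u @ ?r)) * W u"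
    by (simp add: tw_def flip: W_append)
  also have "\<dots> \<doteq> W (tw (bar u i) (bar u j)) * W u"
    using assms r p im by (intro eqv_mult_right conj_square) auto
  finally show ?thesis .
qed

text \<open>t_ij is pure, so conjugation by it preserves the indices k and l.\<close>

lemma tw_tw_commute:
  "pair i j \<Longrightarrow> pair k l \<Longrightarrow> W (tw i j) * W (tw k l) \<doteq> W (tw k l) * W (tw i j)"
  using tw_conj[of k l "tw i j"] valid_tw bar_tw by simp

lemma tw_square: "pair i j \<Longrightarrow> W (tw i j) * W (tw i j) \<doteq> 1"
proof -
  assume p: "pair i j"
  let ?r = "rw i j" and ?s = "[(1, True), (1, True)] :: bword"
  note r = rw[OF p]
  have "W (tw i j) * W (tw i j) = W ((?r @ ?s) @ winv ?r @ ?r @ ?s @ winv ?r)"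
    by (simp add: tw_def flip: W_append)
  also have "\<dots> \<doteq> W ((?r @ ?s) @ ?s @ winv ?r)" by (rule W_cancel') (rule r)
  also have "\<dots> = W (?r @ (?s @ ?s) @ winv ?r)" by simp
  also have "\<dots> \<doteq> W (?r @ [] @ winv ?r)"
    using W_power4[of 1] n2 by (intro W_cong) simp
  also have "\<dots> \<doteq> 1" using W_winv[OF r(1)] by (simp add: W_append)
  finally show ?thesis .
qed

lemma square_conj_square1:
  "1 \<le> i \<Longrightarrow> i < n \<Longrightarrow> \<exists>g. valid n g \<and> bar g 1 = i \<and> bar g 2 = Suc i \<and>
     W [(i, True), (i, True)] \<doteq> W (g @ [(1, True), (1, True)] @ winv g)"
proof (induction i rule: dec_induct)
  case base
  then show ?case by (intro exI[of _ "[]"]) auto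
next
  case (step i)
  let ?s = "[(1, True), (1, True)] :: bword" and ?i = "(i, True)" and ?j = "(Suc i, True)"
  obtain g where g: "valid n g" "bar g 1 = i" "bar g 2 = Suc i" "W [?i, ?i] \<doteq> W (g @ ?s @ winv g)"
    using step by auto
  have b: "W [?i, ?j, ?i] \<doteq> W [?j, ?i, ?j]" using W_braid[of i] step by simp
  \<comment> \<open>This is the inverse of sigma_i sigma_(i+1), which conjugates sigma_i into
    sigma_(i+1) by the braid relation; the relation is applied once for each of the two letters of
    the square.\<close>
  let ?e = "[(Suc i, False), (i, False)]"
  have "W (([?i, ?j] @ g) @ ?s @ winv ([?i, ?j] @ g)) = W ([?i, ?j] @ (g @ ?s @ winv g) @ ?e)" by simp
  also have "\<dots> \<doteq> W ([?i, ?j] @ [?i, ?i] @ ?e)" by (rule W_cong) (rule eqv_sym[OF g(4)])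
  also have "\<dots> = W ([] @ [?i, ?j, ?i] @ [?i] @ ?e)" by simp
  also have "\<dots> \<doteq> W ([] @ [?j, ?i, ?j] @ [?i] @ ?e)" by (rule W_cong) (rule b)
  also have "\<dots> = W ([?j] @ [?i, ?j, ?i] @ ?e)" by simp
  also have "\<dots> \<doteq> W ([?j] @ [?j, ?i, ?j] @ ?e)" by (rule W_cong) (rule b)
  also have "\<dots> = W ([?j, ?j] @ [?i, ?j] @ winv [?i, ?j] @ [])" by simp
  also have "\<dots> \<doteq> W ([?j, ?j] @ [])" using step by (intro W_cancel) auto
  finally have "W [?j, ?j] \<doteq> W (([?i, ?j] @ g) @ ?s @ winv ([?i, ?j] @ g))" by (simp add: eqv_sym)
  then show ?case using step g
    by (intro exI[of _ "[?i, ?j] @ g"]) (auto simp: transp_def)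
qed

lemma square_eqv_tw:
  assumes "1 \<le> i" "i < n"
  shows "W [(i, True), (i, True)] \<doteq> W (tw i (Suc i))"
proof -
  obtain g where g: "valid n g" "bar g 1 = i" "bar g 2 = Suc i"
     "W [(i, True), (i, True)] \<doteq> W (g @ [(1, True), (1, True)] @ winv g)"
    using square_conj_square1[OF assms] by blast
  have "pair i (Suc i)" using assms by (auto simp: pair_def)
  then have "W (g @ [(1, True), (1, True)] @ winv g) \<doteq> W (tw i (Suc i))"
    using g by (intro conj_square) auto
  then show ?thesis using g(4) eqv_trans by blast
qed

subsection \<open>Colour idempotents\<close>

definition eps :: "(nat \<Rightarrow> bool) \<Rightarrow> nat \<Rightarrow> nat \<Rightarrow> 'k" where
  "eps c i j = (if c i \<noteq> c j then - 1 else 1)"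

lemma eps_square [simp]: "eps c i j * eps c i j = 1"
  by (simp add: eps_def)

text \<open>The projection to the eigenvalue \<open>eps c i j\<close> of the involution t_ij. It
  unites q_ij (unequal colours) and r_ij (equal colours), so that one product over all pairs
  describes a colouring.\<close>

definition E :: "(nat \<Rightarrow> bool) \<Rightarrow> nat \<times> nat \<Rightarrow> wd \<Rightarrow>\<^sub>0 'k" where
  "E c p = (case p of (i, j) \<Rightarrow> C (1 / 2) * (1 + C (eps c i j) * W (tw i j)))"

definition PP :: "(nat \<Rightarrow> bool) \<Rightarrow> (nat \<times> nat) list \<Rightarrow> wd \<Rightarrow>\<^sub>0 'k" where
  "PP c L = prod_list (map (E c) L)"

abbreviation P :: "(nat \<Rightarrow> bool) \<Rightarrow> wd \<Rightarrow>\<^sub>0 'k" where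
  "P c \<equiv> PP c (pl n)"

abbreviation pairs :: "(nat \<times> nat) list \<Rightarrow> bool" where
  "pairs L \<equiv> \<forall>(i, j)\<in>set L. pair i j"

lemma E_commute_symm: "E c (i, j) = E c (j, i)"
  by (auto simp: E_def eps_def tw_commute)

lemma qE_eqv_E: "pair i j \<Longrightarrow> c i \<noteq> c j \<Longrightarrow> qE i j \<doteq> E c (i, j)"
  using qE_eqv[of i j] by (simp add: E_def eps_def C_minus)

lemma rE_eqv_E: "pair i j \<Longrightarrow> c i = c j \<Longrightarrow> rE i j \<doteq> E c (i, j)"
  using rE_eqv[of i j] by (simp add: E_def eps_def)

lemma C_left_commute: "A * (C c * B) = C c * (A * (B :: wd \<Rightarrow>\<^sub>0 'k))"
  by (simp add: C_comm flip: mult.assoc)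

lemma C_collect: "C a * (C b * F) = C (a * b) * (F :: wd \<Rightarrow>\<^sub>0 'k)"
  by (simp add: C_mult mult.assoc)

lemma E_mult_eqv:
  assumes "W u * W (tw i j) \<doteq> W v * W u" "eps c i j = eps d k l" "v = tw k l"
  shows "W u * E c (i, j) \<doteq> E d (k, l) * W u"
proof -
  have "W u * E c (i, j) = C (1 / 2) * (W u + C (eps c i j) * (W u * W (tw i j)))"
    by (simp add: E_def C_left_commute[of "W u"] C_comm[of "W u"] distrib_left)
  also have "\<dots> \<doteq> C (1 / 2) * (W u + C (eps c i j) * (W v * W u))"
    by (intro eqv_mult_left eqv_add eqv_refl assms)
  also have "\<dots> = E d (k, l) * W u"
    using assms by (simp add: E_def mult.assoc distrib_right distrib_left)
  finally show ?thesis .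
qed

lemma W_E_conj:
  "pair i j \<Longrightarrow> valid n u \<Longrightarrow> W u * E (c \<circ> bar u) (i, j) \<doteq> E c (bar u i, bar u j) * W u"
  by (intro E_mult_eqv[OF tw_conj]) (auto simp: eps_def)

lemma E_E_commute:
  assumes "pair i j" "pair k l"
  shows "E c (i, j) * E d (k, l) \<doteq> E d (k, l) * E c (i, j)"
proof -
  have *: "W (tw i j) * E d (k, l) \<doteq> E d (k, l) * W (tw i j)"
    by (intro E_mult_eqv[OF tw_tw_commute]) (auto simp: assms)
  have "E c (i, j) * E d (k, l) =
      C (1 / 2) * (E d (k, l) + C (eps c i j) * (W (tw i j) * E d (k, l)))"
    by (simp add: E_def[of c] mult.assoc distrib_right)
  also have "\<dots> \<doteq> C (1 / 2) * (E d (k, l) + C (eps c i j) * (E d (k, l) * W (tw i j)))"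
    by (intro eqv_mult_left eqv_add eqv_refl *)
  also have "\<dots> = E d (k, l) * E c (i, j)"
    by (simp add: E_def[of c] C_left_commute[of "E d (k, l)"] C_comm[of "E d (k, l)"] distrib_left)
  finally show ?thesis .
qed

lemma E_absorb:
  assumes "pair i j"
  shows "E c (i, j) * W (tw i j) \<doteq> C (eps c i j) * E c (i, j)"
proof -
  have "E c (i, j) * W (tw i j) = C (1 / 2) * (W (tw i j) + C (eps c i j) * (W (tw i j) * W (tw i j)))"
    by (simp add: E_def mult.assoc distrib_right)
  also have "\<dots> \<doteq> C (1 / 2) * (W (tw i j) + C (eps c i j) * 1)"
    by (intro eqv_mult_left eqv_add eqv_refl tw_square assms)
  also have "W (tw i j) + C (eps c i j) * 1 = C (eps c i j) * (1 + C (eps c i j) * W (tw i j))"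
    by (simp add: distrib_left C_collect)
  also have "C (1 / 2) * \<dots> = C (eps c i j) * E c (i, j)"
    unfolding E_def case_prod_conv by (rule C_left_commute)
  finally show ?thesis .
qed

lemma PP_append: "PP c (L @ L') = PP c L * PP c L'"
  by (simp add: PP_def)

lemma PP_Cons: "PP c (p # L) = E c p * PP c L"
  by (simp add: PP_def)

lemma E_PP_commute:
  "pair i j \<Longrightarrow> pairs L \<Longrightarrow> E c (i, j) * PP c L \<doteq> PP c L * E c (i, j)"
proof (induction L)
  case Nil
  then show ?case by (simp add: PP_def)
next
  case (Cons p L)
  obtain k l where p: "p = (k, l)" by (cases p)
  have "E c (i, j) * PP c (p # L) = E c (i, j) * E c (k, l) * PP c L" by (simp add: PP_Cons p mult.assoc)
  also have "\<dots> \<doteq> E c (k, l) * E c (i, j) * PP c L"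
    using Cons p by (intro eqv_mult_right E_E_commute) auto
  also have "\<dots> = E c (k, l) * (E c (i, j) * PP c L)" by (simp add: mult.assoc)
  also have "\<dots> \<doteq> E c (k, l) * (PP c L * E c (i, j))"
    using Cons by (intro eqv_mult_left) auto
  also have "\<dots> = PP c (p # L) * E c (i, j)" by (simp add: PP_Cons p mult.assoc)
  finally show ?case .
qed

text \<open>The factors commute modulo the ideal, so the order in the list of pairs is
  irrelevant.\<close>

lemma PP_mset_cong: "mset L = mset L' \<Longrightarrow> pairs L \<Longrightarrow> PP c L \<doteq> PP c L'"
proof (induction L arbitrary: L')
  case Nil
  then show ?case by simp
next
  case (Cons p L)
  obtain i j where p: "p = (i, j)" by (cases p)
  have "p \<in> set L'" using Cons.prems(1) by (metis list.set_intros(1) set_mset_mset)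
  then obtain X Y where L': "L' = X @ p # Y" by (meson split_list)
  have m: "mset L = mset (X @ Y)" using Cons.prems(1) L' by simp
  then have "set X \<subseteq> set L" by (metis set_append set_mset_mset sup_ge1)
  then have X: "pairs X" using Cons.prems(2) by auto
  have "PP c (p # L) = E c p * PP c L" by (rule PP_Cons)
  also have "\<dots> \<doteq> E c p * PP c (X @ Y)"
    using Cons.prems m by (intro eqv_mult_left Cons.IH) auto
  also have "\<dots> = (E c (i, j) * PP c X) * PP c Y" by (simp add: PP_append p mult.assoc)
  also have "\<dots> \<doteq> (PP c X * E c (i, j)) * PP c Y"
    using Cons.prems X p by (intro eqv_mult_right E_PP_commute) auto
  also have "\<dots> = PP c L'" by (simp add: L' PP_append PP_Cons p mult.assoc)
  finally show ?case .
qed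

lemma pairs_pl: "pairs (pl n)"
  using pair_set_pl by auto

lemma W_PP_conj:
  "pairs L \<Longrightarrow> valid n u \<Longrightarrow>
    W u * PP (c \<circ> bar u) L \<doteq> PP c (map (map_prod (bar u) (bar u)) L) * W u"
proof (induction L)
  case Nil
  then show ?case by (simp add: PP_def)
next
  case (Cons p L)
  obtain i j where p: "p = (i, j)" by (cases p)
  let ?L = "map (map_prod (bar u) (bar u)) L"
  have "W u * PP (c \<circ> bar u) (p # L) \<doteq> (W u * E (c \<circ> bar u) (i, j)) * PP (c \<circ> bar u) L"
    by (simp add: PP_Cons p mult.assoc)
  also have "\<dots> \<doteq> (E c (bar u i, bar u j) * W u) * PP (c \<circ> bar u) L"
    using Cons.prems p by (intro eqv_mult_right W_E_conj) auto
  also have "\<dots> \<doteq> E c (bar u i, bar u j) * (W u * PP (c \<circ> bar u) L)" by (simp add: mult.assoc)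
  also have "\<dots> \<doteq> E c (bar u i, bar u j) * (PP c ?L * W u)"
    using Cons by (intro eqv_mult_left Cons.IH) auto
  finally show ?case by (simp add: PP_Cons p mult.assoc o_def)
qed

text \<open>Conjugation by \<open>u\<close> permutes the unordered pairs and hence the factors. An
  image pair may come out in the wrong order; \<open>nrm\<close> sorts it, which is harmless because
  \<open>E\<close> is symmetric in the two indices.\<close>

lemma P_conj:
  assumes u: "valid n u"
  shows "P c * W u \<doteq> W u * P (c \<circ> bar u)"
proof -
  let ?f = "map_prod (bar u) (bar u)"
  define nrm :: "nat \<times> nat \<Rightarrow> nat \<times> nat" where "nrm = (\<lambda>(i, j). (min i j, max i j))"
  have E_nrm: "E c (nrm p) = E c p" for p
    by (cases p) (auto simp: nrm_def min_def max_def E_commute_symm)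
  let ?L = "map (nrm \<circ> ?f) (pl n)"
  have inj: "inj_on (nrm \<circ> ?f) (set (pl n))"
  proof (rule inj_onI)
    fix p q assume pq: "p \<in> set (pl n)" "q \<in> set (pl n)" and eq: "(nrm \<circ> ?f) p = (nrm \<circ> ?f) q"
    obtain i j k l where ijkl: "p = (i, j)" "q = (k, l)" by (cases p, cases q)
    then have "i < j" "k < l" using pq set_pl by auto
    moreover have "(bar u i = bar u k \<and> bar u j = bar u l) \<or> (bar u i = bar u l \<and> bar u j = bar u k)"
      using eq ijkl by (auto simp: nrm_def min_def max_def split: if_splits)
    ultimately show "p = q" using ijkl by auto
  qed
  have sub: "(nrm \<circ> ?f) ` set (pl n) \<subseteq> set (pl n)"
  proof
    fix q assume "q \<in> (nrm \<circ> ?f) ` set (pl n)"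
    then obtain i j where "(i, j) \<in> set (pl n)" "q = nrm (bar u i, bar u j)" by auto
    moreover from this have "bar u i \<noteq> bar u j" unfolding set_pl by auto
    then have "bar u i < bar u j \<or> bar u j < bar u i" by linarith
    ultimately show "q \<in> set (pl n)"
      using bar_bounds[OF u, of i] bar_bounds[OF u, of j]
      unfolding set_pl nrm_def by auto
  qed
  have "set ?L = set (pl n)"
    using endo_inj_surj[OF _ sub inj] by simp
  moreover have "distinct ?L" using inj distinct_pl by (simp add: distinct_map)
  ultimately have m: "mset (pl n) = mset ?L"
    using distinct_pl set_eq_iff_mset_eq_distinct by blast
  have "P c * W u \<doteq> PP c ?L * W u"
    by (intro eqv_mult_right PP_mset_cong m pairs_pl)
  also have "PP c ?L = PP c (map ?f (pl n))"
    by (simp add: PP_def E_nrm o_def)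
  also have "PP c (map ?f (pl n)) * W u \<doteq> W u * P (c \<circ> bar u)"
    by (intro eqv_sym[OF W_PP_conj] pairs_pl u)
  finally show ?thesis .
qed

lemma P_absorb:
  assumes "pair i j"
  shows "P c * W (tw i j) \<doteq> C (eps c i j) * P c"
proof -
  have *: "P c * W (tw i j) \<doteq> C (eps c i j) * P c" if ij: "(i, j) \<in> set (pl n)" for i j
  proof -
    obtain X Y where L: "pl n = X @ (i, j) # Y" using split_list[OF ij] by blast
    have p: "pair i j" using ij pair_set_pl by blast
    \<comment> \<open>The factor that can absorb t_ij is moved to the right end.\<close>
    have m: "mset (pl n) = mset (X @ Y @ [(i, j)])" by (simp add: L)
    have P: "P c \<doteq> PP c (X @ Y) * E c (i, j)"
      using PP_mset_cong[OF m pairs_pl] by (simp add: PP_append PP_Cons mult.assoc) (simp add: PP_def)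
    have "P c * W (tw i j) \<doteq> PP c (X @ Y) * (E c (i, j) * W (tw i j))"
      using eqv_mult_right[OF P] by (simp add: mult.assoc)
    also have "\<dots> \<doteq> PP c (X @ Y) * (C (eps c i j) * E c (i, j))"
      by (intro eqv_mult_left E_absorb p)
    also have "\<dots> = C (eps c i j) * (PP c (X @ Y) * E c (i, j))" by (rule C_left_commute)
    also have "\<dots> \<doteq> C (eps c i j) * P c" by (intro eqv_mult_left eqv_sym[OF P])
    finally show ?thesis .
  qed
  have "tw i j = tw j i" "eps c i j = eps c j i" by (auto simp: tw_commute eps_def)
  moreover have "(i, j) \<in> set (pl n) \<or> (j, i) \<in> set (pl n)"
    using assms unfolding set_pl pair_def by auto
  ultimately show ?thesis using *[of i j] *[of j i] by auto
qed

lemma QI_eqv_P: "QI I \<doteq> P (\<lambda>k. k \<notin> I)"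
proof -
  let ?c = "\<lambda>k. k \<notin> I"
  let ?A = "filter (\<lambda>(i, j). (i \<in> I) \<noteq> (j \<in> I)) (pl n)"
    and ?B = "filter (\<lambda>(i, j). i \<in> I \<and> j \<in> I) (pl n)"
    and ?D = "filter (\<lambda>(i, j). i \<notin> I \<and> j \<notin> I) (pl n)"
  have *: "prod_list (map f L) \<doteq> PP ?c L" if "\<And>p. p \<in> set L \<Longrightarrow> f p \<doteq> E ?c p" for f L
    using that unfolding PP_def by (induction L) (auto intro: eqv_mult)
  have "QI I \<doteq> PP ?c ?A * PP ?c ?B * PP ?c ?D"
    unfolding QI_def
    by (intro eqv_mult *) (auto intro!: qE_eqv_E rE_eqv_E dest: pair_set_pl)
  also have "\<dots> = PP ?c (?A @ ?B @ ?D)" by (simp add: PP_append mult.assoc)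
  also have "\<dots> \<doteq> P ?c"
  proof (rule eqv_sym, rule PP_mset_cong)
    have "mset L = mset (filter (\<lambda>(i, j). (i \<in> I) \<noteq> (j \<in> I)) L @
      filter (\<lambda>(i, j). i \<in> I \<and> j \<in> I) L @ filter (\<lambda>(i, j). i \<notin> I \<and> j \<notin> I) L)" for L
      by (induction L) auto
    then show "mset (pl n) = mset (?A @ ?B @ ?D)" .
  qed (rule pairs_pl)
  finally show ?thesis .
qed

text \<open>The factor msign normalises p w so that it no longer depends on the signs picked up from
  pure braids.\<close>

definition NN :: "(nat \<Rightarrow> bool) \<Rightarrow> bword \<Rightarrow> wd \<Rightarrow>\<^sub>0 'k" where
  "NN c u = C (msign c u) * (P c * W u)"

lemma P_cong: "(\<And>k. k \<in> {1..n} \<Longrightarrow> c k = d k) \<Longrightarrow> P c = P d"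
  unfolding PP_def
  by (intro arg_cong[of _ _ prod_list] map_cong) (auto simp: E_def eps_def set_pl)

lemma NN_cong: "valid n u \<Longrightarrow> (\<And>k. k \<in> {1..n} \<Longrightarrow> c k = d k) \<Longrightarrow> NN c u = NN d u"
  unfolding NN_def using P_cong[of c d] msign_cong[of n u c d, where ?'a = 'k] by simp

lemma NN_append:
  assumes "valid n x"
  shows "NN c (x @ u) \<doteq> C (msign c x) * (W x * NN (c \<circ> bar x) u)"
proof -
  have "NN c (x @ u) = C (msign c x * msign (c \<circ> bar x) u) * ((P c * W x) * W u)"
    by (simp add: NN_def msign_append W_append mult.assoc)
  also have "\<dots> \<doteq> C (msign c x * msign (c \<circ> bar x) u) * ((W x * P (c \<circ> bar x)) * W u)"
    by (intro eqv_mult_left eqv_mult_right P_conj assms)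
  also have "\<dots> = C (msign c x) * (W x * NN (c \<circ> bar x) u)"
    by (simp add: NN_def C_left_commute[of "W x"] C_collect mult.assoc)
  finally show ?thesis .
qed

lemma NN_append_right: "NN c (u @ y) = C (msign (c \<circ> bar u) y) * (NN c u * W y)"
  by (simp add: NN_def msign_append W_append mult.assoc C_collect mult.commute[of "msign c u"])

text \<open>The prefix \<open>x\<close> passes through the idempotent by recolouring it. The
  hypothesis is therefore required for all colourings, and the induction in \<open>NN_cox\<close>
  keeps \<open>c\<close> arbitrary.\<close>

lemma NN_cox_cong:
  assumes "valid n x" "\<And>c. NN c u \<doteq> NN c v" "bar u = bar v"
  shows "NN c (x @ u @ y) \<doteq> NN c (x @ v @ y)"
proof -
  let ?d = "c \<circ> bar x"
  have "NN c (x @ u @ y) \<doteq> C (msign c x) * (W x * NN ?d (u @ y))"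
    by (rule NN_append) (rule assms)
  also have "\<dots> \<doteq> C (msign c x) * (W x * NN ?d (v @ y))"
    unfolding NN_append_right assms(3) by (intro eqv_mult_left eqv_mult_right assms)
  also have "\<dots> \<doteq> NN c (x @ v @ y)"
    by (rule eqv_sym[OF NN_append]) (rule assms)
  finally show ?thesis .
qed

lemma P_square:
  assumes "1 \<le> i" "i < n"
  shows "P c * W [(i, True), (i, True)] \<doteq> C (eps c i (Suc i)) * P c"
proof -
  have "P c * W [(i, True), (i, True)] \<doteq> P c * W (tw i (Suc i))"
    by (intro eqv_mult_left square_eqv_tw assms)
  also have "\<dots> \<doteq> C (eps c i (Suc i)) * P c"
    using assms by (intro P_absorb) (auto simp: pair_def)
  finally show ?thesis .
qed

lemma NN_sign:
  assumes "1 \<le> i" "i < n"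
  shows "NN c [(i, True)] \<doteq> NN c [(i, False)]"
proof -
  let ?e = "eps c i (Suc i)"
  \<comment> \<open>sigma_i is sigma_i^2 times its inverse, and the idempotent turns the square into
    the scalar \<open>?e\<close>, which is exactly the quotient of the two signs.\<close>
  have sgn: "msign c [(i, True)] * ?e = msign c [(i, False)]"
    by (auto simp: eps_def sg_def yd_sign_def)
  have "W ([(i, True)] @ [(i, True)] @ winv [(i, True)] @ []) \<doteq> W ([(i, True)] @ [])"
    using assms by (intro W_cancel) auto
  then have "W [(i, True)] \<doteq> W [(i, True), (i, True)] * W [(i, False)]"
    by (simp add: eqv_sym flip: W_append)
  then have "NN c [(i, True)] \<doteq> C (msign c [(i, True)]) * (P c * (W [(i, True), (i, True)] * W [(i, False)]))"
    unfolding NN_def by (intro eqv_mult_left)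
  also have "\<dots> = C (msign c [(i, True)]) * ((P c * W [(i, True), (i, True)]) * W [(i, False)])"
    by (simp add: mult.assoc)
  also have "\<dots> \<doteq> C (msign c [(i, True)]) * ((C ?e * P c) * W [(i, False)])"
    by (intro eqv_mult_left eqv_mult_right P_square assms)
  also have "\<dots> = NN c [(i, False)]"
    unfolding NN_def sgn[symmetric] by (simp only: C_mult mult.assoc)
  finally show ?thesis .
qed

lemma NN_cox: "cox_eq n u v \<Longrightarrow> NN c u \<doteq> NN c v"
proof (induction arbitrary: c rule: cox_eq.induct)
  case (cox_sym u v)
  then show ?case using eqv_sym by blast
next
  case (cox_trans u v w)
  then show ?case using eqv_trans by blast
next
  case (cox_cong u v x y)
  then show ?case using cox_eq_bar by (intro NN_cox_cong) auto
next
  case (cox_sign i s t)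
  then show ?case using NN_sign[of i c] eqv_sym by (cases s; cases t) auto
next
  case (cox_square i)
  have "NN c [(i, True), (i, True)] \<doteq> C (msign c [(i, True), (i, True)]) * (C (eps c i (Suc i)) * P c)"
    unfolding NN_def by (intro eqv_mult_left P_square cox_square)
  also have "\<dots> = NN c []"
    unfolding msign_double by (auto simp: NN_def eps_def C_collect)
  finally show ?case .
next
  case (cox_far i j)
  then show ?case unfolding NN_def msign_far[OF cox_far(2)]
    by (intro eqv_mult_left W_far)
next
  case (cox_braid i)
  then show ?case unfolding NN_def msign_braid
    by (intro eqv_mult_left W_braid)
qed auto

end

section \<open>Recolouring by braids, and words with the same effect on a colouring\<close>

lemma ex_word_recolour:
  assumes "mset (lst n c) = mset (lst n d)"
  shows "\<exists>g. valid n g \<and> (\<forall>k\<in>{1..n}. c (bar g k) = d k)"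
proof -
  obtain p where p: "p permutes {..<n}" "permute_list p (lst n c) = lst n d"
    using mset_eq_permutation[OF assms[symmetric]] by auto
  \<comment> \<open>\<open>permute_list\<close> permutes 0-based list positions; \<open>q\<close> is
    the same permutation on the 1-based positions of \<open>bar\<close>.\<close>
  define q where "q k = (if k \<in> {1..n} then Suc (p (k - 1)) else k)" for k
  have "bij_betw q {1..n} {1..n}"
  proof (rule bij_betwI[where g = "\<lambda>k. Suc (inv p (k - 1))"])
    have "p x < n \<longleftrightarrow> x < n" "inv p x < n \<longleftrightarrow> x < n" for x
      using permutes_in_image[OF p(1), of x] permutes_in_image[OF permutes_inv[OF p(1)], of x] by auto
    then show "q \<in> {1..n} \<rightarrow> {1..n}" "(\<lambda>k. Suc (inv p (k - 1))) \<in> {1..n} \<rightarrow> {1..n}"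
      "\<And>x. x \<in> {1..n} \<Longrightarrow> Suc (inv p (q x - 1)) = x"
      "\<And>y. y \<in> {1..n} \<Longrightarrow> q (Suc (inv p (y - 1))) = y"
      using permutes_inverses[OF p(1)] by (auto simp: q_def Suc_le_eq)
  qed
  then have "q permutes {1..n}"
    by (rule bij_imp_permutes) (auto simp: q_def)
  then obtain e where e: "set e \<subseteq> {1..<n}" "bar (pos e) = q"
    using permutation_lift by blast
  have "c (bar (pos e) k) = d k" if k: "k \<in> {1..n}" for k
  proof -
    obtain l where l: "k = Suc l" "l < n" using k by (cases k) auto
    then have "p l < n" using permutes_in_image[OF p(1), of l] by auto
    then have "c (Suc (p l)) = permute_list p (lst n c) ! l"
      using l p(1) by (simp add: permute_list_nth)
    then show ?thesis using p(2) l k by (simp add: e q_def)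
  qed
  then show ?thesis using e by (intro exI[of _ "pos e"]) (auto simp: valid_pos)
qed

context magma_identities
begin

abbreviation seg :: "nat \<Rightarrow> nat \<Rightarrow> bool" where
  "seg i \<equiv> \<lambda>k. k \<notin> {1..i}"

lemma QS_absorb:
  assumes "i < n" "1 \<le> j" "j < n" "j \<noteq> i"
  shows "QS i * W [(j, True)] \<doteq> QS i"
proof -
  let ?F = "QS i * W [(j, True)] - QS i"
  obtain l where l: "j = l + 1" using assms(2) by (cases j) auto
  have "cf ?F = (\<lambda>w. conv (qseg rho pl n i) (delta [(l + 1, True)]) w - qseg rho pl n i w)"
    by (auto simp: cf_diff cf_mult cf_W cf_QS l)
  moreover have "\<dots> \<in> V3 rho pl n"
  proof -
    have "l + 2 \<le> n" "l + 1 \<noteq> i" using assms l by auto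
    then show ?thesis unfolding V3_def using assms(1) by blast
  qed
  ultimately have "?F \<doteq> 0" by (intro V3_eqv_0) simp
  then show ?thesis by (simp add: eqv_iff_diff[of "QS i * W [(j, True)]"])
qed

text \<open>Leaving out the letter i gives the positive words of the Young subgroup S_i x S_(n-i),
  the stabiliser of the segment colouring.\<close>

lemma P_seg_absorb:
  assumes "1 \<le> i" "i < n" "set d \<subseteq> {1..<n} - {i}"
  shows "P (seg i) * W (pos d) \<doteq> P (seg i)"
  using assms(3)
proof (induction d)
  case Nil
  then show ?case by simp
next
  case (Cons j d)
  have Q: "P (seg i) \<doteq> QS i" using QI_eqv_P[of "{1..i}"] assms by (simp add: QS_def eqv_sym)
  have "P (seg i) * W (pos (j # d)) \<doteq> (P (seg i) * W [(j, True)]) * W (pos d)"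
    by (simp add: mult.assoc flip: W_append)
  also have "\<dots> \<doteq> (QS i * W [(j, True)]) * W (pos d)" by (intro eqv_mult_right Q)
  also have "\<dots> \<doteq> QS i * W (pos d)" using Cons.prems assms by (intro eqv_mult_right QS_absorb) auto
  also have "\<dots> \<doteq> P (seg i) * W (pos d)" by (intro eqv_mult_right eqv_sym[OF Q])
  also have "\<dots> \<doteq> P (seg i)" using Cons by auto
  finally show ?case .
qed

text \<open>Without the letter i only neighbours of equal colour are exchanged, in the segment
  colouring as well as in its complement.\<close>

lemma seg_pos:
  assumes "1 \<le> i" "set d \<subseteq> {1..<n} - {i}"
  shows "seg i \<circ> bar (pos d) = seg i" "msign (seg i) (pos d) = (1 :: 'k)"
    "msign (\<lambda>k. \<not> seg i k) (pos d) = (1 :: 'k)"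
proof -
  have t: "transp j k \<in> {Suc 0..i} \<longleftrightarrow> k \<in> {Suc 0..i}" if "1 \<le> j" "j \<noteq> i" for j k
    using that by (auto simp: transp_def)
  show "seg i \<circ> bar (pos d) = seg i"
    using assms(2) by (induction d) (auto simp: fun_eq_iff t simp del: atLeastAtMost_iff)
  have "msign c (pos d) = (1 :: 'k)" if "\<And>j k. 1 \<le> j \<Longrightarrow> j \<noteq> i \<Longrightarrow> c (transp j k) = c k" for c
    using assms(2)
  proof (induction d)
    case (Cons j d)
    have "c \<circ> transp j = c" using that Cons.prems by (auto simp: fun_eq_iff)
    moreover have "c (Suc j) = c j" using that[of j j] Cons.prems by auto
    ultimately show ?case using Cons by (simp add: sg_def yd_sign_def)
  qed simp
  from this[of "seg i"] this[of "\<lambda>k. \<not> seg i k"]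
  show "msign (seg i) (pos d) = (1 :: 'k)" "msign (\<lambda>k. \<not> seg i k) (pos d) = (1 :: 'k)"
    using t by auto
qed

text \<open>The permutation of \<open>u @ winv v\<close> preserves {1..i}. It splits into
  permutations \<open>p1\<close>, \<open>p2\<close> of the two blocks, each lifted to letters of its
  own block, so up to Coxeter equivalence \<open>u\<close> is \<open>v\<close> with a prefix that
  the idempotent absorbs and that has sign 1 on both colourings.\<close>

lemma seg_transport:
  assumes i: "1 \<le> i" "i < n" and u: "valid n u" and v: "valid n v"
    and eq: "\<And>k. k \<in> {1..n} \<Longrightarrow> seg i (bar u k) = seg i (bar v k)"
  shows "NN (seg i) u \<doteq> NN (seg i) v" "msign2 (seg i) u = (msign2 (seg i) v :: 'k)"
proof -
  define p where "p = bar (u @ winv v)"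
  have p: "p permutes {1..n}" unfolding p_def using u v by (intro bar_permutes) simp
  have p_seg: "p k \<in> {1..i} \<longleftrightarrow> k \<in> {1..i}" if "k \<in> {1..n}" for k
  proof -
    have "bar (winv v) k \<in> {1..n}" using that v bar_range[of n "winv v" k] by simp
    from eq[OF this] show ?thesis by (auto simp: p_def)
  qed
  have p_out: "k \<notin> {1..n} \<Longrightarrow> p k = k" for k using p by (simp add: permutes_def)
  define p1 where "p1 k = (if k \<in> {1..i} then p k else k)" for k
  define p2 where "p2 k = (if k \<in> {i+1..n} then p k else k)" for k
  have inj: "inj p" using p permutes_inj by blast
  have "p1 permutes {1..i}"
  proof (rule bij_imp_permutes)
    have "p ` {1..i} \<subseteq> {1..i}" using p_seg i by auto
    then have "p ` {1..i} = {1..i}" using inj by (intro endo_inj_surj) (auto intro: inj_on_subset)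
    then have "bij_betw p {1..i} {1..i}" using inj_on_subset[OF inj subset_UNIV] by (simp add: bij_betw_def)
    then show "bij_betw p1 {1..i} {1..i}" by (rule bij_betw_cong[THEN iffD1, rotated]) (auto simp: p1_def)
  qed (auto simp: p1_def)
  then obtain d1 where d1: "set d1 \<subseteq> {1..<i}" "bar (pos d1) = p1" using permutation_lift by blast
  have "p2 permutes {i+1..n}"
  proof (rule bij_imp_permutes)
    have "p ` {i+1..n} \<subseteq> {i+1..n}"
    proof
      fix l assume "l \<in> p ` {i+1..n}"
      then obtain k where k: "k \<in> {i+1..n}" "l = p k" by blast
      then have "p k \<in> {1..n}" using permutes_in_image[OF p, of k] by auto
      then show "l \<in> {i+1..n}" using p_seg[of k] k by auto
    qed
    then have "p ` {i+1..n} = {i+1..n}" using inj by (intro endo_inj_surj) (auto intro: inj_on_subset)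
    then have "bij_betw p {i+1..n} {i+1..n}" using inj_on_subset[OF inj subset_UNIV] by (simp add: bij_betw_def)
    then show "bij_betw p2 {i+1..n} {i+1..n}" by (rule bij_betw_cong[THEN iffD1, rotated]) (auto simp: p2_def)
  qed (auto simp: p2_def)
  then obtain d2 where d2: "set d2 \<subseteq> {i+1..<n}" "bar (pos d2) = p2"
    using permutation_lift[of p2 "i + 1" n] by auto
  let ?d = "d1 @ d2"
  have d: "set ?d \<subseteq> {1..<n} - {i}" using d1 d2 i by auto
  have "p1 (p2 k) = p k" for k
  proof -
    consider "k \<in> {1..i}" | "k \<in> {i+1..n}" | "k \<notin> {1..n}" using i by fastforce
    then show ?thesis
    proof cases
      case 2
      then have "p k \<notin> {1..i}" using p_seg[of k] by auto
      then show ?thesis using 2 by (auto simp: p1_def p2_def)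
    next
      case 3
      then show ?thesis using i p_out[of k] by (auto simp: p1_def p2_def)
    qed (auto simp: p1_def p2_def)
  qed
  then have "bar u x = bar (pos ?d @ v) x" for x
    using fun_cong[OF d1(2), of "p2 (bar v x)"] fun_cong[OF d2(2), of "bar v x"] by (simp add: p_def)
  then have "bar u = bar (pos ?d @ v)" by blast
  moreover have vd: "valid n (pos ?d @ v)" using d v i by (auto simp: valid_pos)
  ultimately have cox: "cox_eq n u (pos ?d @ v)" using cox_eq_if_bar_eq u by blast
  note s = seg_pos[OF i(1) d]
  have "NN (seg i) u \<doteq> NN (seg i) (pos ?d @ v)" by (rule NN_cox[OF cox])
  also have "\<dots> = C (msign (seg i) v) * ((P (seg i) * W (pos ?d)) * W v)"
    unfolding NN_def msign_append s W_append by (simp add: mult.assoc)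
  also have "\<dots> \<doteq> NN (seg i) v"
    unfolding NN_def by (intro eqv_mult_left eqv_mult_right P_seg_absorb i d)
  finally show "NN (seg i) u \<doteq> NN (seg i) v" .
  have "msign2 (seg i) u = (msign2 (seg i) (pos ?d @ v) :: 'k)" by (rule cox_eq_msign2[OF cox])
  also have "\<dots> = msign2 (seg i) v"
    unfolding msign2_append s(1) unfolding msign2_def s(2,3) by simp
  finally show "msign2 (seg i) u = (msign2 (seg i) v :: 'k)" .
qed

lemma msign2_cong:
  "valid n w \<Longrightarrow> (\<And>k. k \<in> {1..n} \<Longrightarrow> c k = d k) \<Longrightarrow> msign2 c w = (msign2 d w :: 'k)"
  unfolding msign2_def by (intro arg_cong2[of _ _ _ _ times] msign_cong[of n]) auto

text \<open>A braid \<open>g\<close> carries \<open>c\<close> to the segment colouring of the same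
  weight, and \<open>seg_transport\<close> is applied to \<open>winv g @ u\<close> and
  \<open>winv g @ v\<close>.\<close>

lemma transport:
  assumes c: "\<not> monochrome c" and u: "valid n u" and v: "valid n v"
    and eq: "\<And>k. k \<in> {1..n} \<Longrightarrow> c (bar u k) = c (bar v k)"
  shows "NN c u \<doteq> NN c v" "msign2 c u = (msign2 c v :: 'k)"
proof -
  \<comment> \<open>\<open>seg i\<close> is False on {1..i}, so i has to be the number of False
    values; both colours occur, whence 1 \<le> i < n.\<close>
  define i where "i = count (mset (lst n c)) False"
  have "1 \<le> i \<and> i < n"
  proof -
    obtain k where k: "k \<in> {1..n}" "c k \<noteq> c 1" using c unfolding monochrome_def by blast
    have mem: "c l \<in> set (lst n c)" if "l \<in> {1..n}" for l using that by (auto simp: lst_def simp del: upt_Suc)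
    have "False \<in> set (lst n c)" "True \<in> set (lst n c)"
      using mem[OF k(1)] mem[of 1] k(2) n2 by (cases "c k"; cases "c 1"; simp)+
    moreover have "count (mset (lst n c)) False + count (mset (lst n c)) True = n"
    proof -
      have "count (mset xs) False + count (mset xs) True = length xs" for xs
        by (induction xs) auto
      then show ?thesis by simp
    qed
    ultimately show ?thesis unfolding i_def
      by (metis One_nat_def Suc_leI count_greater_zero_iff less_add_same_cancel1 set_mset_mset)
  qed
  then have i: "1 \<le> i" "i < n" by auto
  have "mset (lst n c) = mset (lst n (seg i))"
  proof (rule multiset_eqI)
    fix b
    have T: "count (mset xs) True = length xs - count (mset xs) False" for xs :: "bool list"
    proof -
      have "count (mset xs) False + count (mset xs) True = length xs" by (induction xs) auto
      then show ?thesis by simp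
    qed
    have "lst n (seg i) = replicate i False @ replicate (n - i) True"
      using i by (intro nth_equalityI) (auto simp: nth_append)
    then have "count (mset (lst n (seg i))) False = i" by simp
    then show "count (mset (lst n c)) b = count (mset (lst n (seg i))) b"
      by (cases b) (simp_all add: T i_def)
  qed
  from ex_word_recolour[OF this]
  obtain g where g: "valid n g" "\<forall>k\<in>{1..n}. c (bar g k) = seg i k" by (elim exE conjE)
  let ?c = "c \<circ> bar g"
  have cg: "?c k = seg i k" if "k \<in> {1..n}" for k using bspec[OF g(2) that] by simp
  have red: "NN c w \<doteq> C (msign c g) * (W g * NN (seg i) (winv g @ w))"
      "msign2 c w = (msign2 c g * msign2 (seg i) (winv g @ w) :: 'k)" if w: "valid n w" for w
  proof -
    have v': "valid n (winv g @ w)" using g w by simp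
    have cox: "cox_eq n w (g @ winv g @ w)"
      using g w by (intro cox_eq_if_bar_eq) (auto simp: fun_eq_iff)
    have "NN c w \<doteq> NN c (g @ winv g @ w)" by (rule NN_cox[OF cox])
    also have "\<dots> \<doteq> C (msign c g) * (W g * NN ?c (winv g @ w))" by (rule NN_append[OF g(1)])
    also have "NN ?c (winv g @ w) = NN (seg i) (winv g @ w)" by (rule NN_cong[OF v' cg])
    finally show "NN c w \<doteq> C (msign c g) * (W g * NN (seg i) (winv g @ w))" .
    have "msign2 c w = (msign2 c (g @ winv g @ w) :: 'k)" by (rule cox_eq_msign2[OF cox])
    also have "\<dots> = msign2 c g * msign2 ?c (winv g @ w)" by (rule msign2_append)
    also have "msign2 ?c (winv g @ w) = (msign2 (seg i) (winv g @ w) :: 'k)" by (rule msign2_cong[OF v' cg])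
    finally show "msign2 c w = (msign2 c g * msign2 (seg i) (winv g @ w) :: 'k)" .
  qed
  have st: "seg i (bar (winv g @ u) k) = seg i (bar (winv g @ v) k)" if k: "k \<in> {1..n}" for k
  proof -
    have "seg i (bar (winv g @ w) k) = c (bar w k)" if "valid n w" for w
    proof -
      have "bar (winv g @ w) k \<in> {1..n}" using k g that bar_range[of n "winv g @ w" k] by simp
      from bspec[OF g(2) this] show ?thesis by simp
    qed
    then show ?thesis using u v eq[OF k] by simp
  qed
  have "valid n (winv g @ u)" "valid n (winv g @ v)" using g u v by auto
  note st' = seg_transport[OF i this st]
  have "NN c u \<doteq> C (msign c g) * (W g * NN (seg i) (winv g @ u))" by (rule red[OF u])
  also have "\<dots> \<doteq> C (msign c g) * (W g * NN (seg i) (winv g @ v))"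
    by (intro eqv_mult_left st')
  also have "\<dots> \<doteq> NN c v" by (rule eqv_sym[OF red(1)[OF v]])
  finally show "NN c u \<doteq> NN c v" .
  show "msign2 c u = (msign2 c v :: 'k)" using red(2)[OF u] red(2)[OF v] st'(2) by simp
qed

section \<open>Annihilation of identities by the idempotents, and completeness\<close>

lemma Q0_absorb: "valid n u \<Longrightarrow> Q0 * W u \<doteq> Q0"
proof (induction u)
  case (Cons g u)
  obtain i s where g: "g = (i, s)" by (cases g)
  have i: "1 \<le> i" "i < n" using Cons.prems g by auto
  have T: "Q0 * W [(i, True)] \<doteq> Q0" using QS_absorb[of 0 i] i n2 by (simp add: QS_def)
  \<comment> \<open>The generators only provide positive letters; an inverse letter is absorbed by
    inserting its positive partner first.\<close>
  have "Q0 * W [(i, False)] \<doteq> Q0"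
  proof -
    have "Q0 * W [(i, False)] \<doteq> (Q0 * W [(i, True)]) * W [(i, False)]"
      by (intro eqv_mult_right eqv_sym[OF T])
    also have "\<dots> = Q0 * (W [(i, True)] * W (winv [(i, True)]))" by (simp add: mult.assoc)
    also have "\<dots> \<doteq> Q0 * 1" using i by (intro eqv_mult_left W_winv) simp
    finally show ?thesis by simp
  qed
  with T have "Q0 * W [g] \<doteq> Q0" by (cases s) (auto simp: g)
  then have "Q0 * W [g] * W u \<doteq> Q0 * W u" by (rule eqv_mult_right)
  also have "\<dots> \<doteq> Q0" using Cons by auto
  finally show ?case by (simp add: mult.assoc flip: W_append)
qed simp

lemma Ev_sum_words: "Ev n F y x = (\<Sum>w\<in>{w. cf F w \<noteq> 0}. cf F w * Eop n w y x)"
  by (rule Ev_superset[OF finite_cf order_refl])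

text \<open>Words with equal column index \<open>kap w\<close> in the row of \<open>c\<close> have
  the same \<open>NN\<close> by \<open>transport\<close>. The coefficient collected in front of it
  is the entry of the operator of \<open>F\<close> in that row and column, which is 0.\<close>

lemma P_annihilates:
  assumes F: "vsupp n F" "\<And>y x. Ev n F y x = 0" and c: "\<not> monochrome c"
  shows "P c * F \<doteq> 0"
proof -
  let ?S = "{w. cf F w \<noteq> 0}"
  define kap where "kap w = lst n (c \<circ> bar w)" for w
  have v: "w \<in> ?S \<Longrightarrow> valid n w" for w using F(1) by (simp add: vsupp_def)
  have Eop: "Eop n w (lst n c) x = (if x = kap w then msign c w else 0 :: 'k)" if "w \<in> ?S" for w x
  proof -
    have "msign (col (lst n c)) w = (msign c w :: 'k)" by (intro msign_cong[OF v[OF that]]) simp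
    then show ?thesis using v[OF that] by (simp add: Eop_eq lst_col_lst kap_def)
  qed
  have "P c * F = P c * (\<Sum>w\<in>?S. C (cf F w) * W w)" by (subst fa_expand[of F]) (rule refl)
  \<comment> \<open>The sign occurs twice, once explicitly and once inside \<open>NN\<close>, and
    cancels.\<close>
  also have "\<dots> = (\<Sum>w\<in>?S. C (cf F w * msign c w) * NN c w)"
    by (simp add: sum_distrib_left C_left_commute[of "P c"] NN_def C_collect mult.assoc)
  also have "\<dots> = (\<Sum>x\<in>kap ` ?S. \<Sum>w\<in>{w\<in>?S. kap w = x}. C (cf F w * msign c w) * NN c w)"
    by (rule sum.image_gen) (rule finite_cf)
  also have "\<dots> \<doteq> (\<Sum>x\<in>kap ` ?S. 0)"
  proof (rule eqv_sum)
    fix x assume "x \<in> kap ` ?S"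
    then obtain w0 where w0: "w0 \<in> ?S" "x = kap w0" by blast
    have fin: "finite ?S" by (rule finite_cf)
    have "(\<Sum>w\<in>{w\<in>?S. kap w = x}. cf F w * msign c w) = Ev n F (lst n c) x"
      unfolding Ev_sum_words
      by (rule sum.mono_neutral_cong_left) (use fin Eop in auto)
    then have z: "(\<Sum>w\<in>{w\<in>?S. kap w = x}. cf F w * msign c w) = 0" using F(2) by simp
    have "(\<Sum>w\<in>{w\<in>?S. kap w = x}. C (cf F w * msign c w) * NN c w)
        \<doteq> (\<Sum>w\<in>{w\<in>?S. kap w = x}. C (cf F w * msign c w) * NN c w0)"
    proof (intro eqv_sum eqv_mult_left transport(1)[OF c])
      fix w k assume w: "w \<in> {w\<in>?S. kap w = x}" and k: "k \<in> {1..n}"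
      then have "lst n (c \<circ> bar w) = lst n (c \<circ> bar w0)" using w0(2) by (simp add: kap_def)
      then show "c (bar w k) = c (bar w0 k)" using k unfolding lst_eq_iff by auto
    qed (use v w0 in auto)
    also have "\<dots> = 0" by (simp only: sum_distrib_right[symmetric] C_sum[symmetric] z C_0 mult_zero_left)
    finally show "(\<Sum>w\<in>{w\<in>?S. kap w = x}. C (cf F w * msign c w) * NN c w) \<doteq> 0" .
  qed
  finally show ?thesis by simp
qed

text \<open>Every word fixes the vector a \<otimes> ... \<otimes> a with sign 1, so the
  corresponding diagonal entry of \<open>F\<close> is the sum of its coefficients. Since
  \<open>Q0\<close> absorbs all words, this sum is also the factor left in front of
  \<open>Q0\<close>.\<close>

lemma Q0_annihilates:
  assumes F: "vsupp n F" "\<And>y x. Ev n F y x = 0"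
  shows "Q0 * F \<doteq> 0"
proof -
  let ?S = "{w. cf F w \<noteq> 0}" and ?y = "replicate n False"
  have v: "w \<in> ?S \<Longrightarrow> valid n w" for w using F(1) by (simp add: vsupp_def)
  have "Eop n w ?y ?y = (1 :: 'k)" if "w \<in> ?S" for w
  proof -
    have "lst n (col ?y \<circ> bar w) = ?y"
    proof (rule lst_fix)
      fix k assume "k \<in> {1..n}"
      then have "bar w k \<in> {1..n}" using bar_range[OF v[OF that]] by blast
      then show "(col ?y \<circ> bar w) k = col ?y k" using \<open>k \<in> {1..n}\<close> by (auto simp: col_def)
    qed simp
    moreover have "msign (col ?y) w = (1 :: 'k)"
      by (rule msign_const[OF v[OF that], of _ False]) (auto simp: col_def)
    ultimately show ?thesis using v[OF that] by (simp add: Eop_eq)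
  qed
  then have z: "(\<Sum>w\<in>?S. cf F w) = 0" using F(2)[of ?y ?y] unfolding Ev_sum_words by simp
  have "Q0 * F = Q0 * (\<Sum>w\<in>?S. C (cf F w) * W w)" by (subst fa_expand[of F]) (rule refl)
  also have "\<dots> = (\<Sum>w\<in>?S. C (cf F w) * (Q0 * W w))"
    by (simp add: sum_distrib_left C_left_commute[of Q0])
  also have "\<dots> \<doteq> (\<Sum>w\<in>?S. C (cf F w) * Q0)"
    by (intro eqv_sum eqv_mult_left Q0_absorb v)
  also have "\<dots> = 0" by (simp only: sum_distrib_right[symmetric] C_sum[symmetric] z C_0 mult_zero_left)
  finally show ?thesis .
qed

theorem V3_complete:
  assumes "is_identity n (f :: bword \<Rightarrow> 'k)"
  shows "in_ideal G n f"
proof -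
  have fin: "fin_el n f" and ev: "Eval n f = (\<lambda>y x. 0)" using assms by (auto simp: is_identity_def)
  obtain F where F: "cf F = f" using fin ex_cf[of f] by (auto simp: fin_el_def)
  have vF: "vsupp n F" using fin F fin_el_cf by blast
  have evF: "Ev n F y x = 0" for y x using ev F by (simp add: Ev_def)
  have QI: "QI I * F \<doteq> 0" if "I \<in> Xi n" for I
  proof -
    have "\<exists>k\<in>{1..n}. k \<notin> I" "1 \<in> I" using that by (auto simp: Xi_def)
    then have "\<not> monochrome (\<lambda>k. k \<notin> I)" by (auto simp: monochrome_def)
    then have "P (\<lambda>k. k \<notin> I) * F \<doteq> 0" using P_annihilates vF evF by blast
    moreover have "QI I * F \<doteq> P (\<lambda>k. k \<notin> I) * F" by (intro eqv_mult_right QI_eqv_P)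
    ultimately show ?thesis using eqv_trans by blast
  qed
  have "F = Q0 * F + (\<Sum>I\<in>Xi n. QI I * F)"
    by (simp add: Q0_def left_diff_distrib sum_distrib_right)
  also have "\<dots> \<doteq> 0 + (\<Sum>I\<in>Xi n. 0)"
    by (intro eqv_add eqv_sum Q0_annihilates vF evF QI)
  finally have "F \<doteq> 0" by simp
  then show ?thesis using in_ideal_if_eqv_0 vF F by blast
qed

end

section \<open>Codimensions\<close>

lemma card_bool_lists:
  "card {z. length z = m \<and> count (mset z) True = k} = m choose k"
proof (induction m arbitrary: k)
  case 0
  have "{z. length z = 0 \<and> count (mset z) True = k} = (if k = 0 then {[]} else {})" by auto
  then show ?case by simp
next
  case (Suc m)
  let ?A = "\<lambda>m k. {z. length z = m \<and> count (mset z) True = k}"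
  have fin: "finite (?A m k)" for k by (rule finite_subset[OF _ finite_length[of m]]) auto
  have "?A (Suc m) k = (#) False ` ?A m k \<union> (#) True ` {z. length z = m \<and> Suc (count (mset z) True) = k}"
    (is "_ = ?F \<union> ?T")
  proof (intro set_eqI)
    fix z show "z \<in> ?A (Suc m) k \<longleftrightarrow> z \<in> ?F \<union> ?T"
    proof (cases z)
      case (Cons b z')
      then show ?thesis by (cases b) auto
    qed auto
  qed
  moreover have "?F \<inter> ?T = {}" by auto
  moreover have "card ?F = m choose k" using Suc by (simp add: card_image)
  moreover have "card ?T = (if k = 0 then 0 else m choose (k - 1))"
    using Suc[of "k - 1"] by (cases k) (auto simp: card_image)
  moreover have "finite ?T" by (rule finite_imageI, rule finite_subset[OF _ finite_length[of m]]) auto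
  ultimately show ?case using fin[of k] by (cases k) (simp_all add: card_Un_disjoint)
qed

lemma count_bool: "count (mset z) False + count (mset z) True = length z"
  by (induction z) auto

lemma count_map_Not: "count (mset (map Not z)) True = count (mset z) False"
  by (induction z) auto

lemma mset_bool_eq_iff:
  assumes "length x = length y"
  shows "mset x = mset y \<longleftrightarrow> count (mset x) True = count (mset y) True"
proof
  assume *: "count (mset x) True = count (mset y) True"
  show "mset x = mset y"
  proof (rule multiset_eqI)
    fix b show "count (mset x) b = count (mset y) b"
      using * assms count_bool[of x] count_bool[of y] by (cases b) auto
  qed
qed simp

lemma map_Not_Not [simp]: "map Not (map Not z) = z"
  by (simp add: o_def)

definition isoweight :: "nat \<Rightarrow> (bool list \<times> bool list) set" where
  "isoweight n = {(y, x). length y = n \<and> length x = n \<and> mset y = mset x}"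

lemma finite_isoweight: "finite (isoweight n)"
  by (rule finite_subset[of _ "{z. length z = n} \<times> {z. length z = n}"])
    (auto simp: isoweight_def finite_length)

text \<open>Complementing \<open>y\<close> turns equality of weights into the condition that
  \<open>x @ map Not y\<close> has exactly n letters True; this is the bijective proof of
  Vandermonde's identity for the central binomial coefficient.\<close>

lemma card_isoweight: "card (isoweight n) = (2 * n) choose n"
proof -
  let ?A = "{z. length z = 2 * n \<and> count (mset z) True = n}"
  have c: "count (mset (x @ map Not y)) True = n \<longleftrightarrow> mset y = mset x"
    if "length x = n" "length y = n" for x y
    using that count_bool[of y] mset_bool_eq_iff[of y x] by (simp only: mset_append count_union count_map_Not) auto
  have "bij_betw (\<lambda>(y, x). x @ map Not y) (isoweight n) ?A"
  proof (rule bij_betwI[where g = "\<lambda>z. (map Not (drop n z), take n z)"])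
    show "(\<lambda>(y, x). x @ map Not y) \<in> isoweight n \<rightarrow> ?A"
    proof (intro funcsetI)
      fix p assume "p \<in> isoweight n"
      then show "(case p of (y, x) \<Rightarrow> x @ map Not y) \<in> ?A"
        using c[of "snd p" "fst p"]
        by (simp add: isoweight_def case_prod_unfold del: mset_map mset_append)
    qed
    show "(\<lambda>z. (map Not (drop n z), take n z)) \<in> ?A \<rightarrow> isoweight n"
    proof (intro funcsetI)
      fix z assume "z \<in> ?A"
      then show "(map Not (drop n z), take n z) \<in> isoweight n"
        using c[of "take n z" "map Not (drop n z)"]
        by (simp add: isoweight_def o_def del: mset_map mset_append)
    qed
  qed (auto simp: isoweight_def o_def)
  then have "card (isoweight n) = card ?A" by (rule bij_betw_same_card)
  then show ?thesis by (simp add: card_bool_lists)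
qed

text \<open>One representative of each pair modulo simultaneous complementation, for n \<ge> 1: the
  one whose row starts with False.\<close>

definition half_isoweight :: "nat \<Rightarrow> (bool list \<times> bool list) set" where
  "half_isoweight n = {(y, x) \<in> isoweight n. \<not> y ! 0}"

lemma card_half_isoweight:
  assumes "1 \<le> n"
  shows "2 * card (half_isoweight n) = (2 * n) choose n"
proof -
  let ?T = "{(y, x) \<in> isoweight n. y ! 0}"
  have m: "mset (map Not y) = mset (map Not x)" if "mset y = mset x" for x y
    using that by simp
  have "bij_betw (\<lambda>(y, x). (map Not y, map Not x)) (half_isoweight n) ?T"
    by (rule bij_betwI[where g = "\<lambda>(y, x). (map Not y, map Not x)"])
      (use assms m in \<open>auto simp: half_isoweight_def isoweight_def o_def Suc_le_eq\<close>)
  then have "card (half_isoweight n) = card ?T" by (rule bij_betw_same_card)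
  moreover have "card (isoweight n) = card (half_isoweight n) + card ?T"
  proof -
    have fin: "finite (half_isoweight n)" "finite ?T"
      by (rule finite_subset[OF _ finite_isoweight[of n]], auto simp: half_isoweight_def)+
    have "half_isoweight n \<union> ?T = isoweight n" "half_isoweight n \<inter> ?T = {}"
      by (auto simp: half_isoweight_def)
    with card_Un_disjoint[OF fin] show ?thesis by metis
  qed
  ultimately show ?thesis using card_isoweight[of n] by simp
qed

section \<open>The vector space of operators, and the cases m \<noteq> n and n \<le> 1\<close>

abbreviation mat_scale :: "'k \<Rightarrow> 'k mat \<Rightarrow> 'k::field mat" where
  "mat_scale \<equiv> \<lambda>c A y x. c * A y x"

interpretation mat: vector_space "mat_scale :: 'k::field \<Rightarrow> 'k mat \<Rightarrow> 'k mat"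
  by standard (auto simp: fun_eq_iff algebra_simps)

lemma sum_mat_apply: "(\<Sum>a\<in>A. f a) y x = (\<Sum>a\<in>A. f a y x :: 'k::field)"
  by (induction A rule: infinite_finite_induct) auto

lemma codim_eq: "codim TYPE('k::field) m n = mat.dim (Eop n ` mor m n :: 'k mat set)"
  by (simp add: codim_def)

lemma codim_neq: "m \<noteq> n \<Longrightarrow> codim TYPE('k::field) m n = 0"
  using mat.dim_eq_card_independent[OF mat.independent_empty]
  by (simp add: codim_eq mor_def)

lemma codim_le_1:
  assumes "n \<le> 1"
  shows "codim TYPE('k::field) n n = 1"
proof -
  have "mor n n = {[]}" using valid_le_1[OF _ assms] by (auto simp: mor_def)
  moreover have "(Eop n [] :: 'k mat) \<noteq> 0"
  proof
    assume "(Eop n [] :: 'k mat) = 0"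
    then have "Eop n [] (replicate n False) (replicate n False) = (0 :: 'k)" by simp
    then show False by (simp add: Eop_Nil)
  qed
  then have "mat.independent {Eop n [] :: 'k mat}" by (simp only: mat.dependent_single) simp
  ultimately show ?thesis
    using mat.dim_eq_card_independent[of "{Eop n [] :: 'k mat}"] by (simp add: codim_eq)
qed

lemma Ev_in_span:
  assumes "vsupp n F"
  shows "Ev n F \<in> mat.span (Eop n ` mor n n)"
proof -
  have "Ev n F = (\<Sum>w\<in>{w. cf F w \<noteq> 0}. mat_scale (cf F w) (Eop n w))"
    by (auto simp: fun_eq_iff sum_mat_apply Ev_superset[OF finite_cf order_refl])
  also have "\<dots> \<in> mat.span (Eop n ` mor n n)"
    using assms by (intro mat.span_sum mat.span_scale mat.span_base) (auto simp: vsupp_def mor_def)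
  finally show ?thesis .
qed

lemma col_map_Not: "k \<in> {1..n} \<Longrightarrow> length y = n \<Longrightarrow> col (map Not y) k \<longleftrightarrow> \<not> col y k"
  by (auto simp: col_def)

section \<open>A basis of the span of the operators\<close>

context magma_identities
begin

text \<open>The idempotent of the colour partition of \<open>y\<close>, or \<open>Q0\<close> if
  \<open>y\<close> is constant, keeps exactly the two rows that induce this partition.\<close>

lemma ex_pair_projection:
  assumes y: "length y = n"
  shows "\<exists>D :: wd \<Rightarrow>\<^sub>0 'k. vsupp n D \<and> acts_diag n D (\<lambda>z. if z = y \<or> z = map Not y then 1 else 0)"
proof -
  have eqs: "z = y \<longleftrightarrow> (\<forall>k\<in>{1..n}. col z k = col y k)"
    "z = map Not y \<longleftrightarrow> (\<forall>k\<in>{1..n}. col z k \<noteq> col y k)" if z: "length z = n" for z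
  proof -
    show "z = y \<longleftrightarrow> (\<forall>k\<in>{1..n}. col z k = col y k)"
      using lst_eq_iff[of n "col z" "col y"] y z by simp
    show "z = map Not y \<longleftrightarrow> (\<forall>k\<in>{1..n}. col z k \<noteq> col y k)"
      using lst_eq_iff[of n "col z" "col (map Not y)"] y z col_map_Not[OF _ y] by simp
  qed
  have n: "1 \<in> {1..n}" using n2 by simp
  show ?thesis
  proof (cases "monochrome (col y)")
    case True
    have "monochrome (col z) \<longleftrightarrow> z = y \<or> z = map Not y" if z: "length z = n" for z
      using True n unfolding eqs[OF z] monochrome_def by metis
    then have "acts_diag n Q0 (\<lambda>z. if z = y \<or> z = map Not y then 1 else 0)"
      using acts_diag_Q0 by (simp add: acts_diag_def)
    then show ?thesis using vsupp_Q0 by blast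
  next
    case False
    define I where "I = {k \<in> {1..n}. col y k = col y 1}"
    have "bicol I (col z) \<longleftrightarrow> z = y \<or> z = map Not y" if z: "length z = n" for z
    proof -
      have "bicol I (col z) \<longleftrightarrow> (\<forall>i\<in>{1..n}. \<forall>j\<in>{1..n}. col z i \<noteq> col z j \<longleftrightarrow> col y i \<noteq> col y j)"
        unfolding bicol_def I_def by blast
      also have "\<dots> \<longleftrightarrow> z = y \<or> z = map Not y"
        unfolding eqs[OF z]
      proof
        assume "\<forall>i\<in>{1..n}. \<forall>j\<in>{1..n}. col z i \<noteq> col z j \<longleftrightarrow> col y i \<noteq> col y j"
        then have "\<forall>k\<in>{1..n}. col z k \<noteq> col z 1 \<longleftrightarrow> col y k \<noteq> col y 1" using n by blast
        then show "(\<forall>k\<in>{1..n}. col z k = col y k) \<or> (\<forall>k\<in>{1..n}. col z k \<noteq> col y k)" by blast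
      qed blast
      finally show ?thesis .
    qed
    then have "acts_diag n (QI I) (\<lambda>z. if z = y \<or> z = map Not y then 1 else 0)"
      using acts_diag_QI[of I] by (simp add: acts_diag_def)
    then show ?thesis using vsupp_QI by blast
  qed
qed

text \<open>Makes the entries of \<open>basis_mat\<close> independent of the word chosen by
  \<open>word_of\<close>. If both colours occur this is \<open>transport\<close>; on a constant
  colouring and its complement all signs are 1.\<close>

lemma msign2_unique:
  assumes "valid n u" "valid n v" "lst n (c \<circ> bar u) = lst n (c \<circ> bar v)"
  shows "msign2 c u = (msign2 c v :: 'k)"
proof (cases "monochrome c")
  case True
  then have c: "c k = c 1" if "k \<in> {1..n}" for k using that unfolding monochrome_def by blast
  then have "(\<not> c k) = (\<not> c 1)" if "k \<in> {1..n}" for k using that by blast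
  with c have "msign c w = (1 :: 'k)" "msign (\<lambda>k. \<not> c k) w = (1 :: 'k)" if "valid n w" for w
    using msign_const[OF that, of c "c 1"] msign_const[OF that, of "\<lambda>k. \<not> c k" "\<not> c 1"] by blast+
  then show ?thesis using assms by (simp add: msign2_def)
next
  case False
  have "c (bar u k) = c (bar v k)" if "k \<in> {1..n}" for k
    using assms(3) that unfolding lst_eq_iff by simp
  from transport(2)[OF False assms(1,2) this] show ?thesis .
qed

definition word_of :: "bool list \<Rightarrow> bool list \<Rightarrow> bword" where
  "word_of y x = (SOME w. valid n w \<and> lst n (col y \<circ> bar w) = x)"

lemma word_of:
  assumes "(y, x) \<in> isoweight n"
  shows "valid n (word_of y x)" "lst n (col y \<circ> bar (word_of y x)) = x"
proof -
  have "mset (lst n (col y)) = mset (lst n (col x))" using assms by (simp add: isoweight_def)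
  then obtain w where "valid n w" "\<forall>k\<in>{1..n}. col y (bar w k) = col x k"
    using ex_word_recolour by blast
  moreover from this have "lst n (col y \<circ> bar w) = x"
    using assms by (intro lst_fix) (simp_all add: isoweight_def)
  ultimately have "valid n w \<and> lst n (col y \<circ> bar w) = x" by blast
  from someI[of "\<lambda>w. valid n w \<and> lst n (col y \<circ> bar w) = x", OF this]
  show "valid n (word_of y x)" "lst n (col y \<circ> bar (word_of y x)) = x"
    unfolding word_of_def by blast+
qed

text \<open>Two matrix units in complementary positions, tied by the relative sign: any word that
  has \<open>x\<close> as its column in row \<open>y\<close> has these two entries up to a common
  factor.\<close>

definition basis_mat :: "bool list \<times> bool list \<Rightarrow> 'k mat" where
  "basis_mat p z t = (case p of (y, x) \<Rightarrow> (if z = y \<and> t = x then 1 else 0) +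
     (if z = map Not y \<and> t = map Not x then msign2 (col y) (word_of y x) else 0))"

lemma Eop_map_Not:
  assumes "length y = n" "valid n w"
  shows "Eop n w (map Not y) t =
    (if t = map Not (lst n (col y \<circ> bar w)) then msign (\<lambda>k. \<not> col y k) w else 0 :: 'k)"
proof -
  have "col (map Not y) k \<longleftrightarrow> \<not> col y k" if "k \<in> {1..n}" for k by (rule col_map_Not[OF that assms(1)])
  note c = this
  have "lst n (col (map Not y) \<circ> bar w) = map Not (lst n (col y \<circ> bar w))"
    using c bar_range[OF assms(2)] by (simp add: lst_def del: upt_Suc)
  moreover have "msign (col (map Not y)) w = (msign (\<lambda>k. \<not> col y k) w :: 'k)"
    by (rule msign_cong[OF assms(2) c])
  ultimately show ?thesis using assms by (simp add: Eop_eq)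
qed

text \<open>The projection cuts the operator of \<open>word_of y x\<close> down to the rows
  \<open>y\<close> and \<open>map Not y\<close>; the scalar \<open>msign (col y) ?w\<close>
  normalises the entry in row \<open>y\<close> to 1.\<close>

lemma basis_mat_in_span:
  assumes "(y, x) \<in> half_isoweight n"
  shows "basis_mat (y, x) \<in> mat.span (Eop n ` mor n n)"
proof -
  have yx: "(y, x) \<in> isoweight n" "\<not> y ! 0" and y: "length y = n"
    using assms by (auto simp: half_isoweight_def isoweight_def)
  note w = word_of[OF yx(1)]
  let ?w = "word_of y x"
  obtain D :: "wd \<Rightarrow>\<^sub>0 'k" where D: "vsupp n D" "acts_diag n D (\<lambda>z. if z = y \<or> z = map Not y then 1 else 0)"
    using ex_pair_projection[OF y] by blast
  have ne: "map Not y \<noteq> y" using yx y n2 by (cases y) auto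
  have "basis_mat (y, x) = mat_scale (msign (col y) ?w) (Ev n (D * W ?w))"
  proof (intro ext)
    fix z t
    show "basis_mat (y, x) z t = msign (col y) ?w * Ev n (D * W ?w) z t"
    proof (cases "length z = n")
      case False
      then show ?thesis using y by (auto simp: basis_mat_def Ev_wrong_length)
    next
      case True
      consider "z = y" | "z = map Not y" | "z \<noteq> y" "z \<noteq> map Not y" by blast
      then show ?thesis
      proof cases
        case 1
        then show ?thesis using ne acts_diagD[OF D(2) y, of "W ?w"] w y
          by (auto simp: basis_mat_def Ev_W Eop_eq)
      next
        case 2
        then show ?thesis using ne acts_diagD[OF D(2) True, of "W ?w"] w y
          by (auto simp: basis_mat_def Ev_W Eop_map_Not msign2_def)
      next
        case 3
        then show ?thesis using acts_diagD[OF D(2) True, of "W ?w"] by (simp add: basis_mat_def)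
      qed
    qed
  qed
  also have "\<dots> \<in> mat.span (Eop n ` mor n n)"
    using D w by (intro mat.span_scale Ev_in_span vsupp_intros)
  finally show ?thesis .
qed

lemma mset_lst_bar: 
  assumes "valid n w"
  shows "mset (lst n (c \<circ> bar w)) = mset (lst n c)"
proof -
  have "mset (lst n c) = image_mset c (mset_set {1..n})" for c :: "nat \<Rightarrow> bool"
    by (simp add: lst_def mset_upt atLeastLessThanSuc_atLeastAtMost del: upt_Suc)
  note m = this
  have "image_mset (c \<circ> bar w) (mset_set {1..n}) = image_mset c (image_mset (bar w) (mset_set {1..n}))"
    by (simp add: multiset.map_comp)
  also have "image_mset (bar w) (mset_set {1..n}) = mset_set (bar w ` {1..n})"
    by (rule image_mset_mset_set) (rule inj_on_subset[OF inj_bar subset_UNIV])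
  also have "bar w ` {1..n} = {1..n}" by (rule permutes_image[OF bar_permutes[OF assms]])
  finally show ?thesis by (simp only: m)
qed

text \<open>An operator is the sum of its parts in complementary pairs of rows. By
  \<open>msign2_unique\<close> the ratio of the two entries is the one built into
  \<open>basis_mat\<close>, so each part is a multiple of one basis matrix.\<close>

lemma Eop_in_span:
  assumes "valid n w"
  shows "(Eop n w :: 'k mat) \<in> mat.span (basis_mat ` half_isoweight n)"
proof -
  let ?Y = "{y. length y = n \<and> \<not> y ! 0}"
  let ?x = "\<lambda>y. lst n (col y \<circ> bar w)"
  have fin: "finite ?Y" by (rule finite_subset[OF _ finite_length[of n]]) auto
  have iso: "(y, ?x y) \<in> isoweight n" if "length y = n" for y
    using mset_lst_bar[OF assms, of "col y"] that by (simp add: isoweight_def)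
  have sgn: "msign (col y) w * msign2 (col y) (word_of y (?x y)) = (msign (\<lambda>k. \<not> col y k) w :: 'k)"
    if "length y = n" for y
  proof -
    have "msign2 (col y) (word_of y (?x y)) = (msign2 (col y) w :: 'k)"
      using word_of[OF iso[OF that]] assms by (intro msign2_unique) auto
    then show ?thesis by (simp add: msign2_def)
  qed
  have "(Eop n w :: 'k mat) = (\<Sum>y\<in>?Y. mat_scale (msign (col y) w) (basis_mat (y, ?x y)))"
  proof (intro ext)
    fix z t
    let ?f = "\<lambda>y. msign (col y) w * basis_mat (y, ?x y) z t"
    have "(\<Sum>y\<in>?Y. ?f y) = Eop n w z t"
    proof (cases "length z = n")
      case False
      then have "?f y = 0" if "y \<in> ?Y" for y using that by (auto simp: basis_mat_def)
      then have "(\<Sum>y\<in>?Y. ?f y) = 0" by (rule sum.neutral[OF ballI])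
      then show ?thesis using False by (simp add: Eop_wrong_length del: sum.neutral)
    next
      case z: True
      have z0: "map Not z ! 0 \<longleftrightarrow> \<not> z ! 0" using z n2 by (cases z) auto
      \<comment> \<open>The representative of the pair {z, complement of z} that starts with False;
        its summand is the only one that reaches row \<open>z\<close>.\<close>
      define y0 where "y0 = (if z ! 0 then map Not z else z)"
      have y0: "y0 \<in> ?Y" using z z0 by (auto simp: y0_def)
      have zero: "?f y = 0" if "y \<in> ?Y - {y0}" for y
      proof -
        have "z \<noteq> y" using that by (auto simp: y0_def)
        moreover have "z \<noteq> map Not y"
        proof
          assume "z = map Not y"
          then have "map Not z = y" by (simp add: o_def)
          then show False using that z0 by (auto simp: y0_def)
        qed
        ultimately show ?thesis by (simp add: basis_mat_def)
      qed
      have "(\<Sum>y\<in>?Y. ?f y) = (\<Sum>y\<in>{y0}. ?f y)"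
        by (rule sum.mono_neutral_right) (use fin y0 zero in auto)
      also have "\<dots> = ?f y0" by simp
      also have "\<dots> = Eop n w z t"
      proof (cases "z ! 0")
        case False
        then have "map Not z \<noteq> z" using z0 by metis
        then show ?thesis using False z assms by (auto simp: y0_def basis_mat_def Eop_eq)
      next
        case True
        have z': "z = map Not y0" using True by (simp add: y0_def o_def)
        have len: "length y0 = n" using y0 by simp
        have "y0 \<noteq> map Not y0" using z0 True z' by (metis map_Not_Not)
        then show ?thesis using sgn[OF len]
          unfolding z' by (simp add: basis_mat_def Eop_map_Not[OF len assms])
      qed
      finally show ?thesis .
    qed
    then show "Eop n w z t = (\<Sum>y\<in>?Y. mat_scale (msign (col y) w) (basis_mat (y, ?x y))) z t"
      by (simp add: sum_mat_apply)
  qed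
  also have "\<dots> \<in> mat.span (basis_mat ` half_isoweight n)"
    using iso by (intro mat.span_sum mat.span_scale mat.span_base) (auto simp: half_isoweight_def)
  finally show ?thesis .
qed

text \<open>The second matrix unit lies in a row starting with True, so it is invisible at the
  positions of \<open>half_isoweight n\<close>; evaluation there is dual to the basis.\<close>

lemma basis_mat_diag:
  assumes "p \<in> half_isoweight n" "q \<in> half_isoweight n"
  shows "basis_mat p (fst q) (snd q) = (if p = q then 1 else 0)"
proof -
  obtain y x z t where pq: "p = (y, x)" "q = (z, t)" by (cases p, cases q)
  have "z \<noteq> map Not y"
    using assms n2 by (cases y) (auto simp: pq half_isoweight_def isoweight_def)
  then show ?thesis by (auto simp: pq basis_mat_def)
qed

lemma inj_basis_mat: "inj_on basis_mat (half_isoweight n)"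
  using basis_mat_diag by (intro inj_onI) (metis zero_neq_one)

lemma finite_half_isoweight: "finite (half_isoweight n)"
  by (rule finite_subset[OF _ finite_isoweight[of n]]) (auto simp: half_isoweight_def)

lemma independent_basis_mat: "mat.independent (basis_mat ` half_isoweight n)"
proof (rule mat.independent_if_scalars_zero)
  show "finite (basis_mat ` half_isoweight n)" using finite_half_isoweight by simp
  fix f :: "'k mat \<Rightarrow> 'k" and A
  assume s: "(\<Sum>B\<in>basis_mat ` half_isoweight n. mat_scale (f B) B) = 0"
    and A: "A \<in> basis_mat ` half_isoweight n"
  then obtain q where q: "q \<in> half_isoweight n" "A = basis_mat q" by blast
  have "0 = (\<Sum>B\<in>basis_mat ` half_isoweight n. mat_scale (f B) B) (fst q) (snd q)"
    unfolding s by simp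
  also have "\<dots> = (\<Sum>p\<in>half_isoweight n. f (basis_mat p) * basis_mat p (fst q) (snd q))"
    by (simp add: sum_mat_apply sum.reindex[OF inj_basis_mat])
  also have "\<dots> = (\<Sum>p\<in>half_isoweight n. if p = q then f (basis_mat p) else 0)"
    using q by (intro sum.cong) (auto simp: basis_mat_diag)
  also have "\<dots> = f A" using q finite_half_isoweight by simp
  finally show "f A = 0" by simp
qed

theorem codim_ge_2: "2 * codim TYPE('k) n n = (2 * n) choose n"
proof -
  have "mat.span (basis_mat ` half_isoweight n) = mat.span (Eop n ` mor n n :: 'k mat set)"
    unfolding mat.span_eq using basis_mat_in_span Eop_in_span by (auto simp: mor_def)
  then have "codim TYPE('k) n n = card (basis_mat ` half_isoweight n)"
    unfolding codim_eq by (rule mat.dim_eq_card[OF _ independent_basis_mat])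
  also have "\<dots> = card (half_isoweight n)" by (rule card_image[OF inj_basis_mat])
  finally show ?thesis using card_half_isoweight n2 by simp
qed

end

section \<open>Asymptotics of the central binomial coefficients\<close>

text \<open>The coefficients of (1 - 4x)^(-1/2) are the central binomial coefficients; in this form
  the Gamma asymptotics of generalised binomials apply.\<close>

lemma gbinomial_minus_half:
  "((- (1 / 2) :: real) gchoose n) = (- 1) ^ n * real ((2 * n) choose n) / 4 ^ n"
proof (induction n)
  case (Suc n)
  \<comment> \<open>Two absorptions and one use of symmetry give the recurrence with ratio
    2(2n+1)/(n+1), kept free of division in the naturals.\<close>
  have "Suc n * (Suc (Suc (2 * n)) choose Suc n) = Suc (Suc (2 * n)) * (Suc (2 * n) choose n)"
    by (rule Suc_times_binomial)
  also have "Suc (2 * n) choose n = Suc (2 * n) choose Suc n"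
    using binomial_symmetric[of n "Suc (2 * n)"] by simp
  finally have "Suc n * (Suc n * (Suc (Suc (2 * n)) choose Suc n)) =
      Suc (Suc (2 * n)) * (Suc n * (Suc (2 * n) choose Suc n))" by (simp only: ac_simps)
  also have "Suc n * (Suc (2 * n) choose Suc n) = Suc (2 * n) * (2 * n choose n)"
    by (rule Suc_times_binomial)
  finally have "Suc n * (Suc n * ((2 * Suc n) choose Suc n)) = Suc (Suc (2 * n)) * (Suc (2 * n) * ((2 * n) choose n))"
    by simp
  moreover have "real A = 2 * (2 * real n + 1) * real B / (real n + 1)"
    if "Suc n * (Suc n * A) = Suc (Suc (2 * n)) * (Suc (2 * n) * B)" for A B
  proof -
    have "real (Suc n * (Suc n * A)) = real (Suc (Suc (2 * n)) * (Suc (2 * n) * B))"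
      by (simp only: that)
    then have "(real n + 1) * ((real n + 1) * real A) = (real n + 1) * (2 * (2 * real n + 1) * real B)"
      by (simp add: algebra_simps)
    then have "(real n + 1) * real A = 2 * (2 * real n + 1) * real B" by simp
    then show ?thesis by (simp add: field_simps)
  qed
  ultimately have rec: "real ((2 * Suc n) choose Suc n) = 2 * (2 * real n + 1) * real ((2 * n) choose n) / (real n + 1)"
    by blast
  have "((- (1 / 2) :: real) gchoose Suc n) = ((- (1 / 2) - real n) / (real n + 1)) * (- (1 / 2) gchoose n)"
    using gbinomial_mult_1[of "- (1 / 2) :: real" n] by (simp add: field_simps)
  moreover have "(- (1 / 2) - r) / (r + 1) * (a * b / p) = - a * (2 * (2 * r + 1) * b / (r + 1)) / (4 * p)"
    if "p \<noteq> 0" "r + 1 \<noteq> 0" for a b p r :: real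
    using that by (simp add: divide_simps) (simp add: algebra_simps)
  ultimately show ?case unfolding Suc.IH rec by simp
qed simp

text \<open>The limit for the exponent -1/2 is 1 / Gamma(1/2) = 1 / sqrt pi, and the normalising
  power is n^(1/2); multiplying by sqrt pi turns the quotient into the required one with limit
  1.\<close>

lemma central_binomial_asymp_equiv:
  "(\<lambda>n. real ((2 * n) choose n)) \<sim>[at_top] (\<lambda>n. 4 ^ n / sqrt (pi * real n))"
proof (rule asymp_equivI')
  have "(\<lambda>n. ((- (1 / 2) :: real) gchoose n) / ((- 1) ^ n / exp ((- (1 / 2) + 1) * ln (real n))))
      \<longlonglongrightarrow> inverse (Gamma (1 / 2))"
    using gbinomial_asymptotic[of "- (1 / 2) :: real"] by simp
  then have "(\<lambda>n. sqrt pi * (((- (1 / 2) :: real) gchoose n) / ((- 1) ^ n / exp ((- (1 / 2) + 1) * ln (real n)))))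
      \<longlonglongrightarrow> sqrt pi * inverse (sqrt pi)"
    unfolding Gamma_one_half_real by (rule tendsto_mult_left)
  then have "(\<lambda>n. sqrt pi * (((- (1 / 2) :: real) gchoose n) / ((- 1) ^ n / exp ((- (1 / 2) + 1) * ln (real n)))))
      \<longlonglongrightarrow> 1" by simp
  moreover have "\<forall>\<^sub>F n in at_top. sqrt pi * (((- (1 / 2) :: real) gchoose n) / ((- 1) ^ n / exp ((- (1 / 2) + 1) * ln (real n))))
      = real ((2 * n) choose n) / (4 ^ n / sqrt (pi * real n))"
    using eventually_gt_at_top[of 0]
  proof eventually_elim
    case (elim n)
    have "exp ((- (1 / 2) + 1) * ln (real n)) = sqrt (real n)"
      using elim by (simp add: powr_half_sqrt[symmetric] powr_def)
    moreover have "(- 1 :: real) ^ n * (- 1) ^ n = 1" by (simp flip: power_mult_distrib)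
    ultimately show ?case by (simp add: gbinomial_minus_half real_sqrt_mult)
  qed
  ultimately show "(\<lambda>n. real ((2 * n) choose n) / (4 ^ n / sqrt (pi * real n))) \<longlonglongrightarrow> 1"
    by (rule Lim_transform_eventually)
qed

theorem mainTheorem13:
  fixes rho :: "nat \<Rightarrow> nat \<Rightarrow> nat \<Rightarrow> bword"
    and pl :: "nat \<Rightarrow> (nat \<times> nat) list"
  assumes char: "(2::'k::field) \<noteq> 0"
    and rho_ok: "\<And>n i j. 2 \<le> n \<Longrightarrow> 1 \<le> i \<Longrightarrow> i < j \<Longrightarrow> j \<le> n \<Longrightarrow>
                   valid n (rho n i j) \<and> bar (rho n i j) 1 = i \<and> bar (rho n i j) 2 = j"
    and pl_ok: "\<And>n. distinct (pl n) \<and> set (pl n) = {(i, j). 1 \<le> i \<and> i < j \<and> j \<le> n}"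
  shows "generates_identities (V3 rho pl :: nat \<Rightarrow> (bword \<Rightarrow> 'k) set)
         \<and> (\<forall>m n. m \<noteq> n \<longrightarrow> codim TYPE('k) m n = 0)
         \<and> codim TYPE('k) 0 0 = 1 \<and> codim TYPE('k) 1 1 = 1
         \<and> (\<forall>n\<ge>2. 2 * codim TYPE('k) n n = (2 * n) choose n)
         \<and> (\<lambda>n. real (codim TYPE('k) n n)) \<sim>[at_top] (\<lambda>n. 4 ^ n / (2 * sqrt (pi * real n)))"
proof -
  have M: "magma_identities (V3 rho pl :: nat \<Rightarrow> (bword \<Rightarrow> 'k) set) n rho pl" if "2 \<le> n" for n
    using char rho_ok[OF that] pl_ok[of n] that by unfold_locales auto
  have "is_identity n f" if "f \<in> V3 rho pl n" for n and f :: "bword \<Rightarrow> 'k"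
  proof -
    have "2 \<le> n" using that by (auto simp: V3_def)
    from magma_identities.V3_sound[OF M[OF this] that] show ?thesis .
  qed
  moreover have "in_ideal (V3 rho pl) n f" if f: "is_identity n f" for n and f :: "bword \<Rightarrow> 'k"
  proof (cases "2 \<le> n")
    case True
    from magma_identities.V3_complete[OF M[OF this] f] show ?thesis .
  next
    case False
    \<comment> \<open>On fewer than two strands only the empty word is valid and acts as the
      identity, so an identity has all coefficients 0.\<close>
    have v: "f w \<noteq> 0 \<Longrightarrow> w = []" for w
      using f valid_le_1[of n w] False by (auto simp: is_identity_def fin_el_def)
    let ?y = "replicate n False"
    have "0 = Eval n f ?y ?y" using f by (simp add: is_identity_def)
    also have "\<dots> = (\<Sum>w\<in>{[]}. f w * Eop n w ?y ?y)"
      unfolding Eval_def using v by (intro sum.mono_neutral_left) auto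
    finally have "f [] = 0" by (simp add: Eop_Nil)
    then have "f = (\<lambda>w. 0)" using v by metis
    then show ?thesis by (simp add: ii_zero)
  qed
  ultimately have "generates_identities (V3 rho pl :: nat \<Rightarrow> (bword \<Rightarrow> 'k) set)"
    unfolding generates_identities_def by blast
  moreover have c2: "\<forall>n\<ge>2. 2 * codim TYPE('k) n n = (2 * n) choose n"
    using magma_identities.codim_ge_2[OF M] by blast
  moreover have "(\<lambda>n. real (codim TYPE('k) n n)) \<sim>[at_top] (\<lambda>n. 4 ^ n / (2 * sqrt (pi * real n)))"
  proof -
    have "(\<lambda>n. real ((2 * n) choose n) * (1 / 2)) \<sim>[at_top] (\<lambda>n. 4 ^ n / sqrt (pi * real n) * (1 / 2))"
      by (intro asymp_equiv_intros central_binomial_asymp_equiv)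
    moreover have "\<forall>\<^sub>F n in at_top. real ((2 * n) choose n) * (1 / 2) = real (codim TYPE('k) n n)"
      using eventually_ge_at_top[of 2]
    proof eventually_elim
      case (elim n)
      then have "real ((2 * n) choose n) = real (2 * codim TYPE('k) n n)" using c2 by simp
      then show ?case by simp
    qed
    ultimately show ?thesis
      by (elim asymp_equiv_cong[THEN iffD1, rotated -1]) (simp_all add: mult.commute)
  qed
  ultimately show ?thesis
    using codim_neq codim_le_1[of 0] codim_le_1[of 1] by auto
qed

end
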